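(* Let $t\mapsto w(t)$ be a continuously differentiable solution of the spatially discretized ideal vorticity equation with velocity $\vec v(t)\in H^{\mathrm{Div}}(\tau_h)$ for every $t$, and assume: (i) either $w(t)\in H^1_{\tilde p}(\tau_h)$ and $w$ satisfies the continuous Galerkin formulation $$\int_\Omega \psi\,(\partial_t w+\vec v\cdot\nabla w)\,dV=0\qquad\forall\,\psi\in H^1_{\tilde p}(\tau_h),$$ or $w(t)\in L^2_{\tilde p}(\tau_h)$ and $w$ satisfies the discontinuous Galerkin formulation without upwinding $$\int_\Omega \eta\,(\partial_t w+\vec v\cdot\nabla w)\,dV-\int_\Gamma (\vec v\cdot\vec n_\Gamma)\,\{\eta\}\,[\![w]\!]\,dS=0\qquad\forall\,\eta\in L^2_{\tilde p}(\tau_h);$$ (ii) $\nabla\cdot\vec v=0$ in $\Omega$; (iii) $\int_{\partial\Omega}w^2\,\vec v\cdot\vec n_{\partial\Omega}\,dS=0$. Then enstrophy is conserved in continuous time: $$\frac{d}{dt}\int_\Omega w^2\,dV=0 .$$ Moreover, condition (iii) is met by periodic or homogeneous Dirichlet boundary conditions (or a mixture thereof) on $w$ and $\vec v\cdot\vec n_{\partial\Omega}$.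
   Context: $\Omega$ is a bounded polygonal/polyhedral domain with outward unit normal $\vec n_{\partial\Omega}$, and $\tau_h$ is a conforming finite element mesh of $\Omega$ with cells $K$. $\Gamma$ is the union of the internal faces between cells (periodically identified boundary faces count as internal faces), and $\vec n_\Gamma$ is a fixed unit normal on each face of $\Gamma$. For a piecewise smooth $\eta$, let $\eta^+$ and $\eta^-$ be the one-sided values on $\Gamma$ from the upwind side (the side $\vec n_\Gamma$ points out of) and the downwind side (the side $\vec n_\Gamma$ points into), respectively. The jump and average are $[\![\eta]\!]=\eta^+-\eta^-$ and $\{\eta\}=(\eta^++\eta^-)/2$. Spaces: $L^2_{q}(\tau_h)$ is the space of functions that are polynomial of order $\le q$ on each cell, possibly discontinuous across $\Gamma$; $H^1_{q}(\tau_h)$ is the subspace of continuous ones; $H^{\mathrm{Div}}(\tau_h)$ is the space of piecewise polynomial vector fields whose normal component is continuous across $\Gamma$. Derivatives such as $\nabla w$ and $\nabla\cdot\vec v$ are taken cell by cell. When homogeneous Dirichlet or periodic boundary conditions on $w$ are imposed, the trial and test spaces are the corresponding subspaces satisfying these conditions. *)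

theory Defs
  imports "HOL-Analysis.Analysis"
begin

text \<open>
  A pair \<open>(F, s)\<close> in \<open>periodic\<close> identifies the boundary facet \<open>F\<close> with its translate
  \<open>F + s\<close>. The field \<open>face_normal\<close> is the normal fixed on each face of \<open>\<Gamma>\<close>; an identified
  pair \<open>(F, s)\<close> is a single face of \<open>\<Gamma>\<close>, represented by \<open>F\<close>.
\<close>
record 'a fe_mesh =
  region :: "'a set"
  cells :: "'a set set"
  periodic :: "('a set \<times> 'a) set"
  face_normal :: "'a set \<Rightarrow> 'a"

definition outward_normal :: "'a::euclidean_space set \<Rightarrow> 'a set \<Rightarrow> 'a" where
  "outward_normal K F =
     (THE n. norm n = 1 \<and> (\<exists>c. K \<subseteq> {x. n \<bullet> x \<le> c} \<and> F = K \<inter> {x. n \<bullet> x = c}))"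

definition interior_facets :: "'a::euclidean_space fe_mesh \<Rightarrow> 'a set set" where
  "interior_facets M =
     {F. \<exists>K\<in>cells M. \<exists>K'\<in>cells M. K \<noteq> K' \<and> F facet_of K \<and> F facet_of K'}"

definition boundary_facets :: "'a::euclidean_space fe_mesh \<Rightarrow> 'a set set" where
  "boundary_facets M = {F. (\<exists>K\<in>cells M. F facet_of K) \<and> F \<subseteq> frontier (region M)}"

text \<open>Faces of \<open>\<Gamma>\<close> as pairs \<open>(F, s)\<close>, with \<open>s = 0\<close> for a face lying inside the domain.\<close>
definition gamma_faces :: "'a::euclidean_space fe_mesh \<Rightarrow> ('a set \<times> 'a) set" where
  "gamma_faces M = (\<lambda>F. (F, 0)) ` interior_facets M \<union> periodic M"

definition identified_facets :: "'a::euclidean_space fe_mesh \<Rightarrow> 'a set set" where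
  "identified_facets M = (\<Union>(F, s)\<in>periodic M. {F, (+) s ` F})"

text \<open>The facets of \<open>\<partial>\<Omega>\<close> that remain once the identified ones count as internal.\<close>
definition free_boundary_facets :: "'a::euclidean_space fe_mesh \<Rightarrow> 'a set set" where
  "free_boundary_facets M = boundary_facets M - identified_facets M"

definition polytopal_domain :: "'a::euclidean_space set \<Rightarrow> bool" where
  "polytopal_domain \<Omega> \<longleftrightarrow> \<Omega> \<noteq> {} \<and> open \<Omega> \<and> connected \<Omega> \<and> bounded \<Omega> \<and>
     interior (closure \<Omega>) = \<Omega> \<and>
     (\<exists>\<P>. finite \<P> \<and> (\<forall>P\<in>\<P>. polytope P) \<and> closure \<Omega> = \<Union>\<P>)"

text \<open>
  Disjointness of the interiors of distinct cells follows from the third conjunct: a common face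
  with nonempty interior is the whole cell.
\<close>
definition conforming_mesh :: "'a::euclidean_space set \<Rightarrow> 'a set set \<Rightarrow> bool" where
  "conforming_mesh \<Omega> \<T> \<longleftrightarrow> finite \<T> \<and>
     (\<forall>K\<in>\<T>. polytope K \<and> interior K \<noteq> {}) \<and>
     (\<forall>K\<in>\<T>. \<forall>K'\<in>\<T>. K \<inter> K' face_of K \<and> K \<inter> K' face_of K') \<and>
     \<Union>\<T> = closure \<Omega>"

definition periodic_identification :: "'a::euclidean_space fe_mesh \<Rightarrow> bool" where
  "periodic_identification M \<longleftrightarrow>
     (\<forall>(F, s)\<in>periodic M.
        F \<in> boundary_facets M \<and> (+) s ` F \<in> boundary_facets M \<and>
        (\<forall>K\<in>cells M. \<forall>K'\<in>cells M. F facet_of K \<longrightarrow> (+) s ` F facet_of K' \<longrightarrow>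
           outward_normal K' ((+) s ` F) = - outward_normal K F)) \<and>
     (\<forall>(F, s)\<in>periodic M. \<forall>(G, r)\<in>periodic M. (F, s) \<noteq> (G, r) \<longrightarrow>
        {F, (+) s ` F} \<inter> {G, (+) r ` G} = {})"

definition fe_mesh :: "'a::euclidean_space fe_mesh \<Rightarrow> bool" where
  "fe_mesh M \<longleftrightarrow> polytopal_domain (region M) \<and> conforming_mesh (region M) (cells M) \<and>
     periodic_identification M \<and>
     (\<forall>(F, s)\<in>gamma_faces M. norm (face_normal M F) = 1 \<and>
        (\<forall>x\<in>F. \<forall>y\<in>F. face_normal M F \<bullet> (x - y) = 0))"

definition trace_from :: "'a::euclidean_space set \<Rightarrow> ('a \<Rightarrow> 'b::t2_space) \<Rightarrow> 'a \<Rightarrow> 'b" where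
  "trace_from K f x = Lim (at x within interior K) f"

text \<open>
  The value on the side of the face \<open>(F, s)\<close> that \<open>n\<close> points out of. For an identified face that
  side is either at \<open>F\<close> (\<open>r = 0\<close>) or at \<open>F + s\<close> (\<open>r = s\<close>); the argument \<open>x\<close> always ranges over \<open>F\<close>.
\<close>
definition side_value ::
    "'a::euclidean_space fe_mesh \<Rightarrow> 'a set \<times> 'a \<Rightarrow> 'a \<Rightarrow> ('a \<Rightarrow> 'b::t2_space) \<Rightarrow> 'a \<Rightarrow> 'b" where
  "side_value M e n f x =
     (let (K, r) = (THE (K, r). K \<in> cells M \<and> r \<in> {0, snd e} \<and> (+) r ` fst e facet_of K \<and>
                       outward_normal K ((+) r ` fst e) = n)
      in trace_from K f (x + r))"

definition upwind_value ::
    "'a::euclidean_space fe_mesh \<Rightarrow> 'a set \<times> 'a \<Rightarrow> ('a \<Rightarrow> 'b::t2_space) \<Rightarrow> 'a \<Rightarrow> 'b" where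
  "upwind_value M e = side_value M e (face_normal M (fst e))"

definition downwind_value ::
    "'a::euclidean_space fe_mesh \<Rightarrow> 'a set \<times> 'a \<Rightarrow> ('a \<Rightarrow> 'b::t2_space) \<Rightarrow> 'a \<Rightarrow> 'b" where
  "downwind_value M e = side_value M e (- face_normal M (fst e))"

definition jump ::
    "'a::euclidean_space fe_mesh \<Rightarrow> 'a set \<times> 'a \<Rightarrow> ('a \<Rightarrow> real) \<Rightarrow> 'a \<Rightarrow> real" where
  "jump M e f x = upwind_value M e f x - downwind_value M e f x"

definition average ::
    "'a::euclidean_space fe_mesh \<Rightarrow> 'a set \<times> 'a \<Rightarrow> ('a \<Rightarrow> real) \<Rightarrow> 'a \<Rightarrow> real" where
  "average M e f x = (upwind_value M e f x + downwind_value M e f x) / 2"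

definition boundary_cell :: "'a::euclidean_space fe_mesh \<Rightarrow> 'a set \<Rightarrow> 'a set" where
  "boundary_cell M F = (THE K. K \<in> cells M \<and> F facet_of K)"

definition boundary_value ::
    "'a::euclidean_space fe_mesh \<Rightarrow> 'a set \<Rightarrow> ('a \<Rightarrow> 'b::t2_space) \<Rightarrow> 'a \<Rightarrow> 'b" where
  "boundary_value M F = trace_from (boundary_cell M F)"

definition boundary_normal :: "'a::euclidean_space fe_mesh \<Rightarrow> 'a set \<Rightarrow> 'a" where
  "boundary_normal M F = outward_normal (boundary_cell M F) F"

text \<open>Polynomials of total degree at most \<open>q\<close>, written over multi-indices \<open>\<alpha>\<close>.\<close>
definition poly_upto :: "nat \<Rightarrow> ('a::euclidean_space \<Rightarrow> real) set" where
  "poly_upto q =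
     {f. \<exists>c. f = (\<lambda>x. \<Sum>\<alpha> | (\<forall>b. b \<notin> Basis \<longrightarrow> \<alpha> b = (0::nat)) \<and> (\<Sum>b\<in>Basis. \<alpha> b) \<le> q.
                     c \<alpha> * (\<Prod>b\<in>Basis. (x \<bullet> b) ^ \<alpha> b))}"

text \<open>
  Functions are constrained on the open cells only; the values on the skeleton, a null set, are
  arbitrary in the discontinuous spaces and are never used: face terms go through traces.
\<close>
definition L2_space :: "'a::euclidean_space fe_mesh \<Rightarrow> nat \<Rightarrow> ('a \<Rightarrow> real) set" where
  "L2_space M q = {f. \<forall>K\<in>cells M. \<exists>p\<in>poly_upto q. \<forall>x\<in>interior K. f x = p x}"

text \<open>Continuity includes continuity across the identified facets.\<close>
definition H1_space :: "'a::euclidean_space fe_mesh \<Rightarrow> nat \<Rightarrow> ('a \<Rightarrow> real) set" where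
  "H1_space M q = {f \<in> L2_space M q. continuous_on (region M) f \<and>
     (\<forall>(F, s)\<in>periodic M. \<forall>x\<in>F. jump M (F, s) f x = 0)}"

definition Hdiv_space :: "'a::euclidean_space fe_mesh \<Rightarrow> ('a \<Rightarrow> 'a) set" where
  "Hdiv_space M = {v.
     (\<forall>K\<in>cells M. \<exists>p. polynomial_function p \<and> (\<forall>x\<in>interior K. v x = p x)) \<and>
     (\<forall>(F, s)\<in>gamma_faces M. \<forall>x\<in>F.
        upwind_value M (F, s) v x \<bullet> face_normal M F =
        downwind_value M (F, s) v x \<bullet> face_normal M F)}"

text \<open>
  The subspace with homogeneous Dirichlet values on the facets in \<open>D\<close> and matching values on the
  identified pairs in \<open>R\<close>. In a discontinuous space periodicity can also be left to the
  \<open>\<Gamma>\<close>-integral, which is the case \<open>R = {}\<close>.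
\<close>
definition with_bc ::
    "'a::euclidean_space fe_mesh \<Rightarrow> 'a set set \<Rightarrow> ('a set \<times> 'a) set \<Rightarrow>
     ('a \<Rightarrow> real) set \<Rightarrow> ('a \<Rightarrow> real) set" where
  "with_bc M D R V = {f \<in> V. (\<forall>F\<in>D. \<forall>x\<in>F. boundary_value M F f x = 0) \<and>
     (\<forall>(F, s)\<in>R. \<forall>x\<in>F. jump M (F, s) f x = 0)}"

text \<open>
  Integration against the \<open>(d - 1)\<close>-dimensional Lebesgue measure of a subset \<open>F\<close> of a hyperplane
  with unit normal \<open>n\<close>: by Fubini it is the \<open>d\<close>-dimensional integral over the cylinder of height
  one on \<open>F\<close> of the function extended constantly along \<open>n\<close>.
\<close>
definition surface_integral :: "'a::euclidean_space \<Rightarrow> 'a set \<Rightarrow> ('a \<Rightarrow> real) \<Rightarrow> real" where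
  "surface_integral n F g =
     (LINT y : {x + h *\<^sub>R n |x h. x \<in> F \<and> 0 \<le> h \<and> h \<le> 1} | lebesgue.
        g (closest_point (affine hull F) y))"

definition gamma_integral ::
    "'a::euclidean_space fe_mesh \<Rightarrow> ('a set \<times> 'a \<Rightarrow> 'a \<Rightarrow> real) \<Rightarrow> real" where
  "gamma_integral M g =
     (\<Sum>e\<in>gamma_faces M. surface_integral (face_normal M (fst e)) (fst e) (g e))"

definition boundary_flux ::
    "'a::euclidean_space fe_mesh \<Rightarrow> 'a set set \<Rightarrow> ('a \<Rightarrow> real) \<Rightarrow> ('a \<Rightarrow> 'a) \<Rightarrow> real" where
  "boundary_flux M B w v =
     (\<Sum>F\<in>B. surface_integral (boundary_normal M F) F
        (\<lambda>x. (boundary_value M F w x)\<^sup>2 * (boundary_value M F v x \<bullet> boundary_normal M F)))"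

text \<open>On piecewise polynomials these are the cellwise derivatives, off the skeleton.\<close>
definition grad :: "('a::euclidean_space \<Rightarrow> real) \<Rightarrow> 'a \<Rightarrow> 'a" where
  "grad f x = (\<Sum>b\<in>Basis. frechet_derivative f (at x) b *\<^sub>R b)"

definition divergence :: "('a::euclidean_space \<Rightarrow> 'a) \<Rightarrow> 'a \<Rightarrow> real" where
  "divergence v x = (\<Sum>b\<in>Basis. frechet_derivative v (at x) b \<bullet> b)"

text \<open>
  Continuous differentiability as a curve in \<open>L\<^sup>2(\<Omega>)\<close>; on a finite-dimensional finite element space
  every norm gives the same notion.
\<close>
definition C1_curve ::
    "'a::euclidean_space set \<Rightarrow> real set \<Rightarrow> (real \<Rightarrow> 'a \<Rightarrow> real) \<Rightarrow> (real \<Rightarrow> 'a \<Rightarrow> real) \<Rightarrow> bool" where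
  "C1_curve \<Omega> I w w' \<longleftrightarrow> (\<forall>t\<in>I.
     ((\<lambda>s. LINT x:\<Omega>|lebesgue. ((w s x - w t x) / (s - t) - w' t x)\<^sup>2) \<longlongrightarrow> 0) (at t within I) \<and>
     ((\<lambda>s. LINT x:\<Omega>|lebesgue. (w' s x - w' t x)\<^sup>2) \<longlongrightarrow> 0) (at t within I))"

definition cg_vorticity_eq ::
    "'a::euclidean_space fe_mesh \<Rightarrow> ('a \<Rightarrow> real) set \<Rightarrow>
     ('a \<Rightarrow> real) \<Rightarrow> ('a \<Rightarrow> real) \<Rightarrow> ('a \<Rightarrow> 'a) \<Rightarrow> bool" where
  "cg_vorticity_eq M V w w' v \<longleftrightarrow>
     (\<forall>\<psi>\<in>V. (LINT x:region M|lebesgue. \<psi> x * (w' x + v x \<bullet> grad w x)) = 0)"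

definition dg_vorticity_eq ::
    "'a::euclidean_space fe_mesh \<Rightarrow> ('a \<Rightarrow> real) set \<Rightarrow>
     ('a \<Rightarrow> real) \<Rightarrow> ('a \<Rightarrow> real) \<Rightarrow> ('a \<Rightarrow> 'a) \<Rightarrow> bool" where
  "dg_vorticity_eq M V w w' v \<longleftrightarrow>
     (\<forall>\<eta>\<in>V. (LINT x:region M|lebesgue. \<eta> x * (w' x + v x \<bullet> grad w x))
        - gamma_integral M (\<lambda>e x. (upwind_value M e v x \<bullet> face_normal M (fst e)) *
            average M e \<eta> x * jump M e w x) = 0)"

end

theory Submission
  imports Defs
begin

text \<open>
  Testing the scheme with \<open>w\<close> itself and using \<open>\<nabla> \<sqdot> v = 0\<close> gives
  \<open>\<integral> w \<partial>\<^sub>t w = -\<integral> w v \<sqdot> \<nabla>w = -\<onehalf> \<integral> \<nabla> \<sqdot> (w\<^sup>2 v)\<close> up to the face term of the discontinuous scheme.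
  By the divergence theorem on each cell the last integral is a sum of fluxes through facets; the
  two fluxes through a face of \<open>\<Gamma>\<close> combine to \<open>(v \<sqdot> n) [w\<^sup>2] = 2 (v \<sqdot> n) {w} [w]\<close>, which is
  zero for continuous \<open>w\<close> and cancels the face term otherwise, so only the flux through \<open>\<partial>\<Omega>\<close> remains.

  The divergence theorem for a polytope \<open>K\<close> and a field \<open>g e\<close> with \<open>e\<close> constant comes from comparing
  \<open>K\<close> with its translate \<open>K + T e\<close>: up to null sets, they differ by the prisms swept out by the facets
  of \<open>K\<close> along \<open>T e\<close>. A linear change of variables turns these slanted prisms into the right prisms
  in terms of which surface integrals are defined, and \<open>T\<close> tends to zero.
\<close>

subsection \<open>Volume under rank-one perturbations of the identity\<close>

text \<open>The route is dictated by \<open>surface_integral\<close>, which is itself a volume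
  integral over a right prism of height one: slanted prisms only have to be reduced to right ones.
  This is done by maps of the form identity plus a rank-one term. That such a map has a volume
  factor at all follows from translation invariance; its value is found by symmetry, conjugation
  with reflections reducing everything to the diagonal case. The comparison of K with its translate
  is a count on each line parallel to e. It can fail on lines that meet two facet hyperplanes in one
  point, or when an end of the chord sits exactly at parameter 0 or T; the exceptional points lie in
  finitely many hyperplanes. For polynomial fields the difference quotient along e extends
  continuously to T = 0, jointly in the point, so the limit is dominated convergence. The pairing of
  fluxes rests on the geometry of the mesh: a facet belongs either to exactly two cells, with
  opposite normals, or to one cell and the boundary. As w is differentiable in time only as a curve
  in the mean-square sense, the derivative of the enstrophy comes from an estimate of its difference
  quotient.\<close>

definition scales_volume :: "('a::euclidean_space \<Rightarrow> 'a) \<Rightarrow> ennreal \<Rightarrow> bool" where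
  "scales_volume T k \<longleftrightarrow> distr lborel borel T = density lborel (\<lambda>_. k)"

text \<open>The factor is the one for preimages, so for invertible \<open>T\<close> it is the
  reciprocal of the absolute determinant. The definition is an equality of measures because that
  form feeds \<open>integral_distr\<close> and \<open>integral_density\<close>.\<close>

lemma scales_volumeD:
  assumes "scales_volume T k" "linear T" "A \<in> sets borel"
  shows "emeasure lborel (T -` A) = k * emeasure lborel A"
proof -
  have T: "T \<in> borel_measurable borel"
    using assms(2) by (simp add: borel_measurable_continuous_onI linear_continuous_on linear_linear)
  have "emeasure (distr lborel borel T) A = emeasure (density lborel (\<lambda>_. k)) A"
    using assms(1) by (simp add: scales_volume_def)
  then show ?thesis
    using assms(3) T by (simp add: emeasure_distr emeasure_density nn_integral_cmult_indicator)
qed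

lemma scales_volumeI:
  fixes T :: "'a::euclidean_space \<Rightarrow> 'a"
  assumes "linear T" "\<And>A. A \<in> sets borel \<Longrightarrow> emeasure lborel (T -` A) = k * emeasure lborel A"
  shows "scales_volume T k"
  unfolding scales_volume_def
proof (rule measure_eqI)
  have T: "T \<in> borel_measurable borel"
    using assms(1) by (simp add: borel_measurable_continuous_onI linear_continuous_on linear_linear)
  fix A assume "A \<in> sets (distr lborel borel T)"
  then show "emeasure (distr lborel borel T) A = emeasure (density lborel (\<lambda>_. k)) A"
    using assms(2) T by (simp add: emeasure_distr emeasure_density nn_integral_cmult_indicator)
qed simp

lemma scales_volume_comp:
  assumes "scales_volume S k" "scales_volume T l" "linear S" "linear T"
  shows "scales_volume (S \<circ> T) (l * k)"
proof (rule scales_volumeI)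
  show "linear (S \<circ> T)" using assms by (simp add: linear_compose)
  fix A :: "'a set" assume A: "A \<in> sets borel"
  have "S -` A \<in> sets borel"
    using assms(3) A
    by (metis UNIV_I borel_measurable_continuous_onI linear_continuous_on linear_linear
        measurable_sets_borel)
  then show "emeasure lborel ((S \<circ> T) -` A) = l * k * emeasure lborel A"
    using scales_volumeD[OF assms(2,4)] scales_volumeD[OF assms(1,3) A]
    by (simp add: vimage_comp[symmetric] mult.assoc)
qed

lemma emeasure_lborel_ball_nontrivial:
  "emeasure lborel (ball (0::'a::euclidean_space) 1) \<noteq> 0"
  "emeasure lborel (ball (0::'a::euclidean_space) 1) \<noteq> \<infinity>"
  using content_ball_pos[of 1 "0::'a"]
  by (metis emeasure_eq_ennreal_measure ennreal_zero_neq_top less_irrefl measure_def enn2real_0 zero_less_one)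
     (metis emeasure_lborel_ball_finite infinity_ennreal_def less_irrefl)

text \<open>Evaluation on the unit ball: cancellation in \<open>ennreal\<close> needs a common
  factor that is neither 0 nor infinite.\<close>

lemma scales_volume_unique:
  assumes "scales_volume T k" "scales_volume T l" "linear T"
  shows "k = l"
proof -
  have "k * emeasure lborel (ball (0::'a) 1) = l * emeasure lborel (ball (0::'a) 1)"
    using scales_volumeD[OF assms(1,3), of "ball 0 1"] scales_volumeD[OF assms(2,3), of "ball 0 1"]
    by simp
  then show ?thesis
    using emeasure_lborel_ball_nontrivial[where 'a='a]
    by (simp add: mult.commute[of k] mult.commute[of l] ennreal_mult_cancel_left)
qed

lemma nn_integral_lborel_translate:
  fixes f :: "'a::euclidean_space \<Rightarrow> ennreal"
  assumes [measurable]: "f \<in> borel_measurable borel"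
  shows "(\<integral>\<^sup>+x. f (x + c) \<partial>lborel) = (\<integral>\<^sup>+x. f x \<partial>lborel)"
proof -
  have "(\<integral>\<^sup>+x. f x \<partial>lborel) = (\<integral>\<^sup>+x. f x \<partial>distr lborel borel ((+) c))"
    by (simp add: lborel_distr_plus)
  also have "\<dots> = (\<integral>\<^sup>+x. f (x + c) \<partial>lborel)"
    by (subst nn_integral_distr) (auto simp: add.commute)
  finally show ?thesis ..
qed

text \<open>
  Uniqueness of Haar measure: for \<open>B\<close> the unit ball, evaluate
  \<open>\<integral>\<integral> 1\<^sub>A(T y) 1\<^sub>B(x - T y)\<close> in both orders and use translation invariance.
\<close>
lemma linear_scales_volume:
  fixes T :: "'a::euclidean_space \<Rightarrow> 'a"
  assumes lin: "linear T" and surj: "surj T"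
  obtains k where "scales_volume T k"
proof -
  define B where "B = ball (0::'a) 1"
  have [measurable]: "T \<in> borel_measurable borel"
    using lin by (simp add: borel_measurable_continuous_onI linear_continuous_on linear_linear)
  have [measurable]: "B \<in> sets borel" by (simp add: B_def)
  define b where "b = emeasure lborel B"
  have b: "b \<noteq> 0" "b \<noteq> \<infinity>"
    using emeasure_lborel_ball_nontrivial[where 'a='a] by (auto simp: b_def B_def)
  define k where "k = emeasure lborel (T -` B) / b"
  have "emeasure lborel (T -` A) = k * emeasure lborel A" if [measurable]: "A \<in> sets borel" for A
  proof -
    have TA: "T -` A \<in> sets borel" "T -` B \<in> sets borel"
      by (metis \<open>T \<in> borel_measurable borel\<close> measurable_sets_borel that)
         (metis \<open>T \<in> borel_measurable borel\<close> \<open>B \<in> sets borel\<close> measurable_sets_borel)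
    have "emeasure lborel (T -` A) * b = (\<integral>\<^sup>+y. indicator (T -` A) y * b \<partial>lborel)"
      using TA by (simp add: nn_integral_multc)
    also have "\<dots> = (\<integral>\<^sup>+y. (\<integral>\<^sup>+x. indicator A (T y) * indicator B (x - T y) \<partial>lborel) \<partial>lborel)"
    proof (rule nn_integral_cong)
      fix y
      have "(\<integral>\<^sup>+x. indicator B (x - T y) \<partial>lborel) = b"
        using nn_integral_lborel_translate[of "indicator B" "- T y"] by (simp add: b_def)
      then show "indicator (T -` A) y * b =
          (\<integral>\<^sup>+x. indicator A (T y) * indicator B (x - T y) \<partial>lborel)"
        by (subst nn_integral_cmult) (auto simp: indicator_def)
    qed
    also have "\<dots> = (\<integral>\<^sup>+x. (\<integral>\<^sup>+y. indicator A (T y) * indicator B (x - T y) \<partial>lborel) \<partial>lborel)"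
      by (rule lborel_pair.Fubini') measurable
    also have "\<dots> = (\<integral>\<^sup>+x. (\<integral>\<^sup>+y. indicator A (T y + x) * indicator B (- T y) \<partial>lborel) \<partial>lborel)"
    proof (rule nn_integral_cong)
      fix x
      \<comment> \<open>This is where surjectivity enters: shifting y by a preimage of x turns
        \<open>T y\<close> into \<open>T y + x\<close>, and \<open>x - T y\<close> into
        \<open>- T y\<close>.\<close>
      obtain z where z: "x = T z" using surj by (metis surjD)
      show "(\<integral>\<^sup>+y. indicator A (T y) * indicator B (x - T y) \<partial>lborel) =
        (\<integral>\<^sup>+y. indicator A (T y + x) * indicator B (- T y) \<partial>lborel)"
        by (subst nn_integral_lborel_translate[of _ z, symmetric])
           (auto simp: z linear_add[OF lin] intro!: nn_integral_cong)
    qed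
    also have "\<dots> = (\<integral>\<^sup>+y. (\<integral>\<^sup>+x. indicator A (T y + x) * indicator B (- T y) \<partial>lborel) \<partial>lborel)"
      by (rule lborel_pair.Fubini'[symmetric]) measurable
    also have "\<dots> = (\<integral>\<^sup>+y. emeasure lborel A * indicator (T -` B) y \<partial>lborel)"
    proof (rule nn_integral_cong)
      fix y
      have "(\<integral>\<^sup>+x. indicator A (T y + x) \<partial>lborel) = emeasure lborel A"
        using nn_integral_lborel_translate[of "indicator A" "T y"] by (simp add: add.commute)
      \<comment> \<open>The ball is symmetric about 0, so \<open>- T y\<close> may be replaced by
        \<open>T y\<close>.\<close>
      then show "(\<integral>\<^sup>+x. indicator A (T y + x) * indicator B (- T y) \<partial>lborel) =
          emeasure lborel A * indicator (T -` B) y"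
        by (subst nn_integral_multc) (auto simp: indicator_def B_def)
    qed
    also have "\<dots> = emeasure lborel A * emeasure lborel (T -` B)"
      using TA by (simp add: nn_integral_cmult)
    also have "emeasure lborel (T -` B) = k * b"
      using b by (simp add: k_def ennreal_divide_times ennreal_divide_self less_top)
    finally have "emeasure lborel (T -` A) * b = (k * emeasure lborel A) * b"
      by (simp add: mult_ac)
    then show ?thesis
      using b by (simp add: mult.commute[of _ b] ennreal_mult_cancel_left)
  qed
  then show ?thesis using that scales_volumeI[OF lin] by blast
qed

section \<open>Volume factors of involutions, shears and stretches\<close>

lemma scales_volume_id: "scales_volume id 1"
  by (rule scales_volumeI) (auto intro: linearI)

text \<open>The existence argument does not exclude an infinite factor, so \<open>top\<close> is a
  case of its own.\<close>

lemma ennreal_square_eq_1: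
  fixes k :: ennreal
  assumes "k * k = 1" shows "k = 1"
proof (cases k)
  case (real r)
  then have "ennreal (r * r) = 1" using assms by (simp add: ennreal_mult)
  then have "r * r = 1" using real by (metis ennreal_eq_1)
  then have "r = 1" using real(1) by (simp add: square_eq_1_iff)
  then show ?thesis using real by simp
next
  case top
  then show ?thesis using assms by simp
qed

text \<open>The unknown factor k of \<open>R\<close> satisfies k * k = 1, because
  \<open>R \<circ> R\<close> is the identity and factors multiply.\<close>

lemma scales_volume_involution:
  assumes "linear R" "R \<circ> R = id"
  shows "scales_volume R 1"
proof -
  have "surj R" using assms(2) by (metis comp_apply id_apply surjI)
  then obtain k where k: "scales_volume R k" using linear_scales_volume assms(1) by blast
  then have "k * k = 1"
    using scales_volume_comp[OF k k assms(1,1)] scales_volume_id scales_volume_unique assms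
    by (metis linear_id)
  then show ?thesis using k ennreal_square_eq_1 by blast
qed

text \<open>The Householder reflection in the hyperplane orthogonal to r. For r = 0 the quotient is
  0 by convention and the map is the identity; this case occurs below when the stretching direction
  is already a basis vector.\<close>

definition reflect :: "'a::euclidean_space \<Rightarrow> 'a \<Rightarrow> 'a" where
  "reflect r y = y - (2 * (r \<bullet> y) / (r \<bullet> r)) *\<^sub>R r"

lemma linear_reflect: "linear (reflect r)"
  by (rule linearI) (auto simp: reflect_def algebra_simps add_divide_distrib)

lemma reflect_involution: "reflect r \<circ> reflect r = id"
  by (cases "r = 0") (auto simp: reflect_def fun_eq_iff inner_diff_right algebra_simps)

text \<open>The identity plus the matrix c n^T. For unit n and c = a - n it fixes the hyperplane
  orthogonal to n and sends n to a, which is what tilts a right prism into a slanted one.\<close>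

definition rank_one :: "'a::euclidean_space \<Rightarrow> 'a \<Rightarrow> 'a \<Rightarrow> 'a" where
  "rank_one n c y = y + (n \<bullet> y) *\<^sub>R c"

lemma linear_rank_one: "linear (rank_one n c)"
  by (rule linearI) (auto simp: rank_one_def algebra_simps)

text \<open>The inverse shear \<open>rank_one n (-c)\<close> is the conjugate of the shear by the
  reflection along n, which reverses n and fixes c. Hence a shear and its inverse have the same
  factor k, and k * k = 1.\<close>

lemma scales_volume_shear:
  fixes n c :: "'a::euclidean_space"
  assumes n: "norm n = 1" and nc: "n \<bullet> c = 0"
  shows "scales_volume (rank_one n c) 1"
proof -
  have nn: "n \<bullet> n = 1" using n by (simp add: norm_eq_1)
  have inv: "rank_one n c \<circ> rank_one n (-c) = id"
    by (auto simp: rank_one_def fun_eq_iff inner_add_right inner_diff_right nc)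
  have "surj (rank_one n c)" using inv by (metis comp_apply id_apply surjI)
  then obtain k where k: "scales_volume (rank_one n c) k"
    using linear_scales_volume linear_rank_one by blast
  have conj: "rank_one n (-c) = reflect n \<circ> (rank_one n c \<circ> reflect n)"
    by (auto simp: rank_one_def reflect_def fun_eq_iff nn inner_add_right inner_diff_right nc
        algebra_simps)
  note R = scales_volume_involution[OF linear_reflect reflect_involution, of n]
  have "scales_volume (rank_one n (-c)) k"
    unfolding conj
    using scales_volume_comp[OF R scales_volume_comp[OF k R linear_rank_one linear_reflect]
        linear_reflect linear_compose[OF linear_reflect linear_rank_one]] by simp
  from scales_volume_comp[OF k this linear_rank_one linear_rank_one] have "scales_volume (id :: 'a \<Rightarrow> 'a) (k * k)"
    using inv by simp
  then have "k * k = 1" using scales_volume_unique[OF _ scales_volume_id linear_id] by blast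
  then show ?thesis using k ennreal_square_eq_1 by blast
qed

text \<open>The one factor that is computed outright: the map is diagonal in the standard basis,
  with a single entry different from 1.\<close>

lemma scales_volume_stretch_Basis:
  fixes b :: "'a::euclidean_space"
  assumes b: "b \<in> Basis" and \<alpha>: "\<alpha> \<noteq> 0"
  shows "scales_volume (rank_one b ((\<alpha> - 1) *\<^sub>R b)) (ennreal (1 / \<bar>\<alpha>\<bar>))"
proof (rule scales_volumeI[OF linear_rank_one])
  define c where "c = (\<lambda>j. if j = b then \<alpha> else 1)"
  have D: "(\<lambda>x. 0 + (\<Sum>j\<in>Basis. (c j * (x \<bullet> j)) *\<^sub>R j)) = rank_one b ((\<alpha> - 1) *\<^sub>R b)"
  proof
    fix x
    have "(\<Sum>j\<in>Basis. (c j * (x \<bullet> j)) *\<^sub>R j) =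
      (\<Sum>j\<in>Basis. (x \<bullet> j) *\<^sub>R j + (if j = b then ((\<alpha> - 1) * (x \<bullet> j)) *\<^sub>R j else 0))"
      by (rule sum.cong) (auto simp: c_def algebra_simps)
    also have "\<dots> = x + ((\<alpha> - 1) * (x \<bullet> b)) *\<^sub>R b"
      using b by (simp add: sum.distrib euclidean_representation)
    finally show "0 + (\<Sum>j\<in>Basis. (c j * (x \<bullet> j)) *\<^sub>R j) = rank_one b ((\<alpha> - 1) *\<^sub>R b) x"
      by (simp add: rank_one_def inner_commute mult.commute)
  qed
  have prod: "(\<Prod>j\<in>Basis. \<bar>c j\<bar>) = \<bar>\<alpha>\<bar>"
    using b by (simp add: c_def if_distrib[of abs] cong: if_cong)
  fix A :: "'a set" assume A: "A \<in> sets borel"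
  have T: "rank_one b ((\<alpha> - 1) *\<^sub>R b) \<in> borel_measurable borel"
    by (simp add: borel_measurable_continuous_onI linear_continuous_on linear_linear linear_rank_one)
  have "emeasure lborel A =
    emeasure (density (distr lborel borel (rank_one b ((\<alpha> - 1) *\<^sub>R b))) (\<lambda>_. ennreal \<bar>\<alpha>\<bar>)) A"
    using lborel_affine_euclidean[of c 0] \<alpha> unfolding D prod by (auto simp: c_def)
  also have "\<dots> = ennreal \<bar>\<alpha>\<bar> * emeasure lborel (rank_one b ((\<alpha> - 1) *\<^sub>R b) -` A)"
    using A T by (simp add: emeasure_density nn_integral_cmult_indicator emeasure_distr)
  finally show "emeasure lborel (rank_one b ((\<alpha> - 1) *\<^sub>R b) -` A) =
      ennreal (1 / \<bar>\<alpha>\<bar>) * emeasure lborel A"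
    using \<alpha> by (simp add: mult.assoc[symmetric] ennreal_mult[symmetric])
qed

text \<open>The reflection along \<open>n - b\<close> exchanges the unit vectors n and b, so it
  conjugates the stretch along a basis vector b into the stretch along n.\<close>

lemma scales_volume_stretch:
  fixes n :: "'a::euclidean_space"
  assumes n: "norm n = 1" and \<alpha>: "\<alpha> \<noteq> 0"
  shows "scales_volume (rank_one n ((\<alpha> - 1) *\<^sub>R n)) (ennreal (1 / \<bar>\<alpha>\<bar>))"
proof -
  obtain b :: 'a where b: "b \<in> Basis" using nonempty_Basis by blast
  define r where "r = n - b"
  have nn: "n \<bullet> n = 1" "b \<bullet> b = 1" using n b by (simp_all add: norm_eq_1)
  have rr: "r \<bullet> r = 2 - 2 * (n \<bullet> b)"
    using nn by (simp add: r_def inner_diff) (simp only: inner_commute)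
  have Rb: "reflect r b = n"
  proof (cases "r = 0")
    case False
    have rb: "2 * (r \<bullet> b) = - (r \<bullet> r)" by (simp add: rr r_def inner_diff nn inner_commute[of n b])
    have "reflect r b = b + r" using False unfolding reflect_def rb by simp
    then show ?thesis by (simp add: r_def)
  qed (simp add: reflect_def r_def)
  have adj: "reflect r x \<bullet> y = x \<bullet> reflect r y" for x y
    by (simp add: reflect_def inner_diff_left inner_diff_right inner_commute algebra_simps)
  have inv: "reflect r (reflect r y) = y" for y
    using reflect_involution[of r] by (simp add: fun_eq_iff)
  have conj: "rank_one n ((\<alpha> - 1) *\<^sub>R n) = reflect r \<circ> (rank_one b ((\<alpha> - 1) *\<^sub>R b) \<circ> reflect r)"
    using linear_reflect[of r]
    by (auto simp: rank_one_def fun_eq_iff linear_add linear_scale inv Rb adj[symmetric])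
  note R = scales_volume_involution[OF linear_reflect reflect_involution, of r]
  show ?thesis
    unfolding conj
    using scales_volume_comp[OF R scales_volume_comp[OF scales_volume_stretch_Basis[OF b \<alpha>] R
          linear_rank_one linear_reflect]
        linear_reflect linear_compose[OF linear_reflect linear_rank_one]] by simp
qed

text \<open>The map is a stretch by \<open>n \<bullet> a\<close> along n followed by the shear that
  moves n to a divided by \<open>n \<bullet> a\<close>; only the stretch changes volume.\<close>

lemma scales_volume_rank_one:
  fixes n a :: "'a::euclidean_space"
  assumes n: "norm n = 1" and a: "n \<bullet> a \<noteq> 0"
  shows "scales_volume (rank_one n (a - n)) (ennreal (1 / \<bar>n \<bullet> a\<bar>))"
proof -
  have nn: "n \<bullet> n = 1" using n by (simp add: norm_eq_1)
  define \<alpha> where "\<alpha> = n \<bullet> a"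
  define c where "c = (1 / \<alpha>) *\<^sub>R a - n"
  have \<alpha>: "\<alpha> \<noteq> 0" using a by (simp add: \<alpha>_def)
  have nc: "n \<bullet> c = 0" using a by (simp add: c_def inner_diff_right nn \<alpha>_def)
  have eq: "rank_one n (a - n) = rank_one n c \<circ> rank_one n ((\<alpha> - 1) *\<^sub>R n)"
    using \<alpha> by (auto simp: rank_one_def fun_eq_iff inner_add_right nn c_def algebra_simps)
  show ?thesis
    unfolding eq
    using scales_volume_comp[OF scales_volume_shear[OF n nc] scales_volume_stretch[OF n \<alpha>]
        linear_rank_one linear_rank_one] by (simp add: \<alpha>_def)
qed

lemma integral_rank_one:
  fixes n a :: "'a::euclidean_space" and f :: "'a \<Rightarrow> real"
  assumes n: "norm n = 1" and a: "n \<bullet> a \<noteq> 0" and f[measurable]: "f \<in> borel_measurable borel"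
  shows "(\<integral>x. f x \<partial>lborel) = \<bar>n \<bullet> a\<bar> * (\<integral>x. f (rank_one n (a - n) x) \<partial>lborel)"
proof -
  have [measurable]: "rank_one n (a - n) \<in> borel_measurable borel"
    by (simp add: borel_measurable_continuous_onI linear_continuous_on linear_linear linear_rank_one)
  have "(\<integral>x. f (rank_one n (a - n) x) \<partial>lborel) = (\<integral>x. f x \<partial>distr lborel borel (rank_one n (a - n)))"
    by (simp add: integral_distr)
  also have "\<dots> = (\<integral>x. (1 / \<bar>n \<bullet> a\<bar>) * f x \<partial>lborel)"
    using scales_volume_rank_one[OF n a] unfolding scales_volume_def
    by (simp add: integral_density)
  finally show ?thesis using a by simp
qed

subsection \<open>Prisms over the facets of a polytope\<close>

text \<open>With e the unit normal of F and T = 1 this is the cylinder in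
  \<open>surface_integral\<close>; other e give the slanted prisms swept out by a
  translation.\<close>

definition prism :: "'a::euclidean_space \<Rightarrow> real \<Rightarrow> 'a set \<Rightarrow> 'a set" where
  "prism e T F = {z + s *\<^sub>R e |z s. z \<in> F \<and> 0 \<le> s \<and> s \<le> T}"

lemma compact_prism:
  assumes "compact F" shows "compact (prism e T F)"
proof -
  have "prism e T F = (\<lambda>(z, s). z + s *\<^sub>R e) ` (F \<times> {0..T})"
    by (fastforce simp: prism_def image_iff)
  moreover have "compact ((\<lambda>(z, s). z + s *\<^sub>R e) ` (F \<times> {0..T}))"
    by (intro compact_continuous_image compact_Times assms compact_Icc)
       (auto simp: case_prod_unfold intro!: continuous_intros)
  ultimately show ?thesis by simp
qed

text \<open>At the extreme point \<open>y - \<alpha> *\<^sub>R e\<close> of the chord some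
  constraint facing e must be tight, since otherwise the parameter could be decreased further inside
  K. Two tight constraints would put the line through the intersection of two facet hyperplanes,
  which \<open>generic\<close> rules out.\<close>

lemma exit_facet:
  fixes n :: "'i \<Rightarrow> 'a::euclidean_space"
  assumes fin: "finite I" and K: "K = {x. \<forall>i\<in>I. n i \<bullet> x \<le> c i}"
    and unit: "\<And>i. i \<in> I \<Longrightarrow> norm (n i) = 1" and inj: "inj_on (\<lambda>i. (n i, c i)) I"
    and generic: "\<And>i j. i \<in> I \<Longrightarrow> j \<in> I \<Longrightarrow> (n j \<bullet> e) *\<^sub>R n i - (n i \<bullet> e) *\<^sub>R n j \<noteq> 0 \<Longrightarrow>
        ((n j \<bullet> e) *\<^sub>R n i - (n i \<bullet> e) *\<^sub>R n j) \<bullet> y \<noteq> (n j \<bullet> e) * c i - (n i \<bullet> e) * c j"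
    and mem: "y - \<alpha> *\<^sub>R e \<in> K" and min: "\<And>s. y - s *\<^sub>R e \<in> K \<Longrightarrow> \<alpha> \<le> s"
  shows "\<exists>!i. i \<in> I \<and> n i \<bullet> e > 0 \<and> n i \<bullet> y - \<alpha> * (n i \<bullet> e) = c i"
proof -
  define s where "s = (\<lambda>i. (n i \<bullet> y - c i) / (n i \<bullet> e))"
  have ineq: "n i \<bullet> y - \<alpha> * (n i \<bullet> e) \<le> c i" if "i \<in> I" for i
    using mem that by (auto simp: K inner_diff_right)
  have "\<exists>i\<in>I. n i \<bullet> e > 0 \<and> n i \<bullet> y - \<alpha> * (n i \<bullet> e) = c i"
  proof (rule ccontr)
    assume none: "\<not> ?thesis"
    \<comment> \<open>A constraint with \<open>n i \<bullet> e > 0\<close> holds at exactly the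
      parameters from \<open>s i\<close> on, so this is a smaller admissible parameter. The entry
      \<open>\<alpha> - 1\<close> keeps the set nonempty when there is no such constraint.\<close>
    define \<alpha>' where "\<alpha>' = Max (insert (\<alpha> - 1) (s ` {i \<in> I. n i \<bullet> e > 0}))"
    have "s i < \<alpha>" if "i \<in> I" "n i \<bullet> e > 0" for i
    proof -
      have "n i \<bullet> y - \<alpha> * (n i \<bullet> e) < c i" using none ineq[of i] that by force
      then show ?thesis using that by (simp add: s_def field_simps)
    qed
    then have lt: "\<alpha>' < \<alpha>" using fin by (auto simp: \<alpha>'_def)
    have "n i \<bullet> (y - \<alpha>' *\<^sub>R e) \<le> c i" if i: "i \<in> I" for i
    proof (cases "n i \<bullet> e > 0")
      case True
      then have "s i \<le> \<alpha>'" using fin i by (auto simp: \<alpha>'_def)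
      then show ?thesis using True by (simp add: s_def field_simps inner_diff_right)
    next
      case False
      then have "\<alpha> * (n i \<bullet> e) \<le> \<alpha>' * (n i \<bullet> e)" using lt by (intro mult_right_mono_neg) auto
      then show ?thesis using ineq[OF i] by (simp add: inner_diff_right)
    qed
    then have "y - \<alpha>' *\<^sub>R e \<in> K" by (simp add: K)
    then show False using min[of \<alpha>'] lt by simp
  qed
  moreover have "i = j"
    if i: "i \<in> I" "n i \<bullet> e > 0" "n i \<bullet> y - \<alpha> * (n i \<bullet> e) = c i"
      and j: "j \<in> I" "n j \<bullet> e > 0" "n j \<bullet> y - \<alpha> * (n j \<bullet> e) = c j" for i j
  proof -
    \<comment> \<open>Eliminating \<alpha> from both tight constraints puts y on the hyperplane
      excluded by \<open>generic\<close>, unless its normal vector vanishes. In that case the two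
      unit normals agree, hence also the levels, and injectivity gives i = j.\<close>
    have "(n j \<bullet> e) * (n i \<bullet> y) - (n i \<bullet> e) * (n j \<bullet> y) = (n j \<bullet> e) * c i - (n i \<bullet> e) * c j"
      unfolding i(3)[symmetric] j(3)[symmetric] by (simp add: algebra_simps)
    then have *: "(n j \<bullet> e) *\<^sub>R n i = (n i \<bullet> e) *\<^sub>R n j"
      using generic[OF i(1) j(1)] by (auto simp: inner_diff_left)
    then have "norm ((n j \<bullet> e) *\<^sub>R n i) = norm ((n i \<bullet> e) *\<^sub>R n j)" by simp
    then have "n j \<bullet> e = n i \<bullet> e" using i j unit by simp
    then have "(n i \<bullet> e) *\<^sub>R n i = (n i \<bullet> e) *\<^sub>R n j" using * by (simp only:)
    then have "n i = n j" using i(2) by (metis less_irrefl scaleR_left_imp_eq)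
    then show ?thesis using i j inj by (auto dest: inj_onD)
  qed
  ultimately show ?thesis by blast
qed

text \<open>
  On a line meeting \<open>K\<close> in the parameters \<open>[\<alpha>, \<beta>]\<close>, the claim is
  \<open>1\<^bsub>[\<alpha>,\<beta>]\<^esub>(0) + 1\<^bsub>[0,T]\<^esub>(\<alpha>) = 1\<^bsub>[0,T]\<^esub>(\<beta>) + 1\<^bsub>[\<alpha>,\<beta>]\<^esub>(T)\<close>.
\<close>
lemma prism_balance_pointwise:
  fixes n :: "'i \<Rightarrow> 'a::euclidean_space"
  assumes fin: "finite I" and K: "K = {x. \<forall>i\<in>I. n i \<bullet> x \<le> c i}" and comp: "compact K"
    and unit: "\<And>i. i \<in> I \<Longrightarrow> norm (n i) = 1" and inj: "inj_on (\<lambda>i. (n i, c i)) I"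
    and e: "e \<noteq> 0" and T: "0 < T"
    and generic: "\<And>i j. i \<in> I \<Longrightarrow> j \<in> I \<Longrightarrow> (n j \<bullet> e) *\<^sub>R n i - (n i \<bullet> e) *\<^sub>R n j \<noteq> 0 \<Longrightarrow>
        ((n j \<bullet> e) *\<^sub>R n i - (n i \<bullet> e) *\<^sub>R n j) \<bullet> y \<noteq> (n j \<bullet> e) * c i - (n i \<bullet> e) * c j"
    and off0: "\<And>i. i \<in> I \<Longrightarrow> n i \<bullet> y \<noteq> c i"
    and offT: "\<And>i. i \<in> I \<Longrightarrow> n i \<bullet> y \<noteq> c i + T * (n i \<bullet> e)"
  shows "indicator K y +
      (\<Sum>i | i \<in> I \<and> n i \<bullet> e > 0. indicator (prism e T (K \<inter> {x. n i \<bullet> x = c i})) y) =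
      (\<Sum>i | i \<in> I \<and> n i \<bullet> e < 0. indicator (prism e T (K \<inter> {x. n i \<bullet> x = c i})) y) +
      (indicator ((+) (T *\<^sub>R e) ` K) y :: real)"
proof -
  \<comment> \<open>The line is run backwards, so that parameter 0 tests membership of y in K and
    parameter T tests membership in the translate.\<close>
  define L where "L = {s. y - s *\<^sub>R e \<in> K}"
  have memK: "y \<in> K \<longleftrightarrow> 0 \<in> L" by (simp add: L_def)
  have memKT: "y \<in> (+) (T *\<^sub>R e) ` K \<longleftrightarrow> T \<in> L"
    by (force simp: L_def image_iff algebra_simps)
  have memP: "y \<in> prism e T (K \<inter> {x. n i \<bullet> x = c i}) \<longleftrightarrow>
      (\<exists>s. 0 \<le> s \<and> s \<le> T \<and> s \<in> L \<and> n i \<bullet> y - s * (n i \<bullet> e) = c i)" for i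
  proof
    assume "y \<in> prism e T (K \<inter> {x. n i \<bullet> x = c i})"
    then obtain z s where "y = z + s *\<^sub>R e" "z \<in> K" "n i \<bullet> z = c i" "0 \<le> s" "s \<le> T"
      by (auto simp: prism_def)
    then show "\<exists>s. 0 \<le> s \<and> s \<le> T \<and> s \<in> L \<and> n i \<bullet> y - s * (n i \<bullet> e) = c i"
      by (intro exI[of _ s]) (auto simp: L_def inner_add_right)
  next
    assume "\<exists>s. 0 \<le> s \<and> s \<le> T \<and> s \<in> L \<and> n i \<bullet> y - s * (n i \<bullet> e) = c i"
    then obtain s where "0 \<le> s" "s \<le> T" "y - s *\<^sub>R e \<in> K" "n i \<bullet> y - s * (n i \<bullet> e) = c i"
      by (auto simp: L_def)
    then show "y \<in> prism e T (K \<inter> {x. n i \<bullet> x = c i})"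
      unfolding prism_def
      by (intro CollectI exI[of _ "y - s *\<^sub>R e"] exI[of _ s]) (auto simp: inner_diff_right)
  qed
  show ?thesis
  proof (cases "L = {}")
    case True
    then show ?thesis by (simp add: indicator_def memK memKT memP)
  next
    case False
    have "closed ((\<lambda>s. y - s *\<^sub>R e) -` K)"
      by (intro closed_vimage compact_imp_closed[OF comp] continuous_intros)
    then have "closed L" by (simp add: L_def vimage_def)
    moreover obtain B where B: "\<And>x. x \<in> K \<Longrightarrow> norm x \<le> B"
      using compact_imp_bounded[OF comp] by (auto simp: bounded_iff)
    have "\<bar>s\<bar> \<le> (B + norm y) / norm e" if "s \<in> L" for s
    proof -
      have "norm (s *\<^sub>R e) \<le> norm (y - s *\<^sub>R e) + norm y"
        by (metis norm_minus_commute norm_triangle_sub add.commute)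
      also have "\<dots> \<le> B + norm y" using B that by (simp add: L_def)
      finally show ?thesis using e by (simp add: field_simps)
    qed
    then have "bounded L" by (auto simp: bounded_iff)
    ultimately have "compact L" by (simp add: compact_eq_bounded_closed)
    from compact_attains_inf[OF this False] compact_attains_sup[OF this False]
    obtain \<alpha> \<beta> where \<alpha>: "\<alpha> \<in> L" "\<And>s. s \<in> L \<Longrightarrow> \<alpha> \<le> s"
      and \<beta>: "\<beta> \<in> L" "\<And>s. s \<in> L \<Longrightarrow> s \<le> \<beta>" by blast
    have L_iff: "s \<in> L \<longleftrightarrow> (\<forall>i\<in>I. n i \<bullet> y - s * (n i \<bullet> e) \<le> c i)" for s
      by (simp add: L_def K inner_diff_right)
    have Lab: "s \<in> L \<longleftrightarrow> \<alpha> \<le> s \<and> s \<le> \<beta>" for s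
    proof
      assume s: "\<alpha> \<le> s \<and> s \<le> \<beta>"
      show "s \<in> L"
        unfolding L_iff
      proof
        fix i assume i: "i \<in> I"
        show "n i \<bullet> y - s * (n i \<bullet> e) \<le> c i"
        proof (cases "n i \<bullet> e \<ge> 0")
          case True
          then have "\<alpha> * (n i \<bullet> e) \<le> s * (n i \<bullet> e)" using s by (intro mult_right_mono) auto
          then show ?thesis using \<alpha>(1) i by (force simp: L_iff)
        next
          case False
          then have "\<beta> * (n i \<bullet> e) \<le> s * (n i \<bullet> e)" using s by (intro mult_right_mono_neg) auto
          then show ?thesis using \<beta>(1) i by (force simp: L_iff)
        qed
      qed
    qed (use \<alpha> \<beta> in auto)
    have top: "\<exists>!i. i \<in> I \<and> n i \<bullet> e > 0 \<and> n i \<bullet> y - \<alpha> * (n i \<bullet> e) = c i"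
      by (rule exit_facet[OF fin K unit inj generic]) (use \<alpha> in \<open>auto simp: L_def\<close>)
    \<comment> \<open>The other end of the chord is the exit point in direction \<open>- e\<close>,
      with parameter \<open>- \<beta>\<close>.\<close>
    have "\<exists>!i. i \<in> I \<and> n i \<bullet> (- e) > 0 \<and> n i \<bullet> y - (- \<beta>) * (n i \<bullet> (- e)) = c i"
    proof (rule exit_facet[OF fin K unit inj])
      fix i j assume ij: "i \<in> I" "j \<in> I" "(n j \<bullet> - e) *\<^sub>R n i - (n i \<bullet> - e) *\<^sub>R n j \<noteq> 0"
      then have "(n j \<bullet> e) *\<^sub>R n i - (n i \<bullet> e) *\<^sub>R n j \<noteq> 0" by auto
      from generic[OF ij(1,2) this]
      show "((n j \<bullet> - e) *\<^sub>R n i - (n i \<bullet> - e) *\<^sub>R n j) \<bullet> y \<noteq> (n j \<bullet> - e) * c i - (n i \<bullet> - e) * c j"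
        by (auto simp: inner_diff_left algebra_simps)
    next
      fix s assume "y - s *\<^sub>R (- e) \<in> K"
      then have "- s \<in> L" by (simp add: L_def)
      then show "- \<beta> \<le> s" using \<beta>(2)[of "- s"] by simp
    qed (use \<beta> in \<open>auto simp: L_def\<close>)
    then have bot: "\<exists>!i. i \<in> I \<and> n i \<bullet> e < 0 \<and> n i \<bullet> y - \<beta> * (n i \<bullet> e) = c i" by simp
    obtain i where i: "i \<in> I" "n i \<bullet> e > 0" "n i \<bullet> y - \<alpha> * (n i \<bullet> e) = c i"
      and iu: "\<And>i'. i' \<in> I \<Longrightarrow> n i' \<bullet> e > 0 \<Longrightarrow> n i' \<bullet> y - \<alpha> * (n i' \<bullet> e) = c i' \<Longrightarrow> i' = i"
      using top by blast
    obtain j where j: "j \<in> I" "n j \<bullet> e < 0" "n j \<bullet> y - \<beta> * (n j \<bullet> e) = c j"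
      and ju: "\<And>i'. i' \<in> I \<Longrightarrow> n i' \<bullet> e < 0 \<Longrightarrow> n i' \<bullet> y - \<beta> * (n i' \<bullet> e) = c i' \<Longrightarrow> i' = j"
      using bot by blast
    \<comment> \<open>The value of a constraint facing e falls as the parameter grows, so it can be
      tight on the chord only at the lower end \<alpha>; by uniqueness of the exit facet only the
      prism over facet i can then contain y.\<close>
    have P_top: "y \<in> prism e T (K \<inter> {x. n i' \<bullet> x = c i'}) \<longleftrightarrow> i' = i \<and> 0 \<le> \<alpha> \<and> \<alpha> \<le> T"
      if i': "i' \<in> I" "n i' \<bullet> e > 0" for i'
    proof -
      have "s = \<alpha>" if "s \<in> L" "n i' \<bullet> y - s * (n i' \<bullet> e) = c i'" for s
      proof -
        have "n i' \<bullet> y - \<alpha> * (n i' \<bullet> e) \<le> n i' \<bullet> y - s * (n i' \<bullet> e)"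
          using \<alpha>(1) i' that by (simp add: L_iff)
        then have "s \<le> \<alpha>" using i' by simp
        then show ?thesis using \<alpha>(2) that by force
      qed
      then show ?thesis unfolding memP using iu[OF i'] i \<alpha>(1) by auto
    qed
    have P_bot: "y \<in> prism e T (K \<inter> {x. n i' \<bullet> x = c i'}) \<longleftrightarrow> i' = j \<and> 0 \<le> \<beta> \<and> \<beta> \<le> T"
      if i': "i' \<in> I" "n i' \<bullet> e < 0" for i'
    proof -
      have "s = \<beta>" if "s \<in> L" "n i' \<bullet> y - s * (n i' \<bullet> e) = c i'" for s
      proof -
        have "n i' \<bullet> y - \<beta> * (n i' \<bullet> e) \<le> n i' \<bullet> y - s * (n i' \<bullet> e)"
          using \<beta>(1) i' that by (simp add: L_iff)
        then have "\<beta> \<le> s" using i' by simp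
        then show ?thesis using \<beta>(2) that by force
      qed
      then show ?thesis unfolding memP using ju[OF i'] j \<beta>(1) by auto
    qed
    have sum_top: "(\<Sum>i' | i' \<in> I \<and> n i' \<bullet> e > 0. indicator (prism e T (K \<inter> {x. n i' \<bullet> x = c i'})) y) =
        (of_bool (0 \<le> \<alpha> \<and> \<alpha> \<le> T) :: real)"
    proof -
      have "(\<Sum>i' | i' \<in> I \<and> n i' \<bullet> e > 0. indicator (prism e T (K \<inter> {x. n i' \<bullet> x = c i'})) y) =
        (\<Sum>i' | i' \<in> I \<and> n i' \<bullet> e > 0. if i' = i then (of_bool (0 \<le> \<alpha> \<and> \<alpha> \<le> T) :: real) else 0)"
        by (rule sum.cong) (auto simp: indicator_def P_top)
      then show ?thesis using fin i by simp
    qed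
    have sum_bot: "(\<Sum>i' | i' \<in> I \<and> n i' \<bullet> e < 0. indicator (prism e T (K \<inter> {x. n i' \<bullet> x = c i'})) y) =
        (of_bool (0 \<le> \<beta> \<and> \<beta> \<le> T) :: real)"
    proof -
      have "(\<Sum>i' | i' \<in> I \<and> n i' \<bullet> e < 0. indicator (prism e T (K \<inter> {x. n i' \<bullet> x = c i'})) y) =
        (\<Sum>i' | i' \<in> I \<and> n i' \<bullet> e < 0. if i' = j then (of_bool (0 \<le> \<beta> \<and> \<beta> \<le> T) :: real) else 0)"
        by (rule sum.cong) (auto simp: indicator_def P_bot)
      then show ?thesis using fin j by simp
    qed
    \<comment> \<open>Since all intervals are closed, the count would be wrong if an end of the
      chord coincided with 0 or T; \<open>off0\<close> and \<open>offT\<close> prevent this.\<close>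
    have "\<alpha> \<noteq> 0" "\<alpha> \<noteq> T" using i off0[OF i(1)] offT[OF i(1)] by auto
    moreover have "\<beta> \<noteq> 0" "\<beta> \<noteq> T" using j off0[OF j(1)] offT[OF j(1)] by auto
    moreover have "\<alpha> \<le> \<beta>" using \<alpha> \<beta> by auto
    ultimately show ?thesis
      unfolding sum_top sum_bot unfolding indicator_def memK memKT Lab using T by auto
  qed
qed

lemma AE_not_in_hyperplane:
  fixes a :: "'a::euclidean_space"
  assumes "a \<noteq> 0" shows "AE y in lborel. a \<bullet> y \<noteq> b"
proof (rule AE_I')
  have "{x. a \<bullet> x = b} \<in> null_sets lebesgue"
    using negligible_hyperplane[of a b] assms by (simp add: negligible_iff_null_sets)
  then show "{x. a \<bullet> x = b} \<in> null_sets lborel"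
    by (simp add: null_sets_completion_iff closed_hyperplane borel_closed)
qed auto

lemma set_integral_compact_continuous:
  fixes g :: "'a::euclidean_space \<Rightarrow> real"
  assumes "compact S" "continuous_on S g"
  shows "set_integrable lborel S g"
  using borel_integrable_compact[OF assms] by (simp add: set_integrable_def)

text \<open>The pointwise count holds off finitely many hyperplanes, hence almost everywhere, and is
  integrated against g. Facets parallel to e occur on neither side: they sweep out subsets of their
  own hyperplanes.\<close>

lemma prism_balance:
  fixes n :: "'i \<Rightarrow> 'a::euclidean_space" and g :: "'a \<Rightarrow> real"
  assumes fin: "finite I" and K: "K = {x. \<forall>i\<in>I. n i \<bullet> x \<le> c i}" and comp: "compact K"
    and unit: "\<And>i. i \<in> I \<Longrightarrow> norm (n i) = 1" and inj: "inj_on (\<lambda>i. (n i, c i)) I"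
    and e: "e \<noteq> 0" and T: "0 < T" and g: "continuous_on UNIV g"
  shows "(LINT y:K|lborel. g y) +
      (\<Sum>i | i \<in> I \<and> n i \<bullet> e > 0. LINT y:prism e T (K \<inter> {x. n i \<bullet> x = c i})|lborel. g y) =
      (\<Sum>i | i \<in> I \<and> n i \<bullet> e < 0. LINT y:prism e T (K \<inter> {x. n i \<bullet> x = c i})|lborel. g y) +
      (LINT y:(+) (T *\<^sub>R e) ` K|lborel. g y)"
proof -
  let ?F = "\<lambda>i. K \<inter> {x. n i \<bullet> x = c i}"
  have ae: "AE y in lborel. indicator K y +
      (\<Sum>i | i \<in> I \<and> n i \<bullet> e > 0. indicator (prism e T (?F i)) y) =
      (\<Sum>i | i \<in> I \<and> n i \<bullet> e < 0. indicator (prism e T (?F i)) y) +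
      (indicator ((+) (T *\<^sub>R e) ` K) y :: real)"
  proof -
    have n0: "n i \<noteq> 0" if "i \<in> I" for i using unit[OF that] by auto
    have "AE y in lborel. \<forall>i\<in>I. n i \<bullet> y \<noteq> c i"
      by (intro AE_finite_allI fin AE_not_in_hyperplane n0)
    moreover have "AE y in lborel. \<forall>i\<in>I. n i \<bullet> y \<noteq> c i + T * (n i \<bullet> e)"
      by (intro AE_finite_allI fin AE_not_in_hyperplane n0)
    moreover have "AE y in lborel. \<forall>i\<in>I. \<forall>j\<in>I. (n j \<bullet> e) *\<^sub>R n i - (n i \<bullet> e) *\<^sub>R n j \<noteq> 0 \<longrightarrow>
        ((n j \<bullet> e) *\<^sub>R n i - (n i \<bullet> e) *\<^sub>R n j) \<bullet> y \<noteq> (n j \<bullet> e) * c i - (n i \<bullet> e) * c j"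
      by (intro AE_finite_allI fin AE_impI AE_not_in_hyperplane)
    ultimately show ?thesis
    proof eventually_elim
      case (elim y)
      show ?case
        by (rule prism_balance_pointwise[OF fin K comp unit inj e T]) (use elim in auto)
    qed
  qed
  have cK: "compact ((+) (T *\<^sub>R e) ` K)" using comp by (simp add: compact_translation)
  have cF: "compact (?F i)" for i by (intro compact_Int_closed comp closed_hyperplane)
  note int = set_integral_compact_continuous[OF _ continuous_on_subset[OF g], unfolded set_integrable_def, simplified]
  have iK: "integrable lborel (\<lambda>y. indicator K y * g y)" using int[OF comp] by simp
  have iKT: "integrable lborel (\<lambda>y. indicator ((+) (T *\<^sub>R e) ` K) y * g y)" using int[OF cK] by simp
  have iP: "integrable lborel (\<lambda>y. indicator (prism e T (?F i)) y * g y)" for i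
    using int[OF compact_prism[OF cF]] by simp
  have "(\<integral>y. indicator K y * g y + (\<Sum>i | i \<in> I \<and> n i \<bullet> e > 0. indicator (prism e T (?F i)) y * g y) \<partial>lborel) =
    (\<integral>y. (\<Sum>i | i \<in> I \<and> n i \<bullet> e < 0. indicator (prism e T (?F i)) y * g y) +
      indicator ((+) (T *\<^sub>R e) ` K) y * g y \<partial>lborel)"
    (is "integral\<^sup>L _ ?l = integral\<^sup>L _ ?r")
  proof (rule integral_cong_AE)
    have "integrable lborel ?l" by (intro Bochner_Integration.integrable_add Bochner_Integration.integrable_sum iK iP)
    then show "?l \<in> borel_measurable lborel" by (rule borel_measurable_integrable)
    have "integrable lborel ?r" by (intro Bochner_Integration.integrable_add Bochner_Integration.integrable_sum iKT iP)
    then show "?r \<in> borel_measurable lborel" by (rule borel_measurable_integrable)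
    show "AE y in lborel. ?l y = ?r y"
      using ae
    proof eventually_elim
      case (elim y)
      then show ?case by (simp only: distrib_right[symmetric] sum_distrib_right[symmetric])
    qed
  qed
  then show ?thesis
    unfolding set_lebesgue_integral_def real_scaleR_def
    by (simp add: iK iP iKT Bochner_Integration.integral_add Bochner_Integration.integral_sum
        Bochner_Integration.integrable_sum)
qed

section \<open>From balanced prisms to the divergence theorem in one direction\<close>

lemma integral_lborel_translate:
  fixes f :: "'a::euclidean_space \<Rightarrow> real"
  assumes [measurable]: "f \<in> borel_measurable borel"
  shows "(\<integral>x. f (x + c) \<partial>lborel) = (\<integral>x. f x \<partial>lborel)"
proof -
  have "(\<integral>x. f x \<partial>lborel) = (\<integral>x. f x \<partial>distr lborel borel ((+) c))"
    by (simp add: lborel_distr_plus)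
  also have "\<dots> = (\<integral>x. f (x + c) \<partial>lborel)"
    by (subst integral_distr) (auto simp: add.commute)
  finally show ?thesis ..
qed

lemma set_integral_translate:
  fixes g :: "'a::euclidean_space \<Rightarrow> real"
  assumes K: "K \<in> sets borel" and g[measurable]: "g \<in> borel_measurable borel"
  shows "(LINT y:(+) v ` K|lborel. g y) = (LINT x:K|lborel. g (x + v))"
proof -
  have "(+) v ` K = (\<lambda>x. x - v) -` K"
    by (force simp: image_iff algebra_simps)
  moreover have "(\<lambda>x. x - v) -` K \<in> sets borel"
    using K by (rule measurable_sets_borel[rotated]) measurable
  ultimately have [measurable]: "(+) v ` K \<in> sets borel" by simp
  have "(LINT y:(+) v ` K|lborel. g y) = (\<integral>y. indicator ((+) v ` K) y * g y \<partial>lborel)"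
    by (simp add: set_lebesgue_integral_def)
  also have "\<dots> = (\<integral>x. indicator ((+) v ` K) (x + v) * g (x + v) \<partial>lborel)"
    by (rule integral_lborel_translate[symmetric]) measurable
  also have "\<dots> = (LINT x:K|lborel. g (x + v))"
    unfolding set_lebesgue_integral_def
    by (intro Bochner_Integration.integral_cong) (auto simp: indicator_def image_iff add.commute)
  finally show ?thesis .
qed

text \<open>The affine map that fixes the hyperplane of F and sends n to
  \<open>T *\<^sub>R e\<close> carries the right prism of height one onto the slanted one, with
  volume factor \<open>T * \<bar>n \<bullet> e\<bar>\<close>.\<close>

lemma prism_integral:
  fixes n e :: "'a::euclidean_space" and g :: "'a \<Rightarrow> real"
  assumes n: "norm n = 1" and ne: "n \<bullet> e \<noteq> 0" and T: "0 < T" and F: "F \<subseteq> {x. n \<bullet> x = c}"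
    and comp: "compact F" and g: "continuous_on UNIV g"
  shows "(LINT y:prism e T F|lborel. g y) =
    T * \<bar>n \<bullet> e\<bar> * (LINT y:prism n 1 F|lborel. g (y + (n \<bullet> y - c) *\<^sub>R (T *\<^sub>R e - n)))"
proof -
  have nn: "n \<bullet> n = 1" using n by (simp add: norm_eq_1)
  let ?A = "\<lambda>y. y + (n \<bullet> y - c) *\<^sub>R (T *\<^sub>R e - n)"
  have [measurable]: "g \<in> borel_measurable borel" using g by (rule borel_measurable_continuous_onI)
  have [measurable]: "prism e T F \<in> sets borel" "prism n 1 F \<in> sets borel"
    using compact_prism[OF comp] by (auto intro: borel_compact)
  \<comment> \<open>The hyperplane of F has level c, so the linear map is conjugated by the
    translation along \<open>c *\<^sub>R n\<close>, which moves it to the origin.\<close>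
  have A: "rank_one n (T *\<^sub>R e - n) (y - c *\<^sub>R n) + c *\<^sub>R n = ?A y" for y
    by (simp add: rank_one_def inner_diff_right nn)
  have mem: "?A y \<in> prism e T F \<longleftrightarrow> y \<in> prism n 1 F" for y
  proof
    assume "?A y \<in> prism e T F"
    then obtain z s where zs: "?A y = z + s *\<^sub>R e" "z \<in> F" "0 \<le> s" "s \<le> T" by (auto simp: prism_def)
    have "n \<bullet> ?A y = n \<bullet> (z + s *\<^sub>R e)" using zs by simp
    then have "(n \<bullet> y - c) * (T * (n \<bullet> e)) = s * (n \<bullet> e)"
      using F zs by (auto simp: inner_add_right inner_diff_right nn algebra_simps)
    then have s: "s = (n \<bullet> y - c) * T" using ne by simp
    then have "y = z + (n \<bullet> y - c) *\<^sub>R n" using zs(1)[unfolded s] by (simp add: algebra_simps)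
    moreover have "0 \<le> n \<bullet> y - c" "n \<bullet> y - c \<le> 1"
      using zs(3,4) T unfolding s by (auto simp: zero_le_mult_iff)
    ultimately show "y \<in> prism n 1 F" using zs(2) unfolding prism_def by blast
  next
    assume "y \<in> prism n 1 F"
    then obtain z s where zs: "y = z + s *\<^sub>R n" "z \<in> F" "0 \<le> s" "s \<le> 1" by (auto simp: prism_def)
    have "n \<bullet> y - c = s" using F zs by (auto simp: inner_add_right nn)
    then have "?A y = z + (s * T) *\<^sub>R e" by (simp add: zs(1) algebra_simps)
    moreover have "0 \<le> s * T" "s * T \<le> T" using zs T by auto
    ultimately show "?A y \<in> prism e T F" using zs(2) unfolding prism_def by blast
  qed
  let ?f = "\<lambda>y. indicator (prism e T F) (y + c *\<^sub>R n) * g (y + c *\<^sub>R n)"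
  have "(LINT y:prism e T F|lborel. g y) = (\<integral>y. indicator (prism e T F) y * g y \<partial>lborel)"
    by (simp add: set_lebesgue_integral_def)
  also have "\<dots> = (\<integral>y. ?f y \<partial>lborel)"
    by (rule integral_lborel_translate[symmetric]) measurable
  also have "\<dots> = \<bar>n \<bullet> (T *\<^sub>R e)\<bar> * (\<integral>y. ?f (rank_one n (T *\<^sub>R e - n) y) \<partial>lborel)"
    using n ne T by (intro integral_rank_one) (auto, measurable)
  also have "(\<integral>y. ?f (rank_one n (T *\<^sub>R e - n) y) \<partial>lborel) =
     (\<integral>y. ?f (rank_one n (T *\<^sub>R e - n) (y + - (c *\<^sub>R n))) \<partial>lborel)"
  proof (rule integral_lborel_translate[symmetric])
    have [measurable]: "rank_one n (T *\<^sub>R e - n) \<in> borel_measurable borel"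
      by (simp add: borel_measurable_continuous_onI linear_continuous_on linear_linear linear_rank_one)
    show "(\<lambda>y. ?f (rank_one n (T *\<^sub>R e - n) y)) \<in> borel_measurable borel" by measurable
  qed
  also have "\<dots> = (LINT y:prism n 1 F|lborel. g (?A y))"
    unfolding set_lebesgue_integral_def
    by (intro Bochner_Integration.integral_cong) (auto simp: A indicator_def mem)
  finally show ?thesis using T by (simp add: abs_mult)
qed

lemma continuous_on_case_prodD:
  assumes "continuous_on UNIV (\<lambda>(x, t). f x t)"
  shows "continuous_on UNIV (\<lambda>x. f x t)" "continuous_on UNIV (f x)"
proof -
  have "continuous_on UNIV (\<lambda>x. (x, t))" "continuous_on UNIV (\<lambda>t. (x, t))"
    by (intro continuous_intros)+
  from this[THEN continuous_on_compose2[OF assms]]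
  show "continuous_on UNIV (\<lambda>x. f x t)" "continuous_on UNIV (f x)" by simp_all
qed

lemma set_integral_parameter_tendsto:
  fixes f :: "'a::euclidean_space \<Rightarrow> real \<Rightarrow> real"
  assumes K: "compact K" and f: "continuous_on UNIV (\<lambda>(x, t). f x t)"
  shows "(\<lambda>m. LINT x:K|lborel. f x (1 / real (Suc m))) \<longlonglongrightarrow> (LINT x:K|lborel. f x 0)"
proof -
  have [measurable]: "(\<lambda>x. f x t) \<in> borel_measurable borel" for t
    using continuous_on_case_prodD(1)[OF f] by (rule borel_measurable_continuous_onI)
  have [measurable]: "K \<in> sets borel" using K by (rule borel_compact)
  \<comment> \<open>All parameters \<open>1 / real (Suc m)\<close> lie between 0 and 1, so a bound
    on this compact set is a majorant for the whole sequence.\<close>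
  have "bounded ((\<lambda>(x, t). f x t) ` (K \<times> {0..1}))"
    by (intro compact_imp_bounded compact_continuous_image compact_Times K continuous_on_subset[OF f]) auto
  then obtain B where B: "\<And>x t. x \<in> K \<Longrightarrow> 0 \<le> t \<Longrightarrow> t \<le> 1 \<Longrightarrow> \<bar>f x t\<bar> \<le> B"
    by (force simp: bounded_iff)
  show ?thesis
    unfolding set_lebesgue_integral_def real_scaleR_def
  proof (rule integral_dominated_convergence[where w = "\<lambda>x. indicator K x * B"])
    show "integrable lborel (\<lambda>x. indicator K x * B)"
      using set_integral_compact_continuous[OF K, of "\<lambda>_. B"] by (simp add: set_integrable_def)
    show "AE x in lborel. (\<lambda>m. indicator K x * f x (1 / real (Suc m))) \<longlonglongrightarrow> indicator K x * f x 0"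
    proof (intro AE_I2 tendsto_mult tendsto_const)
      fix x
      have "continuous_on UNIV (f x)"
        by (rule continuous_on_case_prodD(2)[OF f])
      then have "isCont (f x) 0" by (simp add: continuous_on_eq_continuous_at)
      moreover have "(\<lambda>m. 1 / real (Suc m)) \<longlonglongrightarrow> 0" by (rule LIMSEQ_Suc[OF lim_1_over_n])
      ultimately show "(\<lambda>m. f x (1 / real (Suc m))) \<longlonglongrightarrow> f x 0" by (rule isCont_tendsto_compose)
    qed
    show "AE x in lborel. norm (indicator K x * f x (1 / real (Suc m))) \<le> indicator K x * B" for m
      using B by (intro AE_I2) (auto simp: indicator_def)
  qed measurable
qed

text \<open>
  Balancing the prisms of height \<open>T\<close> along \<open>e\<close> and dividing by \<open>T\<close>, the limit \<open>T \<rightarrow> 0\<close> gives the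
  divergence theorem for the field \<open>g e\<close>; \<open>q x 0\<close> is the derivative of \<open>g\<close> along \<open>e\<close>.
\<close>
lemma halfspace_divergence:
  fixes n :: "'i \<Rightarrow> 'a::euclidean_space" and g :: "'a \<Rightarrow> real"
  assumes fin: "finite I" and K: "K = {x. \<forall>i\<in>I. n i \<bullet> x \<le> c i}" and comp: "compact K"
    and unit: "\<And>i. i \<in> I \<Longrightarrow> norm (n i) = 1" and inj: "inj_on (\<lambda>i. (n i, c i)) I"
    and e: "e \<noteq> 0" and g: "continuous_on UNIV g"
    and q: "continuous_on UNIV (\<lambda>(x, t). q x t)" "\<And>x t. g (x + t *\<^sub>R e) = g x + t * q x t"
  shows "(LINT x:K|lborel. q x 0) = (\<Sum>i\<in>I. (n i \<bullet> e) *
     (LINT y:prism (n i) 1 (K \<inter> {x. n i \<bullet> x = c i})|lborel. g (y - (n i \<bullet> y - c i) *\<^sub>R n i)))"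
proof -
  let ?F = "\<lambda>i. K \<inter> {x. n i \<bullet> x = c i}"
  \<comment> \<open>For t = 0 the argument of g is the orthogonal projection of y onto the
    hyperplane, which gives the surface integral of g; t > 0 is the slanted prism after the change
    of variables.\<close>
  define G where "G = (\<lambda>i t. LINT y:prism (n i) 1 (?F i)|lborel. g (y + (n i \<bullet> y - c i) *\<^sub>R (t *\<^sub>R e - n i)))"
  have cF: "compact (?F i)" for i by (intro compact_Int_closed comp closed_hyperplane)
  have gm: "g \<in> borel_measurable borel" using g by (rule borel_measurable_continuous_onI)
  have main: "(LINT x:K|lborel. q x t) = (\<Sum>i\<in>I. (n i \<bullet> e) * G i t)" if t: "t > 0" for t
  proof -
    have qc: "continuous_on UNIV (\<lambda>x. q x t)" for t
      by (rule continuous_on_case_prodD(1)[OF q(1)])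
    have "(LINT y:(+) (t *\<^sub>R e) ` K|lborel. g y) = (LINT x:K|lborel. g x + t * q x t)"
      by (subst set_integral_translate) (auto simp: q gm borel_compact comp)
    also have "\<dots> = (LINT x:K|lborel. g x) + t * (LINT x:K|lborel. q x t)"
      by (subst set_integral_add)
         (auto intro!: set_integral_compact_continuous comp continuous_intros
            continuous_on_subset[OF g] continuous_on_subset[OF qc])
    finally have KT: "(LINT y:(+) (t *\<^sub>R e) ` K|lborel. g y) =
      (LINT x:K|lborel. g x) + t * (LINT x:K|lborel. q x t)" .
    have P: "(LINT y:prism e t (?F i)|lborel. g y) = t * \<bar>n i \<bullet> e\<bar> * G i t"
      if "i \<in> I" "n i \<bullet> e \<noteq> 0" for i
      unfolding G_def using that unit t by (intro prism_integral cF g) auto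
    have "t * (LINT x:K|lborel. q x t) =
      (\<Sum>i | i \<in> I \<and> n i \<bullet> e > 0. t * \<bar>n i \<bullet> e\<bar> * G i t) - (\<Sum>i | i \<in> I \<and> n i \<bullet> e < 0. t * \<bar>n i \<bullet> e\<bar> * G i t)"
      using prism_balance[OF fin K comp unit inj e t g] unfolding KT by (simp add: P)
    \<comment> \<open>The signs of \<open>n i \<bullet> e\<close> absorb the difference of the two
      sums, and facets parallel to e contribute 0, so the sum extends to all of I.\<close>
    also have "\<dots> = (\<Sum>i\<in>I. t * ((n i \<bullet> e) * G i t))"
    proof -
      have "(\<Sum>i\<in>I. t * ((n i \<bullet> e) * G i t)) =
        (\<Sum>i\<in>I. (if n i \<bullet> e > 0 then t * \<bar>n i \<bullet> e\<bar> * G i t else 0) -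
          (if n i \<bullet> e < 0 then t * \<bar>n i \<bullet> e\<bar> * G i t else 0))"
        by (rule sum.cong) auto
      then show ?thesis
        using fin by (simp add: sum_subtractf sum.If_cases Int_def)
    qed
    finally show ?thesis using t by (simp add: sum_distrib_left[symmetric])
  qed
  have "(\<lambda>m. LINT x:K|lborel. q x (1 / real (Suc m))) \<longlonglongrightarrow> (LINT x:K|lborel. q x 0)"
    by (rule set_integral_parameter_tendsto[OF comp q(1)])
  moreover have "(\<lambda>m. \<Sum>i\<in>I. (n i \<bullet> e) * G i (1 / real (Suc m))) \<longlonglongrightarrow> (\<Sum>i\<in>I. (n i \<bullet> e) * G i 0)"
    unfolding G_def
    by (intro tendsto_sum tendsto_mult tendsto_const set_integral_parameter_tendsto compact_prism cF)
       (auto simp: case_prod_unfold intro!: continuous_intros continuous_on_compose2[OF g])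
  moreover have "(LINT x:K|lborel. q x (1 / real (Suc m))) = (\<Sum>i\<in>I. (n i \<bullet> e) * G i (1 / real (Suc m)))" for m
    by (rule main) simp
  ultimately have "(LINT x:K|lborel. q x 0) = (\<Sum>i\<in>I. (n i \<bullet> e) * G i 0)"
    using LIMSEQ_unique by simp
  then show ?thesis by (simp add: G_def)
qed

text \<open>The difference quotient of a polynomial in t is again polynomial, so it needs no
  exception at t = 0 and is continuous in x and t together. For a product, expanding both factors
  gives the quotient f r + g q + t q r.\<close>

lemma real_polynomial_function_increment:
  assumes "real_polynomial_function g"
  shows "\<exists>q. continuous_on UNIV (\<lambda>(x, t). q x t) \<and> (\<forall>x t. g (x + t *\<^sub>R e) = g x + t * q x t)"
  using assms
proof induction
  case (linear f)
  then show ?case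
    by (intro exI[of _ "\<lambda>x t. f e"])
       (auto simp: linear_simps bounded_linear.linear)
next
  case (const c)
  show ?case by (intro exI[of _ "\<lambda>x t. 0"]) auto
next
  case (add f g)
  then obtain q r where
    "continuous_on UNIV (\<lambda>(x, t). q x t)" "\<forall>x t. f (x + t *\<^sub>R e) = f x + t * q x t"
    "continuous_on UNIV (\<lambda>(x, t). r x t)" "\<forall>x t. g (x + t *\<^sub>R e) = g x + t * r x t" by blast
  then show ?case
    by (intro exI[of _ "\<lambda>x t. q x t + r x t"])
       (auto simp: case_prod_unfold algebra_simps intro!: continuous_intros)
next
  case (mult f g)
  then obtain q r where qr:
    "continuous_on UNIV (\<lambda>(x, t). q x t)" "\<forall>x t. f (x + t *\<^sub>R e) = f x + t * q x t"
    "continuous_on UNIV (\<lambda>(x, t). r x t)" "\<forall>x t. g (x + t *\<^sub>R e) = g x + t * r x t" by blast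
  have "continuous_on UNIV f" "continuous_on UNIV g"
    using mult(1,2) by (auto simp: real_polynomial_function_eq intro: continuous_on_polymonial_function)
  then show ?case
    using qr
    by (intro exI[of _ "\<lambda>x t. f x * r x t + g x * q x t + t * q x t * r x t"])
       (auto simp: case_prod_unfold algebra_simps intro!: continuous_intros intro: continuous_on_compose2)
qed

subsection \<open>Facets, surface integrals and the divergence theorem\<close>

text \<open>The facet has the dimension of the hyperplane, and a proper affine subset of the
  hyperplane would have a smaller one.\<close>

lemma facet_affine_hull:
  fixes K :: "'a::euclidean_space set"
  assumes "interior K \<noteq> {}" "F facet_of K" "n \<noteq> 0" "F \<subseteq> {x. n \<bullet> x = c}"
  shows "affine hull F = {x. n \<bullet> x = c}"
proof (rule ccontr)
  assume *: "affine hull F \<noteq> {x. n \<bullet> x = c}"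
  have "aff_dim K = int DIM('a)" using assms(1) by (rule aff_dim_nonempty_interior)
  then have dimF: "aff_dim F = int DIM('a) - 1" using assms(2) by (simp add: facet_of_def)
  have "affine hull F \<subseteq> {x. n \<bullet> x = c}"
    using assms(4) by (rule hull_minimal) (rule affine_hyperplane)
  then have "affine hull F \<subset> {x. n \<bullet> x = c}" using * by blast
  moreover have "affine hull {x. n \<bullet> x = c} = {x. n \<bullet> x = c}"
    by (simp add: affine_hyperplane hull_same)
  ultimately have "aff_dim F < aff_dim {x. n \<bullet> x = c}"
    by (metis aff_dim_psubset)
  then show False using dimF assms(3) by simp
qed

text \<open>Both hyperplanes are the affine hull of F. The part u of m orthogonal to n is therefore
  a direction of both, hence orthogonal to n and to m, and so it is zero.\<close>

lemma facet_unit_normals: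
  fixes K :: "'a::euclidean_space set"
  assumes K: "interior K \<noteq> {}" and F: "F facet_of K" and n: "norm n = 1" and m: "norm m = 1"
    and Fn: "F \<subseteq> {x. n \<bullet> x = c}" and Fm: "F \<subseteq> {x. m \<bullet> x = d}"
  shows "m = n \<or> m = - n"
proof -
  have nn: "n \<bullet> n = 1" "m \<bullet> m = 1" using n m by (simp_all add: norm_eq_1)
  have eq: "{x. n \<bullet> x = c} = {x. m \<bullet> x = d}"
    using facet_affine_hull[OF K F _ Fn] facet_affine_hull[OF K F _ Fm] n m by force
  obtain x where x: "x \<in> F" using F by (auto simp: facet_of_def)
  define u where "u = m - (n \<bullet> m) *\<^sub>R n"
  have "n \<bullet> u = 0" by (simp add: u_def inner_diff_right nn)
  then have "x + u \<in> {x. n \<bullet> x = c}" using x Fn by (auto simp: inner_add_right)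
  then have "m \<bullet> u = 0" using x Fm unfolding eq by (auto simp: inner_add_right)
  then have sq: "(n \<bullet> m) * (n \<bullet> m) = 1" by (simp add: u_def inner_diff_right nn inner_commute)
  have "u \<bullet> u = 0"
    using \<open>n \<bullet> u = 0\<close> \<open>m \<bullet> u = 0\<close> by (simp add: u_def inner_diff_left)
  then have "m = (n \<bullet> m) *\<^sub>R n" by (simp add: u_def)
  moreover have "n \<bullet> m = 1 \<or> n \<bullet> m = -1" using sq by (simp add: square_eq_1_iff)
  ultimately show ?thesis by force
qed

text \<open>Makes the definite description meaningful. The only rival of a unit normal is its
  opposite, and if both were outward then K would be squeezed into a hyperplane and have empty
  interior.\<close>

lemma outward_normal_ex1:
  fixes K :: "'a::euclidean_space set"
  assumes "polytope K" "interior K \<noteq> {}" "F facet_of K"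
  shows "\<exists>!n. norm n = 1 \<and> (\<exists>c. K \<subseteq> {x. n \<bullet> x \<le> c} \<and> F = K \<inter> {x. n \<bullet> x = c})"
proof -
  obtain a b where ab: "a \<noteq> 0" "K \<subseteq> {x. a \<bullet> x \<le> b}" "F = K \<inter> {x. a \<bullet> x = b}"
    using facet_of_polyhedron[OF polytope_imp_polyhedron[OF assms(1)] assms(3)] by metis
  let ?n = "a /\<^sub>R norm a"
  have ex: "norm ?n = 1 \<and> (\<exists>c. K \<subseteq> {x. ?n \<bullet> x \<le> c} \<and> F = K \<inter> {x. ?n \<bullet> x = c})"
    using ab by (intro conjI exI[of _ "b / norm a"]) (auto simp: field_simps)
  have uniq: "m = n"
    if n: "norm n = 1" "K \<subseteq> {x. n \<bullet> x \<le> c}" "F = K \<inter> {x. n \<bullet> x = c}"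
      and m: "norm m = 1" "K \<subseteq> {x. m \<bullet> x \<le> d}" "F = K \<inter> {x. m \<bullet> x = d}" for n m c d
  proof (rule ccontr)
    assume "m \<noteq> n"
    then have mn: "m = - n" using facet_unit_normals[OF assms(2,3) n(1) m(1)] n(3) m(3) by blast
    obtain x where "x \<in> F" using assms(3) by (auto simp: facet_of_def)
    then have "d = - c" using n m mn by auto
    then have "K \<subseteq> {x. n \<bullet> x = c}" using n(2) m(2) mn by force
    then have "aff_dim K \<le> aff_dim {x. n \<bullet> x = c}" by (rule aff_dim_subset)
    moreover have "n \<noteq> 0" using n(1) by auto
    ultimately show False using aff_dim_nonempty_interior[OF assms(2)] by simp
  qed
  show ?thesis
    by (rule ex1I[of _ ?n]) (use ex uniq in blast)+
qed

text \<open>All points of a facet of a full-dimensional polytope give the same value, so the choice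
  is immaterial; a closed expression allows half-spaces to be indexed by facets.\<close>

definition facet_level :: "'a::euclidean_space set \<Rightarrow> 'a set \<Rightarrow> real" where
  "facet_level K F = outward_normal K F \<bullet> (SOME x. x \<in> F)"

lemma outward_normal:
  fixes K :: "'a::euclidean_space set"
  assumes "polytope K" "interior K \<noteq> {}" "F facet_of K"
  shows norm_outward_normal: "norm (outward_normal K F) = 1"
    and outward_normal_le: "K \<subseteq> {x. outward_normal K F \<bullet> x \<le> facet_level K F}"
    and facet_eq: "F = K \<inter> {x. outward_normal K F \<bullet> x = facet_level K F}"
proof -
  let ?n = "outward_normal K F"
  have "norm ?n = 1 \<and> (\<exists>c. K \<subseteq> {x. ?n \<bullet> x \<le> c} \<and> F = K \<inter> {x. ?n \<bullet> x = c})"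
    unfolding outward_normal_def by (rule theI'[OF outward_normal_ex1[OF assms]])
  then obtain c where c: "norm ?n = 1" "K \<subseteq> {x. ?n \<bullet> x \<le> c}" "F = K \<inter> {x. ?n \<bullet> x = c}" by blast
  have "(SOME x. x \<in> F) \<in> F" using assms(3) by (auto simp: facet_of_def some_in_eq)
  then have "facet_level K F = c" using c(3) by (auto simp: facet_level_def)
  then show "norm ?n = 1" "K \<subseteq> {x. ?n \<bullet> x \<le> facet_level K F}"
    "F = K \<inter> {x. ?n \<bullet> x = facet_level K F}" using c by auto
qed

lemma facet_subset_hyperplane:
  assumes "polytope K" "interior K \<noteq> {}" "F facet_of K"
  shows "F \<subseteq> {x. outward_normal K F \<bullet> x = facet_level K F}"
  using facet_eq[OF assms] by blast

text \<open>The segment from an interior point z to a point x outside K meets the frontier inside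
  some facet. The inequality of that facet is strict at z and tight at the crossing, so x violates
  it.\<close>

lemma polytope_facet_halfspaces:
  fixes K :: "'a::euclidean_space set"
  assumes K: "polytope K" "interior K \<noteq> {}"
  shows "K = {x. \<forall>F\<in>{F. F facet_of K}. outward_normal K F \<bullet> x \<le> facet_level K F}"
proof (intro subset_antisym subsetI)
  fix x assume x: "x \<in> {x. \<forall>F\<in>{F. F facet_of K}. outward_normal K F \<bullet> x \<le> facet_level K F}"
  show "x \<in> K"
  proof (rule ccontr)
    assume "x \<notin> K"
    obtain z where z: "z \<in> interior K" using K by blast
    have "closed_segment z x \<inter> frontier K \<noteq> {}"
      using z \<open>x \<notin> K\<close> interior_subset[of K]
      by (intro connected_Int_frontier) (auto simp: disjoint_iff)
    then obtain y where y: "y \<in> closed_segment z x" "y \<in> frontier K" by blast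
    have "frontier K = \<Union> {F. F facet_of K}"
      using rel_frontier_of_polyhedron[OF polytope_imp_polyhedron[OF K(1)]]
        rel_frontier_nonempty_interior[OF K(2)] by simp
    then obtain F where F: "F facet_of K" "y \<in> F" using y by blast
    note N = outward_normal[OF K F(1)]
    have "interior K \<inter> F = {}"
    proof -
      have "F \<noteq> K" using F(1) by (auto simp: facet_of_def)
      then show ?thesis
        using F(1) face_of_disjoint_interior[of F K] by (auto simp: facet_of_def)
    qed
    then have "outward_normal K F \<bullet> z < facet_level K F"
      using z N interior_subset[of K] by (force simp: disjoint_iff)
    moreover obtain t where t: "0 \<le> t" "t \<le> 1" "y = (1 - t) *\<^sub>R z + t *\<^sub>R x"
      using y(1) by (auto simp: closed_segment_def)
    moreover have "t \<noteq> 1" using t(3) F(2) \<open>x \<notin> K\<close> facet_of_imp_subset[OF F(1)] by auto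
    moreover have "outward_normal K F \<bullet> x \<le> facet_level K F" using x F by blast
    ultimately have "outward_normal K F \<bullet> y < (1 - t) * facet_level K F + t * facet_level K F"
      by (auto simp: inner_add_right intro!: add_less_le_mono mult_left_mono)
    moreover have "outward_normal K F \<bullet> y = facet_level K F" using N(3) F(2) by blast
    ultimately show False by (simp add: algebra_simps)
  qed
qed (use outward_normal_le[OF K] in blast)

lemma facet_subset_facet:
  assumes "F facet_of K" "G facet_of K" "F \<subseteq> G" "convex K"
  shows "F = G"
proof (rule ccontr)
  assume "F \<noteq> G"
  have "F face_of G"
    using assms by (meson face_of_subset facet_of_imp_face_of facet_of_imp_subset)
  moreover have "convex G" using assms(2) by (meson face_of_imp_convex facet_of_imp_face_of assms(4))
  ultimately have "aff_dim F < aff_dim G" using face_of_aff_dim_lt \<open>F \<noteq> G\<close> by blast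
  then show False using assms by (simp add: facet_of_def)
qed

text \<open>Another facet through a relative interior point of F would contain F and hence equal it.
  So the other, finitely many, constraints are strict at x and stay strict nearby.\<close>

lemma facet_local_halfspace:
  fixes K :: "'a::euclidean_space set"
  assumes K: "polytope K" "interior K \<noteq> {}" and F: "F facet_of K" and x: "x \<in> rel_interior F"
  obtains \<epsilon> where "0 < \<epsilon>"
    "\<And>y. dist x y < \<epsilon> \<Longrightarrow> outward_normal K F \<bullet> y \<le> facet_level K F \<Longrightarrow> y \<in> K"
proof -
  let ?U = "\<Inter>G\<in>{G. G facet_of K} - {F}. {y. outward_normal K G \<bullet> y < facet_level K G}"
  have "open ?U"
    using finite_polytope_facets[OF K(1)] by (intro open_INT ballI open_halfspace_lt finite_Diff)
  moreover have "x \<in> ?U"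
  proof clarify
    fix G assume G: "G facet_of K" "G \<noteq> F"
    have "x \<in> K" using x F rel_interior_subset facet_of_imp_subset by blast
    have "x \<notin> G"
    proof
      assume "x \<in> G"
      then have "F \<subseteq> G"
        using x G F by (intro subset_of_face_of[of G K F]) (auto simp: facet_of_imp_face_of facet_of_imp_subset)
      then show False using facet_subset_facet[OF F G(1)] G(2) polytope_imp_convex[OF K(1)] by blast
    qed
    then show "outward_normal K G \<bullet> x < facet_level K G"
      using outward_normal[OF K G(1)] \<open>x \<in> K\<close> by force
  qed
  ultimately obtain \<epsilon> where \<epsilon>: "0 < \<epsilon>" "ball x \<epsilon> \<subseteq> ?U" by (meson open_contains_ball)
  show thesis
  proof
    fix y assume y: "dist x y < \<epsilon>" "outward_normal K F \<bullet> y \<le> facet_level K F"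
    have "y \<in> ?U" using \<epsilon> y by auto
    then have "\<forall>G\<in>{G. G facet_of K}. outward_normal K G \<bullet> y \<le> facet_level K G"
      using y(2) by (metis (mono_tags, lifting) Diff_iff INT_E empty_iff insert_iff less_imp_le mem_Collect_eq)
    then show "y \<in> K" using polytope_facet_halfspaces[OF K] by blast
  qed (rule \<epsilon>(1))
qed

text \<open>Both sides are the derivative at t = 0 of g along the line in direction e.\<close>

lemma frechet_derivative_increment:
  fixes g :: "'a::euclidean_space \<Rightarrow> real"
  assumes g: "g differentiable (at x)"
    and q: "continuous_on UNIV (\<lambda>(x, t). q x t)" "\<And>x t. g (x + t *\<^sub>R e) = g x + t * q x t"
  shows "frechet_derivative g (at x) e = q x 0"
proof -
  let ?D = "frechet_derivative g (at x)"
  have D: "(g has_derivative ?D) (at (x + 0 *\<^sub>R e))" using g by (simp add: frechet_derivative_works)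
  have "((\<lambda>t. x + t *\<^sub>R e) has_derivative (\<lambda>t. t *\<^sub>R e)) (at (0::real))"
    by (auto intro!: derivative_eq_intros)
  from has_derivative_compose[OF this D]
  have "((\<lambda>t. g (x + t *\<^sub>R e)) has_derivative (\<lambda>t. t * ?D e)) (at 0)"
    using linear_scale[OF has_derivative_linear[OF D]] by simp
  then have 1: "((\<lambda>t. g (x + t *\<^sub>R e)) has_field_derivative ?D e) (at 0)"
    by (simp add: has_field_derivative_def mult.commute[of "?D e"] mult_commute_abs)
  have "isCont (q x) 0"
    using continuous_on_case_prodD(2)[OF q(1)] by (simp add: continuous_on_eq_continuous_at)
  then have "(q x \<longlongrightarrow> q x 0) (at 0)" by (simp add: isCont_def)
  then have "((\<lambda>h. (g (x + (0 + h) *\<^sub>R e) - g (x + 0 *\<^sub>R e)) / h) \<longlongrightarrow> q x 0) (at 0)"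
    by (rule Lim_transform_eventually) (auto simp: q eventually_at_filter)
  then have "((\<lambda>t. g (x + t *\<^sub>R e)) has_field_derivative q x 0) (at 0)" by (simp add: DERIV_def)
  with 1 show ?thesis by (rule DERIV_unique)
qed

lemma polytope_divergence_lborel:
  fixes g :: "'a::euclidean_space \<Rightarrow> real"
  assumes K: "polytope K" "interior K \<noteq> {}" and e: "e \<noteq> 0" and g: "real_polynomial_function g"
  shows "continuous_on UNIV (\<lambda>x. frechet_derivative g (at x) e)"
    and "(LINT x:K|lborel. frechet_derivative g (at x) e) =
      (\<Sum>F | F facet_of K. (outward_normal K F \<bullet> e) * (LINT y:prism (outward_normal K F) 1 F|lborel.
        g (y - (outward_normal K F \<bullet> y - facet_level K F) *\<^sub>R outward_normal K F)))"
proof -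
  obtain q where q: "continuous_on UNIV (\<lambda>(x, t). q x t)" "\<And>x t. g (x + t *\<^sub>R e) = g x + t * q x t"
    using real_polynomial_function_increment[OF g] by blast
  have gc: "continuous_on UNIV g"
    using g by (auto simp: real_polynomial_function_eq intro: continuous_on_polymonial_function)
  have D: "frechet_derivative g (at x) e = q x 0" for x
    using g by (intro frechet_derivative_increment[OF _ q] differentiable_at_real_polynomial_function)
  show "continuous_on UNIV (\<lambda>x. frechet_derivative g (at x) e)"
    unfolding D by (rule continuous_on_case_prodD(1)[OF q(1)])
  let ?I = "{F. F facet_of K}"
  note N = outward_normal[OF K]
  have inj: "inj_on (\<lambda>F. (outward_normal K F, facet_level K F)) ?I"
  proof (rule inj_onI)
    fix F G assume "F \<in> ?I" "G \<in> ?I"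
      and eq: "(outward_normal K F, facet_level K F) = (outward_normal K G, facet_level K G)"
    then show "F = G" using N(3)[of F] N(3)[of G] by auto
  qed
  have "(LINT x:K|lborel. q x 0) = (\<Sum>F\<in>?I. (outward_normal K F \<bullet> e) *
     (LINT y:prism (outward_normal K F) 1 (K \<inter> {x. outward_normal K F \<bullet> x = facet_level K F})|lborel.
       g (y - (outward_normal K F \<bullet> y - facet_level K F) *\<^sub>R outward_normal K F)))"
    by (rule halfspace_divergence[OF finite_polytope_facets[OF K(1)] polytope_facet_halfspaces[OF K]
          polytope_imp_compact[OF K(1)] _ inj e gc q])
       (use N(1) in auto)
  also have "\<dots> = (\<Sum>F | F facet_of K. (outward_normal K F \<bullet> e) * (LINT y:prism (outward_normal K F) 1 F|lborel.
        g (y - (outward_normal K F \<bullet> y - facet_level K F) *\<^sub>R outward_normal K F)))"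
    by (intro sum.cong refl) (simp add: N(3)[symmetric])
  finally show "(LINT x:K|lborel. frechet_derivative g (at x) e) = \<dots>" unfolding D .
qed

section \<open>Surface integrals as integrals over right prisms\<close>

lemma set_integral_lebesgue_eq_lborel:
  fixes g :: "'a::euclidean_space \<Rightarrow> real"
  assumes "compact S" "continuous_on S g"
  shows "(LINT x:S|lebesgue. g x) = (LINT x:S|lborel. g x)"
  using borel_measurable_integrable[OF borel_integrable_compact[OF assms]]
  unfolding set_lebesgue_integral_def by (intro integral_completion) simp

lemma closest_point_hyperplane:
  fixes n :: "'a::euclidean_space"
  assumes n: "norm n = 1" and F: "F \<subseteq> {x. n \<bullet> x = c}" and x: "x \<in> F"
  shows "closest_point (affine hull F) (x + h *\<^sub>R n) = x"
proof (rule closest_point_unique[symmetric])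
  show "convex (affine hull F)" "closed (affine hull F)"
    by (simp_all add: affine_imp_convex affine_affine_hull)
  show "x \<in> affine hull F" using x by (rule hull_inc)
  have hull: "affine hull F \<subseteq> {x. n \<bullet> x = c}"
    using F by (rule hull_minimal) (rule affine_hyperplane)
  show "\<forall>z\<in>affine hull F. dist (x + h *\<^sub>R n) x \<le> dist (x + h *\<^sub>R n) z"
  proof
    fix z assume "z \<in> affine hull F"
    then have "n \<bullet> (x + h *\<^sub>R n - z) = h"
      using hull F x n by (auto simp: inner_add_right inner_diff_right norm_eq_1)
    then have "\<bar>h\<bar> \<le> norm n * norm (x + h *\<^sub>R n - z)" by (metis Cauchy_Schwarz_ineq2)
    then show "dist (x + h *\<^sub>R n) x \<le> dist (x + h *\<^sub>R n) z" using n by (simp add: dist_norm)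
  qed
qed

text \<open>The point \<open>y - (n \<bullet> y - c) *\<^sub>R n\<close> is the closest point of the
  hyperplane. The integrand g matters only on F, where it may be a trace; the globally continuous h
  makes it integrable and open to the prism formulas.\<close>

lemma surface_integral_eq:
  fixes n :: "'a::euclidean_space"
  assumes n: "norm n = 1" and F: "F \<subseteq> {x. n \<bullet> x = c}" "compact F"
    and g: "\<And>x. x \<in> F \<Longrightarrow> g x = h x" and h: "continuous_on UNIV h"
  shows "surface_integral n F g = (LINT y:prism n 1 F|lborel. h (y - (n \<bullet> y - c) *\<^sub>R n))"
proof -
  have P: "{x + h *\<^sub>R n |x h. x \<in> F \<and> 0 \<le> h \<and> h \<le> 1} = prism n 1 F" by (simp add: prism_def)
  have cP: "compact (prism n 1 F)" using F(2) by (rule compact_prism)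
  have eq: "g (closest_point (affine hull F) y) = h (y - (n \<bullet> y - c) *\<^sub>R n)" if "y \<in> prism n 1 F" for y
  proof -
    obtain x s where xs: "y = x + s *\<^sub>R n" "x \<in> F" using \<open>y \<in> prism n 1 F\<close> by (auto simp: prism_def)
    then have "n \<bullet> y - c = s" using F n by (auto simp: inner_add_right norm_eq_1)
    then show ?thesis using xs g closest_point_hyperplane[OF n F(1)] by simp
  qed
  have "surface_integral n F g = (LINT y:prism n 1 F|lebesgue. h (y - (n \<bullet> y - c) *\<^sub>R n))"
    unfolding surface_integral_def P set_lebesgue_integral_def
    by (intro Bochner_Integration.integral_cong) (auto simp: indicator_def eq)
  also have "\<dots> = (LINT y:prism n 1 F|lborel. h (y - (n \<bullet> y - c) *\<^sub>R n))"
    by (intro set_integral_lebesgue_eq_lborel cP continuous_on_compose2[OF h] continuous_intros) auto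
  finally show ?thesis .
qed

lemma surface_integral_cong:
  assumes "norm n = 1" "F \<subseteq> {x. n \<bullet> x = c}" "\<And>x. x \<in> F \<Longrightarrow> g x = h x"
  shows "surface_integral n F g = surface_integral n F h"
  unfolding surface_integral_def set_lebesgue_integral_def
proof (intro Bochner_Integration.integral_cong refl)
  fix y
  show "indicator {x + h *\<^sub>R n |x h. x \<in> F \<and> 0 \<le> h \<and> h \<le> 1} y *\<^sub>R g (closest_point (affine hull F) y) =
    indicator {x + h *\<^sub>R n |x h. x \<in> F \<and> 0 \<le> h \<and> h \<le> 1} y *\<^sub>R h (closest_point (affine hull F) y)"
    using closest_point_hyperplane[OF assms(1,2)] assms(3) by (auto simp: indicator_def)
qed

lemma surface_integral_zero:
  assumes "norm n = 1" "F \<subseteq> {x. n \<bullet> x = c}" "\<And>x. x \<in> F \<Longrightarrow> g x = 0"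
  shows "surface_integral n F g = 0"
  using surface_integral_cong[OF assms(1,2), of g "\<lambda>_. 0"] assms(3)
  by (simp add: surface_integral_def)

lemma surface_integral_uminus_fun: "surface_integral n F (\<lambda>x. - g x) = - surface_integral n F g"
  by (simp add: surface_integral_def set_lebesgue_integral_def)

lemma surface_integral_cmult: "surface_integral n F (\<lambda>x. a * g x) = a * surface_integral n F g"
  by (simp add: surface_integral_def)

lemma surface_integral_add:
  fixes n :: "'a::euclidean_space"
  assumes n: "norm n = 1" and F: "F \<subseteq> {x. n \<bullet> x = c}" "compact F"
    and g: "continuous_on UNIV g" and h: "continuous_on UNIV h"
  shows "surface_integral n F (\<lambda>x. g x + h x) = surface_integral n F g + surface_integral n F h"
proof -
  have "continuous_on UNIV (\<lambda>x. g x + h x)" using g h by (intro continuous_intros)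
  moreover have "set_integrable lborel (prism n 1 F) (\<lambda>y. f (y - (n \<bullet> y - c) *\<^sub>R n))"
    if "continuous_on UNIV f" for f :: "'a \<Rightarrow> real"
    by (intro set_integral_compact_continuous compact_prism F continuous_on_compose2[OF that]
        continuous_intros) auto
  ultimately show ?thesis
    using g h by (simp add: surface_integral_eq[OF n F refl] set_integral_add)
qed

lemma surface_integral_sum:
  fixes n :: "'a::euclidean_space"
  assumes n: "norm n = 1" and F: "F \<subseteq> {x. n \<bullet> x = c}" "compact F" and B: "finite B"
    and g: "\<And>b. b \<in> B \<Longrightarrow> continuous_on UNIV (g b)"
  shows "surface_integral n F (\<lambda>x. \<Sum>b\<in>B. g b x) = (\<Sum>b\<in>B. surface_integral n F (g b))"
  using B g
proof (induction B)
  case empty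
  then show ?case by (simp add: surface_integral_def)
next
  case (insert b B)
  then show ?case
    using surface_integral_add[OF n F, of "g b" "\<lambda>x. \<Sum>b\<in>B. g b x"]
    by (simp add: continuous_on_sum)
qed

text \<open>The definition builds its cylinder on one side of F. The two cylinders differ by the
  translation along \<open>- n\<close>, which the projection to the hyperplane does not see.\<close>

lemma surface_integral_flip:
  fixes n :: "'a::euclidean_space"
  assumes n: "norm n = 1" and F: "F \<subseteq> {x. n \<bullet> x = c}" "compact F" and h: "continuous_on UNIV h"
  shows "surface_integral (- n) F h = surface_integral n F h"
proof -
  have nn: "n \<bullet> n = 1" using n by (simp add: norm_eq_1)
  have P: "prism (- n) 1 F = (+) (- n) ` prism n 1 F"
  proof (intro subset_antisym subsetI)
    fix y assume "y \<in> prism (- n) 1 F"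
    then obtain z s where "y = z + s *\<^sub>R (- n)" "z \<in> F" "0 \<le> s" "s \<le> 1" by (auto simp: prism_def)
    moreover from this have "z + (1 - s) *\<^sub>R n \<in> prism n 1 F"
      unfolding prism_def by (intro CollectI exI[of _ z] exI[of _ "1 - s"]) auto
    ultimately show "y \<in> (+) (- n) ` prism n 1 F"
      by (intro image_eqI[of _ _ "z + (1 - s) *\<^sub>R n"]) (auto simp: algebra_simps)
  next
    fix y assume "y \<in> (+) (- n) ` prism n 1 F"
    then obtain z s where zs: "y = - n + (z + s *\<^sub>R n)" "z \<in> F" "0 \<le> s" "s \<le> 1" by (auto simp: prism_def)
    then have "y = z + (1 - s) *\<^sub>R (- n)" by (simp add: algebra_simps)
    then show "y \<in> prism (- n) 1 F" using zs unfolding prism_def by (auto intro!: exI[of _ z] exI[of _ "1 - s"])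
  qed
  have cont: "continuous_on UNIV (\<lambda>y. h (y - (n \<bullet> y - c) *\<^sub>R n))"
    by (intro continuous_on_compose2[OF h] continuous_intros) auto
  have "surface_integral (- n) F h = (LINT y:prism (- n) 1 F|lborel. h (y - ((- n) \<bullet> y - (- c)) *\<^sub>R (- n)))"
    using n F h by (intro surface_integral_eq) auto
  also have "\<dots> = (LINT y:(+) (- n) ` prism n 1 F|lborel. h (y - (n \<bullet> y - c) *\<^sub>R n))"
    unfolding P by (simp add: algebra_simps)
  also have "\<dots> = (LINT y:prism n 1 F|lborel. h ((y + (- n)) - (n \<bullet> (y + (- n)) - c) *\<^sub>R n))"
    by (rule set_integral_translate)
       (use cont F in \<open>auto intro: borel_compact compact_prism borel_measurable_continuous_onI\<close>)
  also have "\<dots> = (LINT y:prism n 1 F|lborel. h (y - (n \<bullet> y - c) *\<^sub>R n))"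
    by (simp add: inner_diff_right nn algebra_simps)
  also have "\<dots> = surface_integral n F h"
    using n F h by (intro surface_integral_eq[symmetric]) auto
  finally show ?thesis .
qed

lemma surface_integral_translate:
  fixes n :: "'a::euclidean_space"
  assumes n: "norm n = 1" and F: "F \<subseteq> {x. n \<bullet> x = c}" "compact F" and h: "continuous_on UNIV h"
  shows "surface_integral n ((+) r ` F) h = surface_integral n F (\<lambda>x. h (x + r))"
proof -
  have nn: "n \<bullet> n = 1" using n by (simp add: norm_eq_1)
  have P: "prism n 1 ((+) r ` F) = (+) r ` prism n 1 F"
    by (auto simp: prism_def image_iff algebra_simps) (metis add.assoc add.commute)+
  define d where "d = c + n \<bullet> r"
  have cont: "continuous_on UNIV (\<lambda>y. h (y - (n \<bullet> y - d) *\<^sub>R n))"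
    by (intro continuous_on_compose2[OF h] continuous_intros) auto
  have hr: "continuous_on UNIV (\<lambda>x. h (x + r))"
    by (intro continuous_on_compose2[OF h] continuous_intros) auto
  have "surface_integral n ((+) r ` F) h = (LINT y:prism n 1 ((+) r ` F)|lborel. h (y - (n \<bullet> y - d) *\<^sub>R n))"
    using n F h by (intro surface_integral_eq) (auto simp: inner_add_right d_def compact_translation)
  also have "\<dots> = (LINT y:prism n 1 F|lborel. h ((y + r) - (n \<bullet> (y + r) - d) *\<^sub>R n))"
    unfolding P by (rule set_integral_translate)
       (use cont F in \<open>auto intro: borel_compact compact_prism borel_measurable_continuous_onI\<close>)
  also have "\<dots> = (LINT y:prism n 1 F|lborel. h ((y - (n \<bullet> y - c) *\<^sub>R n) + r))"
    by (simp add: inner_add_right d_def algebra_simps)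
  also have "\<dots> = surface_integral n F (\<lambda>x. h (x + r))"
    using n F hr by (intro surface_integral_eq[symmetric]) auto
  finally show ?thesis .
qed

lemma compact_facet: "polytope K \<Longrightarrow> F facet_of K \<Longrightarrow> compact F"
  by (meson face_of_polytope_polytope facet_of_imp_face_of polytope_imp_compact)

lemma polytope_divergence:
  fixes g :: "'a::euclidean_space \<Rightarrow> 'a \<Rightarrow> real"
  assumes K: "polytope K" "interior K \<noteq> {}"
    and g: "\<And>b. b \<in> Basis \<Longrightarrow> real_polynomial_function (g b)"
  shows "(LINT x:K|lborel. \<Sum>b\<in>Basis. frechet_derivative (g b) (at x) b) =
    (\<Sum>F | F facet_of K. surface_integral (outward_normal K F) F
       (\<lambda>x. \<Sum>b\<in>Basis. (outward_normal K F \<bullet> b) * g b x))"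
proof -
  have gc: "continuous_on UNIV (g b)" if "b \<in> Basis" for b
    using g[OF that] by (auto simp: real_polynomial_function_eq intro: continuous_on_polymonial_function)
  note N = outward_normal[OF K]
  have S: "surface_integral (outward_normal K F) F (g b) = (LINT y:prism (outward_normal K F) 1 F|lborel.
        g b (y - (outward_normal K F \<bullet> y - facet_level K F) *\<^sub>R outward_normal K F))"
    if "b \<in> Basis" "F facet_of K" for b F
    using that N[of F] gc compact_facet[OF K(1)] by (intro surface_integral_eq) auto
  have "(LINT x:K|lborel. \<Sum>b\<in>Basis. frechet_derivative (g b) (at x) b) =
    (\<Sum>b\<in>Basis. LINT x:K|lborel. frechet_derivative (g b) (at x) b)"
    unfolding set_lebesgue_integral_def scaleR_sum_right
  proof (rule Bochner_Integration.integral_sum)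
    fix b :: 'a assume b: "b \<in> Basis"
    have "continuous_on UNIV (\<lambda>x. frechet_derivative (g b) (at x) b)"
      using polytope_divergence_lborel(1)[OF K _ g] b nonzero_Basis by blast
    then show "integrable lborel (\<lambda>x. indicator K x *\<^sub>R frechet_derivative (g b) (at x) b)"
      by (intro borel_integrable_compact polytope_imp_compact K) (auto intro: continuous_on_subset)
  qed
  also have "\<dots> = (\<Sum>b\<in>Basis. \<Sum>F | F facet_of K. (outward_normal K F \<bullet> b) *
      surface_integral (outward_normal K F) F (g b))"
  proof (intro sum.cong refl)
    fix b :: 'a assume b: "b \<in> Basis"
    show "(LINT x:K|lborel. frechet_derivative (g b) (at x) b) =
      (\<Sum>F | F facet_of K. (outward_normal K F \<bullet> b) * surface_integral (outward_normal K F) F (g b))"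
      unfolding polytope_divergence_lborel(2)[OF K nonzero_Basis[OF b] g[OF b]]
      using S[OF b] by (intro sum.cong) auto
  qed
  also have "\<dots> = (\<Sum>F | F facet_of K. \<Sum>b\<in>Basis. (outward_normal K F \<bullet> b) *
      surface_integral (outward_normal K F) F (g b))"
    by (rule sum.swap)
  also have "\<dots> = (\<Sum>F | F facet_of K. surface_integral (outward_normal K F) F
       (\<lambda>x. \<Sum>b\<in>Basis. (outward_normal K F \<bullet> b) * g b x))"
  proof (intro sum.cong refl)
    fix F assume "F \<in> {F. F facet_of K}"
    then have F: "F facet_of K" by simp
    show "(\<Sum>b\<in>Basis. (outward_normal K F \<bullet> b) * surface_integral (outward_normal K F) F (g b)) =
      surface_integral (outward_normal K F) F (\<lambda>x. \<Sum>b\<in>Basis. (outward_normal K F \<bullet> b) * g b x)"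
      by (subst surface_integral_sum[OF N(1)[OF F] facet_subset_hyperplane[OF K F] compact_facet[OF K(1) F]])
         (auto simp: surface_integral_cmult intro!: continuous_intros gc)
  qed
  finally show ?thesis .
qed

section \<open>Traces from inside a convex cell\<close>

lemma at_within_interior_nontrivial:
  fixes K :: "'a::euclidean_space set"
  assumes K: "convex K" "interior K \<noteq> {}" and x: "x \<in> K"
  shows "at x within interior K \<noteq> bot"
proof -
  have "x \<in> closure (interior K)"
    using convex_closure_interior[OF K] x closure_subset by blast
  then have "x islimpt interior K"
    by (metis closure_def Un_iff interior_limit_point interior_interior islimpt_subset
        interior_subset mem_Collect_eq)
  then show ?thesis by (simp add: trivial_limit_within)
qed

lemma trace_from_isCont:
  fixes K :: "'a::euclidean_space set" and f :: "'a \<Rightarrow> 'b::t2_space"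
  assumes "convex K" "interior K \<noteq> {}" "x \<in> K" "isCont f x"
  shows "trace_from K f x = f x"
  unfolding trace_from_def using assms(4)
  by (intro tendsto_Lim at_within_interior_nontrivial assms(1-3))
     (auto simp: isCont_def intro: tendsto_within_subset)

lemma trace_from_eq:
  fixes K :: "'a::euclidean_space set" and f :: "'a \<Rightarrow> 'b::t2_space"
  assumes K: "convex K" "interior K \<noteq> {}" and f: "\<And>y. y \<in> interior K \<Longrightarrow> f y = p y"
    and p: "isCont p x" and x: "x \<in> K"
  shows "trace_from K f x = p x"
proof -
  have "eventually (\<lambda>y. f y = p y) (at x within interior K)"
    by (simp add: eventually_at_filter f)
  from tendsto_cong[OF this, of "p x"] have "(f \<longlongrightarrow> p x) (at x within interior K)"
    using p by (auto simp: isCont_def intro: tendsto_within_subset)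
  then show ?thesis
    unfolding trace_from_def by (rule tendsto_Lim[OF at_within_interior_nontrivial[OF K x]])
qed

subsection \<open>Fluxes through the faces of a mesh\<close>

definition cell_flux ::
    "('a::euclidean_space \<Rightarrow> real) \<Rightarrow> ('a \<Rightarrow> 'a) \<Rightarrow> 'a set \<Rightarrow> 'a set \<Rightarrow> real" where
  "cell_flux w v K F = surface_integral (outward_normal K F) F
     (\<lambda>x. (trace_from K w x)\<^sup>2 * (trace_from K v x \<bullet> outward_normal K F))"

text \<open>The net flux of w^2 v through a face along its fixed normal. The upwind velocity stands
  for both sides, whose normal components agree in \<open>Hdiv_space\<close>; this matches the face
  term of the discontinuous scheme.\<close>

definition gamma_flux ::
    "'a::euclidean_space fe_mesh \<Rightarrow> ('a \<Rightarrow> real) \<Rightarrow> ('a \<Rightarrow> 'a) \<Rightarrow> 'a set \<times> 'a \<Rightarrow> real" where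
  "gamma_flux M w v e = surface_integral (face_normal M (fst e)) (fst e)
     (\<lambda>x. (upwind_value M e v x \<bullet> face_normal M (fst e)) *
        ((upwind_value M e w x)\<^sup>2 - (downwind_value M e w x)\<^sup>2))"

text \<open>The condition described in \<open>side_value\<close>, made a predicate so that existence
  and uniqueness of a side can be treated separately.\<close>

definition face_side ::
    "'a::euclidean_space fe_mesh \<Rightarrow> 'a set \<times> 'a \<Rightarrow> 'a \<Rightarrow> 'a set \<Rightarrow> 'a \<Rightarrow> bool" where
  "face_side M e n K r \<longleftrightarrow> K \<in> cells M \<and> r \<in> {0, snd e} \<and> (+) r ` fst e facet_of K \<and>
     outward_normal K ((+) r ` fst e) = n"

context
  fixes M :: "'a::euclidean_space fe_mesh"
  assumes mesh: "fe_mesh M"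
begin

section \<open>Geometry of cells and facets in a conforming mesh\<close>

lemma mesh_region: "open (region M)" "interior (closure (region M)) = region M"
    "\<Union> (cells M) = closure (region M)"
  using mesh by (auto simp: fe_mesh_def polytopal_domain_def conforming_mesh_def)

lemma finite_cells: "finite (cells M)"
  using mesh by (auto simp: fe_mesh_def conforming_mesh_def)

lemma cell: "K \<in> cells M \<Longrightarrow> polytope K" "K \<in> cells M \<Longrightarrow> interior K \<noteq> {}"
  using mesh by (auto simp: fe_mesh_def conforming_mesh_def)

lemma cell_Int_face: "K \<in> cells M \<Longrightarrow> K' \<in> cells M \<Longrightarrow> K \<inter> K' face_of K"
  using mesh by (auto simp: fe_mesh_def conforming_mesh_def)

text \<open>A face that meets the interior of its polytope is the whole polytope. Applied to
  \<open>K'\<close> this gives \<open>K' \<subseteq> K\<close>; then the common face also meets the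
  interior of K, so it is K.\<close>

lemma cells_disjoint:
  assumes "K \<in> cells M" "K' \<in> cells M" "K \<inter> interior K' \<noteq> {}"
  shows "K = K'"
proof -
  have "K' \<inter> K = K'"
    using face_of_disjoint_interior[OF cell_Int_face[OF assms(2,1)]] assms(3) interior_subset[of K'] by blast
  then have sub: "K' \<subseteq> K" by blast
  then have "interior K' \<subseteq> interior K" by (rule interior_mono)
  then have "(K \<inter> K') \<inter> interior K \<noteq> {}"
    using cell(2)[OF assms(2)] sub interior_subset[of K'] by blast
  then have "K \<inter> K' = K"
    using face_of_disjoint_interior[OF cell_Int_face[OF assms(1,2)]] by blast
  then show ?thesis using sub by blast
qed

lemma facet_rel_interior_nonempty:
  assumes "K \<in> cells M" "F facet_of K" obtains x where "x \<in> rel_interior F"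
proof -
  have "convex F" using assms(2) by (meson face_of_imp_convex facet_of_imp_face_of polytope_imp_convex cell(1)[OF assms(1)])
  moreover have "F \<noteq> {}" using assms(2) by (auto simp: facet_of_def)
  ultimately show thesis using that rel_interior_eq_empty by blast
qed

lemma facet_closure_rel_interior:
  assumes "K \<in> cells M" "F facet_of K" shows "closure (rel_interior F) = F"
proof -
  have "convex F" using assms(2) by (meson face_of_imp_convex facet_of_imp_face_of polytope_imp_convex cell(1)[OF assms(1)])
  moreover have "closed F" using compact_facet[OF cell(1)[OF assms(1)] assms(2)] by (rule compact_imp_closed)
  ultimately show ?thesis by (simp add: convex_closure_rel_interior)
qed

text \<open>Near a relative interior point of F, both cells contain the same half ball, so their
  interiors overlap.\<close>

lemma same_normal_same_cell:
  assumes K: "K \<in> cells M" "F facet_of K" and K': "K' \<in> cells M" "F facet_of K'"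
    and eq: "outward_normal K F = outward_normal K' F"
  shows "K = K'"
proof -
  obtain x where x: "x \<in> rel_interior F" using facet_rel_interior_nonempty[OF K] by blast
  let ?n = "outward_normal K F"
  have n: "norm ?n = 1" by (rule norm_outward_normal[OF cell[OF K(1)] K(2)])
  have xF: "x \<in> F" using x rel_interior_subset by blast
  have lev: "?n \<bullet> x = facet_level K F" "?n \<bullet> x = facet_level K' F"
    using facet_subset_hyperplane[OF cell[OF K(1)] K(2)] facet_subset_hyperplane[OF cell[OF K'(1)] K'(2)] xF eq
    by auto
  obtain \<epsilon> where \<epsilon>: "0 < \<epsilon>" "\<And>y. dist x y < \<epsilon> \<Longrightarrow> ?n \<bullet> y \<le> facet_level K F \<Longrightarrow> y \<in> K"
    using facet_local_halfspace[OF cell[OF K(1)] K(2) x] by blast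
  obtain \<delta> where \<delta>: "0 < \<delta>" "\<And>y. dist x y < \<delta> \<Longrightarrow> outward_normal K' F \<bullet> y \<le> facet_level K' F \<Longrightarrow> y \<in> K'"
    using facet_local_halfspace[OF cell[OF K'(1)] K'(2) x] by blast
  define U where "U = ball x (min \<epsilon> \<delta>) \<inter> {y. ?n \<bullet> y < facet_level K F}"
  have "open U" unfolding U_def by (intro open_Int open_ball open_halfspace_lt)
  moreover have "U \<subseteq> K'" using \<delta>(2) lev eq by (auto simp: U_def)
  ultimately have "U \<subseteq> interior K'" by (rule interior_maximal[rotated])
  define y where "y = x - (min \<epsilon> \<delta> / 2) *\<^sub>R ?n"
  have "y \<in> U"
    using \<epsilon>(1) \<delta>(1) n lev(1) norm_eq_1[of ?n] by (auto simp: U_def y_def dist_norm inner_diff_right)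
  moreover have "U \<subseteq> K" using \<epsilon>(2) by (auto simp: U_def)
  ultimately have "K \<inter> interior K' \<noteq> {}" using \<open>U \<subseteq> interior K'\<close> by blast
  then show ?thesis using cells_disjoint K(1) K'(1) by blast
qed

lemma opposite_normals:
  assumes K: "K \<in> cells M" "F facet_of K" and K': "K' \<in> cells M" "F facet_of K'" and ne: "K \<noteq> K'"
  shows "outward_normal K' F = - outward_normal K F"
  using facet_unit_normals[OF cell(2)[OF K(1)] K(2) norm_outward_normal[OF cell[OF K(1)] K(2)]
      norm_outward_normal[OF cell[OF K'(1)] K'(2)] facet_subset_hyperplane[OF cell[OF K(1)] K(2)]
      facet_subset_hyperplane[OF cell[OF K'(1)] K'(2)]]
    same_normal_same_cell[OF K K'] ne by auto

text \<open>The two cells fill complementary half balls, so the point is interior to the closure of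
  the domain, which by regularity is interior to the domain itself. This is where slits are
  excluded.\<close>

lemma interior_facet_region:
  assumes K: "K \<in> cells M" "F facet_of K" and K': "K' \<in> cells M" "F facet_of K'" and ne: "K \<noteq> K'"
  shows "rel_interior F \<subseteq> region M"
proof
  fix x assume x: "x \<in> rel_interior F"
  then have xF: "x \<in> F" using rel_interior_subset by blast
  note opp = opposite_normals[OF K K' ne]
  have lev: "facet_level K' F = - facet_level K F"
    using facet_subset_hyperplane[OF cell[OF K(1)] K(2)] facet_subset_hyperplane[OF cell[OF K'(1)] K'(2)] xF
    unfolding opp by fastforce
  obtain \<epsilon> where \<epsilon>: "0 < \<epsilon>"
    "\<And>y. dist x y < \<epsilon> \<Longrightarrow> outward_normal K F \<bullet> y \<le> facet_level K F \<Longrightarrow> y \<in> K"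
    using facet_local_halfspace[OF cell[OF K(1)] K(2) x] by blast
  obtain \<delta> where \<delta>: "0 < \<delta>"
    "\<And>y. dist x y < \<delta> \<Longrightarrow> outward_normal K' F \<bullet> y \<le> facet_level K' F \<Longrightarrow> y \<in> K'"
    using facet_local_halfspace[OF cell[OF K'(1)] K'(2) x] by blast
  have "ball x (min \<epsilon> \<delta>) \<subseteq> K \<union> K'"
  proof
    fix y assume "y \<in> ball x (min \<epsilon> \<delta>)"
    then show "y \<in> K \<union> K'"
      using \<epsilon>(2)[of y] \<delta>(2)[of y] opp lev by (cases "outward_normal K F \<bullet> y \<le> facet_level K F") auto
  qed
  also have "\<dots> \<subseteq> closure (region M)" using K(1) K'(1) mesh_region(3) by blast
  finally have "x \<in> interior (closure (region M))"
    using \<epsilon>(1) \<delta>(1) by (auto simp: mem_interior intro!: exI[of _ "min \<epsilon> \<delta>"])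
  then show "x \<in> region M" using mesh_region(2) by simp
qed

lemma interior_not_boundary:
  assumes "F \<in> interior_facets M" shows "F \<notin> boundary_facets M"
proof
  assume b: "F \<in> boundary_facets M"
  obtain K K' where K: "K \<in> cells M" "F facet_of K" and K': "K' \<in> cells M" "F facet_of K'" "K \<noteq> K'"
    using assms by (auto simp: interior_facets_def)
  obtain x where "x \<in> rel_interior F" using facet_rel_interior_nonempty[OF K] by blast
  then have "x \<in> region M" "x \<in> frontier (region M)"
    using interior_facet_region[OF K K'] b rel_interior_subset by (auto simp: boundary_facets_def)
  then show False using mesh_region(1) by (simp add: frontier_def interior_open)
qed

text \<open>
  Just outside \<open>K\<close>, next to a relative interior point of \<open>F\<close> lying in \<open>\<Omega>\<close>, there is a further
  cell \<open>K'\<close> through that point, and \<open>K \<inter> K'\<close> is a proper face of \<open>K\<close> containing \<open>F\<close>.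
\<close>
lemma facet_interior_or_boundary:
  assumes K: "K \<in> cells M" "F facet_of K"
  shows "F \<in> interior_facets M \<or> F \<in> boundary_facets M"
proof (rule disjCI)
  assume nb: "F \<notin> boundary_facets M"
  let ?n = "outward_normal K F"
  have "\<not> rel_interior F \<subseteq> frontier (region M)"
  proof
    assume "rel_interior F \<subseteq> frontier (region M)"
    then have "closure (rel_interior F) \<subseteq> frontier (region M)" by (intro closure_minimal frontier_closed)
    then show False using nb K facet_closure_rel_interior[OF K] by (auto simp: boundary_facets_def)
  qed
  then obtain x where x: "x \<in> rel_interior F" "x \<notin> frontier (region M)" by blast
  have xF: "x \<in> F" using x(1) rel_interior_subset by blast
  then have "x \<in> K" using facet_of_imp_subset[OF K(2)] by blast
  then have "x \<in> closure (region M)" using K(1) mesh_region(3) by blast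
  then have xR: "x \<in> region M" using x(2) mesh_region(1) by (simp add: frontier_def interior_open)
  \<comment> \<open>Only finitely many closed cells are removed, so this is an open neighbourhood of
    x in which every cell that is met passes through x.\<close>
  define U where "U = region M - \<Union> {K' \<in> cells M. x \<notin> K'}"
  have "closed (\<Union> {K' \<in> cells M. x \<notin> K'})"
    using finite_cells cell(1) by (intro closed_Union) (auto intro: polytope_imp_closed)
  then have "open U" unfolding U_def using mesh_region(1) by (intro open_Diff)
  moreover have "x \<in> U" using xR by (auto simp: U_def)
  ultimately obtain \<eta> where \<eta>: "\<eta> > 0" "ball x \<eta> \<subseteq> U" by (meson open_contains_ball)
  define y where "y = x + (\<eta> / 2) *\<^sub>R ?n"
  have n: "norm ?n = 1" by (rule norm_outward_normal[OF cell[OF K(1)] K(2)])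
  have "y \<in> ball x \<eta>" using \<eta>(1) n by (simp add: y_def dist_norm)
  then have yU: "y \<in> U" using \<eta> by blast
  then have "y \<in> \<Union> (cells M)" using mesh_region(3) closure_subset by (auto simp: U_def)
  then obtain K' where K': "K' \<in> cells M" "y \<in> K'" by blast
  then have "x \<in> K'" using yU by (auto simp: U_def)
  have "?n \<bullet> x = facet_level K F" using facet_subset_hyperplane[OF cell[OF K(1)] K(2)] xF by blast
  then have "?n \<bullet> y > facet_level K F" using \<eta>(1) n by (simp add: y_def inner_add_right norm_eq_1)
  then have "y \<notin> K" using outward_normal_le[OF cell[OF K(1)] K(2)] by force
  then have ne: "K \<noteq> K'" using K' by blast
  have face: "K \<inter> K' face_of K" "K \<inter> K' face_of K'"
    using cell_Int_face[OF K(1) K'(1)] cell_Int_face[OF K'(1) K(1)] by (auto simp: Int_commute)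
  have sub: "F \<subseteq> K \<inter> K'"
    using x(1) \<open>x \<in> K\<close> \<open>x \<in> K'\<close> facet_of_imp_subset[OF K(2)]
    by (intro subset_of_face_of[OF face(1)]) auto
  have "K \<inter> K' \<noteq> K"
  proof
    assume "K \<inter> K' = K"
    then have "K' \<inter> interior K \<noteq> {}" using cell(2)[OF K(1)] interior_subset[of K] by blast
    then show False using cells_disjoint[OF K'(1) K(1)] ne by blast
  qed
  then have lt: "aff_dim (K \<inter> K') < aff_dim K"
    using face_of_aff_dim_lt[OF polytope_imp_convex[OF cell(1)[OF K(1)]] face(1)] by blast
  \<comment> \<open>No dimension lies strictly between those of F and K, so F cannot be a proper
    face of the proper face \<open>K \<inter> K'\<close>.\<close>
  have "F = K \<inter> K'"
  proof (rule ccontr)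
    assume "F \<noteq> K \<inter> K'"
    moreover have "F face_of (K \<inter> K')"
      using K(2) sub by (meson face_of_subset facet_of_imp_face_of inf_le1)
    moreover have "convex (K \<inter> K')" using face(1) by (rule face_of_imp_convex)
    ultimately have "aff_dim F < aff_dim (K \<inter> K')" using face_of_aff_dim_lt by blast
    then show False using lt K(2) by (simp add: facet_of_def)
  qed
  then have "F facet_of K'"
    using face(2) K(2) aff_dim_nonempty_interior[OF cell(2)[OF K(1)]] aff_dim_nonempty_interior[OF cell(2)[OF K'(1)]]
    by (simp add: facet_of_def)
  then show "F \<in> interior_facets M" using K K' ne by (auto simp: interior_facets_def)
qed

lemma boundary_cell_unique:
  assumes "F \<in> boundary_facets M" "K \<in> cells M" "F facet_of K" "K' \<in> cells M" "F facet_of K'"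
  shows "K = K'"
  using interior_not_boundary[of F] assms by (auto simp: interior_facets_def)

lemma boundary_cell_eq:
  assumes "F \<in> boundary_facets M" "K \<in> cells M" "F facet_of K"
  shows "boundary_cell M F = K"
  unfolding boundary_cell_def
proof (rule the_equality)
  fix L assume "L \<in> cells M \<and> F facet_of L"
  then show "L = K" using boundary_cell_unique[OF assms(1) _ _ assms(2,3)] by blast
qed (use assms in blast)

lemma boundary_cell:
  assumes "F \<in> boundary_facets M"
  shows "boundary_cell M F \<in> cells M" "F facet_of boundary_cell M F"
proof -
  obtain K where "K \<in> cells M" "F facet_of K" using assms by (auto simp: boundary_facets_def)
  then show "boundary_cell M F \<in> cells M" "F facet_of boundary_cell M F"
    using boundary_cell_eq[OF assms] by auto
qed

lemma periodicD:
  assumes "(F, s) \<in> periodic M"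
  shows "F \<in> boundary_facets M" "(+) s ` F \<in> boundary_facets M"
    "\<And>K K'. K \<in> cells M \<Longrightarrow> K' \<in> cells M \<Longrightarrow> F facet_of K \<Longrightarrow> (+) s ` F facet_of K' \<Longrightarrow>
       outward_normal K' ((+) s ` F) = - outward_normal K F"
  using mesh assms by (auto simp: fe_mesh_def periodic_identification_def)

lemma periodic_disjoint:
  assumes "(F, s) \<in> periodic M" "(G, r) \<in> periodic M" "(F, s) \<noteq> (G, r)"
  shows "{F, (+) s ` F} \<inter> {G, (+) r ` G} = {}"
proof -
  have *: "\<forall>(F, s)\<in>periodic M. \<forall>(G, r)\<in>periodic M. (F, s) \<noteq> (G, r) \<longrightarrow>
      {F, (+) s ` F} \<inter> {G, (+) r ` G} = {}"
    using mesh unfolding fe_mesh_def periodic_identification_def by (elim conjE)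
  show ?thesis
    using bspec[OF bspec[OF * assms(1), unfolded split_conv] assms(2), unfolded split_conv] assms(3)
    by (rule mp)
qed

lemma unit_neq_uminus: "norm (n::'a) = 1 \<Longrightarrow> n \<noteq> - n"
proof
  assume "norm n = 1" "n = - n"
  then have "2 *\<^sub>R n = 0" by (simp add: eq_neg_iff_add_eq_0 scaleR_2)
  then show False using \<open>norm n = 1\<close> by auto
qed

text \<open>A facet identified with itself would have a normal equal to its own opposite. This
  guarantees that each identified pair contributes two separate boundary fluxes.\<close>

lemma periodic_facets_distinct:
  assumes "(F, s) \<in> periodic M" shows "F \<noteq> (+) s ` F"
proof
  assume eq: "F = (+) s ` F"
  let ?K = "boundary_cell M F"
  note b = boundary_cell[OF periodicD(1)[OF assms]]
  have "outward_normal ?K F = - outward_normal ?K F"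
    using periodicD(3)[OF assms b(1) b(1) b(2)] b(2) eq by metis
  then show False using unit_neq_uminus norm_outward_normal[OF cell[OF b(1)] b(2)] by blast
qed

lemma face_normal:
  assumes "(F, s) \<in> gamma_faces M"
  shows "norm (face_normal M F) = 1" "\<exists>c. F \<subseteq> {x. face_normal M F \<bullet> x = c}"
proof -
  have *: "norm (face_normal M F) = 1 \<and> (\<forall>x\<in>F. \<forall>y\<in>F. face_normal M F \<bullet> (x - y) = 0)"
    using mesh assms by (auto simp: fe_mesh_def)
  then show "norm (face_normal M F) = 1" by blast
  show "\<exists>c. F \<subseteq> {x. face_normal M F \<bullet> x = c}"
  proof (cases "F = {}")
    case False
    then obtain y where "y \<in> F" by blast
    have "F \<subseteq> {x. face_normal M F \<bullet> x = face_normal M F \<bullet> y}"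
    proof
      fix x assume "x \<in> F"
      then have "face_normal M F \<bullet> (x - y) = 0" using * \<open>y \<in> F\<close> by blast
      then show "x \<in> {x. face_normal M F \<bullet> x = face_normal M F \<bullet> y}" by (simp add: inner_diff_right)
    qed
    then show ?thesis by blast
  qed auto
qed

lemma gamma_face_normal_cases:
  assumes "(F, s) \<in> gamma_faces M" "K \<in> cells M" "F facet_of K"
  shows "face_normal M F = outward_normal K F \<or> face_normal M F = - outward_normal K F"
proof -
  obtain c where "F \<subseteq> {x. face_normal M F \<bullet> x = c}" using face_normal(2)[OF assms(1)] by blast
  then show ?thesis
    by (rule facet_unit_normals[OF cell(2)[OF assms(2)] assms(3)
          norm_outward_normal[OF cell[OF assms(2)] assms(3)] face_normal(1)[OF assms(1)]
          facet_subset_hyperplane[OF cell[OF assms(2)] assms(3)]])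
qed

text \<open>Different shifts are possible only on a periodic pair, whose outward normals are
  opposite and cannot both be n. With equal shifts, facet and normal determine the cell.\<close>

lemma face_side_unique:
  assumes e: "e \<in> gamma_faces M" and s: "face_side M e n K r" and s': "face_side M e n K' r'"
  shows "K = K' \<and> r = r'"
proof -
  have K: "K \<in> cells M" "(+) r ` fst e facet_of K" "outward_normal K ((+) r ` fst e) = n"
    and K': "K' \<in> cells M" "(+) r' ` fst e facet_of K'" "outward_normal K' ((+) r' ` fst e) = n"
    using s s' by (simp_all only: face_side_def)
  have r: "r = 0 \<or> r = snd e" "r' = 0 \<or> r' = snd e" using s s' by (simp_all add: face_side_def)
  have "r = r'"
  proof (rule ccontr)
    assume "r \<noteq> r'"
    then have "snd e \<noteq> 0" using r by auto
    then have per: "(fst e, snd e) \<in> periodic M" using e by (auto simp: gamma_faces_def)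
    have n: "norm n = 1" using norm_outward_normal[OF cell[OF K(1)] K(2)] K(3) by simp
    from \<open>r \<noteq> r'\<close> r consider "r = 0" "r' = snd e" | "r = snd e" "r' = 0" by auto
    then have "n = - n"
    proof cases
      case 1
      then show ?thesis using periodicD(3)[OF per K(1) K'(1)] K K' by simp
    next
      case 2
      then show ?thesis using periodicD(3)[OF per K'(1) K(1)] K K' by simp
    qed
    then show False using unit_neq_uminus[OF n] by blast
  qed
  moreover from this have "K = K'"
    using same_normal_same_cell[OF K(1,2) K'(1)] K K' by simp
  ultimately show ?thesis by blast
qed

lemma side_value_eq:
  assumes "e \<in> gamma_faces M" "face_side M e n K r"
  shows "side_value M e n f x = trace_from K f (x + r)"
proof -
  have "(THE (K, r). face_side M e n K r) = (K, r)"
    by (rule the_equality) (auto simp: assms dest: face_side_unique[OF assms(1) _ assms(2)])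
  then show ?thesis by (simp add: side_value_def face_side_def)
qed

text \<open>A third cell at F would have to be opposite to the first, hence share the normal of the
  second and coincide with it.\<close>

lemma interior_face_sides:
  assumes F: "F \<in> interior_facets M"
  obtains K1 K2 where "face_side M (F, 0) (face_normal M F) K1 0"
    "face_side M (F, 0) (- face_normal M F) K2 0"
    "{K \<in> cells M. F facet_of K} = {K1, K2}" "K1 \<noteq> K2"
proof -
  have e: "(F, 0) \<in> gamma_faces M" using F by (auto simp: gamma_faces_def)
  obtain K K' where K: "K \<in> cells M" "F facet_of K" and K': "K' \<in> cells M" "F facet_of K'" "K \<noteq> K'"
    using F by (auto simp: interior_facets_def)
  note opp = opposite_normals[OF K K']
  have two: "{K \<in> cells M. F facet_of K} = {K, K'}"
  proof (intro subset_antisym subsetI)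
    fix L assume "L \<in> {K \<in> cells M. F facet_of K}"
    then have L: "L \<in> cells M" "F facet_of L" by auto
    show "L \<in> {K, K'}"
    proof (rule ccontr)
      assume "L \<notin> {K, K'}"
      then have "K \<noteq> L" by auto
      then have "outward_normal L F = outward_normal K' F"
        using opposite_normals[OF K L] opp by simp
      then show False using same_normal_same_cell[OF L K'(1,2)] \<open>L \<notin> {K, K'}\<close> by simp
    qed
  qed (use K K' in auto)
  from gamma_face_normal_cases[OF e K] show thesis
  proof
    assume "face_normal M F = outward_normal K F"
    then show thesis using K K' opp two by (intro that[of K K']) (auto simp: face_side_def)
  next
    assume "face_normal M F = - outward_normal K F"
    then show thesis using K K' opp two by (intro that[of K' K]) (auto simp: face_side_def)
  qed
qed

text \<open>The fixed normal may point out of the cell at F or out of the cell at its translate, so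
  either copy can be the upwind one.\<close>

lemma periodic_face_sides:
  assumes P: "(F, s) \<in> periodic M"
  obtains K1 r1 K2 r2 where "face_side M (F, s) (face_normal M F) K1 r1"
    "face_side M (F, s) (- face_normal M F) K2 r2" "r1 = 0 \<and> r2 = s \<or> r1 = s \<and> r2 = 0"
proof -
  have e: "(F, s) \<in> gamma_faces M" using P by (auto simp: gamma_faces_def)
  note K = boundary_cell[OF periodicD(1)[OF P]] and K' = boundary_cell[OF periodicD(2)[OF P]]
  note opp = periodicD(3)[OF P K(1) K'(1) K(2) K'(2)]
  from gamma_face_normal_cases[OF e K] show thesis
  proof
    assume "face_normal M F = outward_normal (boundary_cell M F) F"
    then show thesis using K K' opp
      by (intro that[of "boundary_cell M F" 0 "boundary_cell M ((+) s ` F)" s]) (auto simp: face_side_def)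
  next
    assume "face_normal M F = - outward_normal (boundary_cell M F) F"
    then show thesis using K K' opp
      by (intro that[of "boundary_cell M ((+) s ` F)" s "boundary_cell M F" 0]) (auto simp: face_side_def)
  qed
qed

lemma finite_facets: "finite {F. \<exists>K\<in>cells M. F facet_of K}"
proof -
  have "finite (\<Union>K\<in>cells M. {F. F facet_of K})"
    using cell(1) by (intro finite_UN_I finite_cells finite_polytope_facets)
  moreover have "{F. \<exists>K\<in>cells M. F facet_of K} = (\<Union>K\<in>cells M. {F. F facet_of K})" by blast
  ultimately show ?thesis by simp
qed

lemma facets_eq: "{F. \<exists>K\<in>cells M. F facet_of K} = interior_facets M \<union> boundary_facets M"
  using facet_interior_or_boundary by (auto simp: interior_facets_def boundary_facets_def)

lemma finite_interior_facets: "finite (interior_facets M)"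
  and finite_boundary_facets: "finite (boundary_facets M)"
  using finite_facets unfolding facets_eq by simp_all

text \<open>Distinct identified pairs share no facet, so a pair is determined by its first one.
  Without finiteness the sums over faces would be 0 by convention.\<close>

lemma finite_periodic: "finite (periodic M)"
proof (rule inj_on_finite)
  show "inj_on fst (periodic M)"
  proof (rule inj_onI)
    fix x y assume "x \<in> periodic M" "y \<in> periodic M" "fst x = fst y"
    then show "x = y"
      using periodic_disjoint[of "fst x" "snd x" "fst y" "snd y"] by (cases x; cases y) auto
  qed
  show "fst ` periodic M \<subseteq> boundary_facets M" using periodicD(1) by force
qed (rule finite_boundary_facets)

text \<open>The polynomial of each cell extends the function continuously across the cell's
  boundary, so traces, defined as limits, become plain values of a smooth function.\<close>

lemma L2_space_trace:
  assumes "w \<in> L2_space M q"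
  obtains p where "\<And>K. K \<in> cells M \<Longrightarrow> real_polynomial_function (p K)"
    "\<And>K x. K \<in> cells M \<Longrightarrow> x \<in> interior K \<Longrightarrow> w x = p K x"
    "\<And>K x. K \<in> cells M \<Longrightarrow> x \<in> K \<Longrightarrow> trace_from K w x = p K x"
proof -
  have poly: "real_polynomial_function f" if "f \<in> poly_upto q" for f :: "'a \<Rightarrow> real"
  proof -
    define A where "A = {\<alpha>. (\<forall>b. b \<notin> (Basis :: 'a set) \<longrightarrow> \<alpha> b = (0::nat)) \<and> (\<Sum>b\<in>Basis. \<alpha> b) \<le> q}"
    obtain c where f: "f = (\<lambda>x. \<Sum>\<alpha>\<in>A. c \<alpha> * (\<Prod>b\<in>Basis. (x \<bullet> b) ^ \<alpha> b))"
      using \<open>f \<in> poly_upto q\<close> by (auto simp: poly_upto_def A_def)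
    have "real_polynomial_function (\<lambda>x. c \<alpha> * (\<Prod>b\<in>Basis. (x \<bullet> b) ^ \<alpha> b))" for \<alpha>
      by (intro real_polynomial_function.intros(2,4) real_polynomial_function_prod
          real_polynomial_function_power real_polynomial_function.intros(1) bounded_linear_inner_left) auto
    \<comment> \<open>A sum over an infinite index set is 0 by convention, again a polynomial, so
      both cases close.\<close>
    then show ?thesis
      unfolding f by (cases "finite A") (auto intro!: real_polynomial_function_sum real_polynomial_function.intros(2))
  qed
  have "\<forall>K\<in>cells M. \<exists>p. real_polynomial_function p \<and> (\<forall>x\<in>interior K. w x = p x)"
    using assms poly by (fastforce simp: L2_space_def)
  then obtain p where p: "\<And>K. K \<in> cells M \<Longrightarrow> real_polynomial_function (p K)"
    "\<And>K x. K \<in> cells M \<Longrightarrow> x \<in> interior K \<Longrightarrow> w x = p K x" by metis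
  have "trace_from K w x = p K x" if "K \<in> cells M" "x \<in> K" for K x
    using that p(1)[OF that(1)] p(2)[OF that(1)] cell[OF that(1)]
    by (intro trace_from_eq polytope_imp_convex)
       (auto simp: real_polynomial_function_eq intro: continuous_polymonial_function)
  then show thesis using that p by blast
qed

lemma Hdiv_space_trace:
  assumes "v \<in> Hdiv_space M"
  obtains u where "\<And>K. K \<in> cells M \<Longrightarrow> polynomial_function (u K)"
    "\<And>K x. K \<in> cells M \<Longrightarrow> x \<in> interior K \<Longrightarrow> v x = u K x"
    "\<And>K x. K \<in> cells M \<Longrightarrow> x \<in> K \<Longrightarrow> trace_from K v x = u K x"
proof -
  have "\<forall>K\<in>cells M. \<exists>p. polynomial_function p \<and> (\<forall>x\<in>interior K. v x = p x)"
    using assms by (auto simp: Hdiv_space_def)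
  then obtain u where u: "\<And>K. K \<in> cells M \<Longrightarrow> polynomial_function (u K)"
    "\<And>K x. K \<in> cells M \<Longrightarrow> x \<in> interior K \<Longrightarrow> v x = u K x" by metis
  have "trace_from K v x = u K x" if "K \<in> cells M" "x \<in> K" for K x
    using that u(1)[OF that(1)] u(2)[OF that(1)] cell[OF that(1)]
    by (intro trace_from_eq polytope_imp_convex) (auto intro: continuous_polymonial_function)
  then show thesis using that u by blast
qed

text \<open>Interior and identified faces are treated alike: both facets are translated back to F,
  and the downwind flux, taken with outward normal \<open>- n\<close>, is turned around at the price
  of a sign. Normal continuity of v then lets the two integrands share one velocity factor.\<close>

lemma gamma_flux_eq:
  assumes e: "e \<in> gamma_faces M" and w: "w \<in> L2_space M q" and v: "v \<in> Hdiv_space M"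
    and s1: "face_side M e (face_normal M (fst e)) K1 r1"
    and s2: "face_side M e (- face_normal M (fst e)) K2 r2"
  shows "gamma_flux M w v e = cell_flux w v K1 ((+) r1 ` fst e) + cell_flux w v K2 ((+) r2 ` fst e)"
proof -
  obtain F s where Fs: "e = (F, s)" by force
  let ?n = "face_normal M F"
  obtain c where n: "norm ?n = 1" and Fc: "F \<subseteq> {x. ?n \<bullet> x = c}" using face_normal e Fs by blast
  obtain p where p: "\<And>K. K \<in> cells M \<Longrightarrow> real_polynomial_function (p K)"
    "\<And>K x. K \<in> cells M \<Longrightarrow> x \<in> K \<Longrightarrow> trace_from K w x = p K x"
    using L2_space_trace[OF w] by metis
  obtain u where u: "\<And>K. K \<in> cells M \<Longrightarrow> polynomial_function (u K)"
    "\<And>K x. K \<in> cells M \<Longrightarrow> x \<in> K \<Longrightarrow> trace_from K v x = u K x"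
    using Hdiv_space_trace[OF v] by metis
  have K1: "K1 \<in> cells M" "(+) r1 ` F facet_of K1" "outward_normal K1 ((+) r1 ` F) = ?n"
    and K2: "K2 \<in> cells M" "(+) r2 ` F facet_of K2" "outward_normal K2 ((+) r2 ` F) = - ?n"
    using s1 s2 by (auto simp: face_side_def Fs)
  have mem1: "x + r1 \<in> K1" and mem2: "x + r2 \<in> K2" if "x \<in> F" for x
    using that facet_of_imp_subset[OF K1(2)] facet_of_imp_subset[OF K2(2)] by (auto simp: add.commute)
  have pc: "continuous_on UNIV (p K)" if "K \<in> cells M" for K
    using p(1)[OF that] by (auto simp: real_polynomial_function_eq intro: continuous_on_polymonial_function)
  have uc: "continuous_on UNIV (u K)" if "K \<in> cells M" for K
    using u(1)[OF that] by (rule continuous_on_polymonial_function)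
  define h where "h = (\<lambda>K x. (p K x)\<^sup>2 * (u K x \<bullet> ?n))"
  have hc: "continuous_on UNIV (h K)" if "K \<in> cells M" for K
    unfolding h_def using pc[OF that] uc[OF that] by (intro continuous_intros)
  have hrc: "continuous_on UNIV (\<lambda>x. h K (x + r))" if "K \<in> cells M" for K r
    by (intro continuous_on_compose2[OF hc[OF that]] continuous_intros) auto
  have cF: "compact F"
  proof -
    have "compact ((+) (- r1) ` ((+) r1 ` F))"
      by (rule compact_translation[OF compact_facet[OF cell(1)[OF K1(1)] K1(2)]])
    moreover have "(+) (- r1) ` ((+) r1 ` F) = F" unfolding image_image by simp
    ultimately show ?thesis by simp
  qed
  have Fr: "(+) r ` F \<subseteq> {x. ?n \<bullet> x = c + ?n \<bullet> r}" for r using Fc by (auto simp: inner_add_right)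
  have cFr: "compact ((+) r ` F)" for r using cF by (simp add: compact_translation)
  have "cell_flux w v K1 ((+) r1 ` F) = surface_integral ?n ((+) r1 ` F) (h K1)"
    unfolding cell_flux_def K1(3)
    using facet_of_imp_subset[OF K1(2)]
    by (intro surface_integral_cong[OF n Fr]) (auto simp: p(2)[OF K1(1)] u(2)[OF K1(1)] h_def)
  also have "\<dots> = surface_integral ?n F (\<lambda>x. h K1 (x + r1))"
    by (rule surface_integral_translate[OF n Fc cF hc[OF K1(1)]])
  finally have 1: "cell_flux w v K1 ((+) r1 ` F) = \<dots>" .
  have "cell_flux w v K2 ((+) r2 ` F) = surface_integral (- ?n) ((+) r2 ` F) (\<lambda>x. - h K2 x)"
    unfolding cell_flux_def K2(3)
  proof (rule surface_integral_cong)
    show "(+) r2 ` F \<subseteq> {x. - ?n \<bullet> x = - (c + ?n \<bullet> r2)}"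
      using Fc by (auto simp: inner_add_right)
  qed (use n facet_of_imp_subset[OF K2(2)] in \<open>auto simp: p(2)[OF K2(1)] u(2)[OF K2(1)] h_def\<close>)
  also have "\<dots> = - surface_integral ?n ((+) r2 ` F) (h K2)"
    using surface_integral_flip[OF n Fr cFr hc[OF K2(1)]] by (simp add: surface_integral_uminus_fun)
  also have "\<dots> = - surface_integral ?n F (\<lambda>x. h K2 (x + r2))"
    by (simp add: surface_integral_translate[OF n Fc cF hc[OF K2(1)]])
  finally have 2: "cell_flux w v K2 ((+) r2 ` F) = \<dots>" .
  have "gamma_flux M w v e = surface_integral ?n F (\<lambda>x. h K1 (x + r1) + - h K2 (x + r2))"
    unfolding gamma_flux_def Fs fst_conv
  proof (rule surface_integral_cong[OF n Fc])
    fix x assume x: "x \<in> F"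
    have up: "upwind_value M (F, s) w x = p K1 (x + r1)"
      using side_value_eq[OF e s1, of w x] p(2)[OF K1(1) mem1[OF x]] by (simp add: upwind_value_def Fs)
    have down: "downwind_value M (F, s) w x = p K2 (x + r2)"
      using side_value_eq[OF e s2, of w x] p(2)[OF K2(1) mem2[OF x]] by (simp add: downwind_value_def Fs)
    have up': "upwind_value M (F, s) v x = u K1 (x + r1)"
      using side_value_eq[OF e s1, of v x] u(2)[OF K1(1) mem1[OF x]] by (simp add: upwind_value_def Fs)
    have down': "downwind_value M (F, s) v x = u K2 (x + r2)"
      using side_value_eq[OF e s2, of v x] u(2)[OF K2(1) mem2[OF x]] by (simp add: downwind_value_def Fs)
    have "u K1 (x + r1) \<bullet> ?n = u K2 (x + r2) \<bullet> ?n"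
      using v e x unfolding Fs Hdiv_space_def up'[symmetric] down'[symmetric] by auto
    then show "(upwind_value M (F, s) v x \<bullet> ?n) *
        ((upwind_value M (F, s) w x)\<^sup>2 - (downwind_value M (F, s) w x)\<^sup>2) = h K1 (x + r1) + - h K2 (x + r2)"
      unfolding up' up down h_def
      by (simp add: algebra_simps)
  qed
  also have "\<dots> = surface_integral ?n F (\<lambda>x. h K1 (x + r1)) + surface_integral ?n F (\<lambda>x. - h K2 (x + r2))"
    by (intro surface_integral_add[OF n Fc cF] continuous_on_minus hrc K1 K2)
  finally show ?thesis unfolding Fs fst_conv 1 2 by (simp add: surface_integral_uminus_fun)
qed

section \<open>Summation of the fluxes over the whole mesh\<close>

lemma boundary_flux_cell: "boundary_flux M B w v = (\<Sum>F\<in>B. cell_flux w v (boundary_cell M F) F)"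
  by (simp add: boundary_flux_def cell_flux_def boundary_value_def boundary_normal_def)

text \<open>The identified facets split into disjoint pairs, and the two outward fluxes of a pair
  add up to the flux through one face of the interface.\<close>

lemma boundary_flux_boundary_facets:
  assumes w: "w \<in> L2_space M q" and v: "v \<in> Hdiv_space M"
  shows "boundary_flux M (boundary_facets M) w v =
    boundary_flux M (free_boundary_facets M) w v + (\<Sum>e\<in>periodic M. gamma_flux M w v e)"
proof -
  let ?\<phi> = "\<lambda>F. cell_flux w v (boundary_cell M F) F"
  have pair: "(\<Sum>F\<in>{fst e, (+) (snd e) ` fst e}. ?\<phi> F) = gamma_flux M w v e" if e: "e \<in> periodic M" for e
  proof -
    obtain F s where Fs: "e = (F, s)" by force
    then have P: "(F, s) \<in> periodic M" using e by simp
    have eG: "(F, s) \<in> gamma_faces M" using P by (auto simp: gamma_faces_def)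
    obtain K1 r1 K2 r2 where s1: "face_side M (F, s) (face_normal M F) K1 r1"
      and s2: "face_side M (F, s) (- face_normal M F) K2 r2" and r: "r1 = 0 \<and> r2 = s \<or> r1 = s \<and> r2 = 0"
      using periodic_face_sides[OF P] by blast
    have b: "(+) r ` F \<in> boundary_facets M" if "r \<in> {0, s}" for r
      using periodicD(1,2)[OF P] that by auto
    have "gamma_flux M w v (F, s) = cell_flux w v K1 ((+) r1 ` F) + cell_flux w v K2 ((+) r2 ` F)"
      using gamma_flux_eq[OF eG w v, of K1 r1 K2 r2] s1 s2 by simp
    also have "K1 = boundary_cell M ((+) r1 ` F)"
      using s1 b by (intro boundary_cell_eq[symmetric]) (auto simp: face_side_def)
    also have "K2 = boundary_cell M ((+) r2 ` F)"
      using s2 b by (intro boundary_cell_eq[symmetric]) (auto simp: face_side_def)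
    finally have "gamma_flux M w v (F, s) = ?\<phi> ((+) r1 ` F) + ?\<phi> ((+) r2 ` F)" .
    then show ?thesis using r periodic_facets_distinct[OF P] by (auto simp: Fs)
  qed
  have ident: "identified_facets M = (\<Union>e\<in>periodic M. {fst e, (+) (snd e) ` fst e})"
    by (auto simp: identified_facets_def case_prod_unfold)
  have sub: "identified_facets M \<subseteq> boundary_facets M"
    using periodicD(1,2) by (auto simp: identified_facets_def)
  have "(\<Sum>F\<in>identified_facets M. ?\<phi> F) = (\<Sum>e\<in>periodic M. \<Sum>F\<in>{fst e, (+) (snd e) ` fst e}. ?\<phi> F)"
    unfolding ident
  proof (rule sum.UNION_disjoint)
    show "\<forall>i\<in>periodic M. \<forall>j\<in>periodic M. i \<noteq> j \<longrightarrow>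
      {fst i, (+) (snd i) ` fst i} \<inter> {fst j, (+) (snd j) ` fst j} = {}"
      using periodic_disjoint by (metis prod.collapse)
  qed (use finite_periodic in auto)
  also have "\<dots> = (\<Sum>e\<in>periodic M. gamma_flux M w v e)" by (intro sum.cong refl pair)
  finally have id: "(\<Sum>F\<in>identified_facets M. ?\<phi> F) = \<dots>" .
  show ?thesis
    unfolding boundary_flux_cell free_boundary_facets_def id[symmetric]
    using sum.subset_diff[OF sub finite_boundary_facets, of ?\<phi>] by simp
qed

text \<open>Double counting: after exchanging the sums over cells and facets, an interior facet
  collects two fluxes and a boundary facet one.\<close>

lemma sum_cell_flux:
  assumes w: "w \<in> L2_space M q" and v: "v \<in> Hdiv_space M"
  shows "(\<Sum>K\<in>cells M. \<Sum>F | F facet_of K. cell_flux w v K F) =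
    (\<Sum>e\<in>gamma_faces M. gamma_flux M w v e) + boundary_flux M (free_boundary_facets M) w v"
proof -
  let ?A = "{F. \<exists>K\<in>cells M. F facet_of K}"
  have disj: "interior_facets M \<inter> boundary_facets M = {}" using interior_not_boundary by blast
  have "(\<Sum>K\<in>cells M. \<Sum>F | F facet_of K. cell_flux w v K F) =
    (\<Sum>K\<in>cells M. \<Sum>F | F \<in> ?A \<and> F facet_of K. cell_flux w v K F)"
    by (intro sum.cong) auto
  also have "\<dots> = (\<Sum>F\<in>?A. \<Sum>K | K \<in> cells M \<and> F facet_of K. cell_flux w v K F)"
    by (rule sum.swap_restrict[OF finite_cells finite_facets])
  also have "\<dots> = (\<Sum>F\<in>interior_facets M. \<Sum>K | K \<in> cells M \<and> F facet_of K. cell_flux w v K F) +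
    (\<Sum>F\<in>boundary_facets M. \<Sum>K | K \<in> cells M \<and> F facet_of K. cell_flux w v K F)"
    unfolding facets_eq by (rule sum.union_disjoint[OF finite_interior_facets finite_boundary_facets disj])
  also have "(\<Sum>F\<in>boundary_facets M. \<Sum>K | K \<in> cells M \<and> F facet_of K. cell_flux w v K F) =
    boundary_flux M (boundary_facets M) w v"
    unfolding boundary_flux_cell
  proof (intro sum.cong refl)
    fix F assume F: "F \<in> boundary_facets M"
    have "{K. K \<in> cells M \<and> F facet_of K} = {boundary_cell M F}"
      using boundary_cell[OF F] boundary_cell_eq[OF F] by blast
    then show "(\<Sum>K | K \<in> cells M \<and> F facet_of K. cell_flux w v K F) = cell_flux w v (boundary_cell M F) F"
      by simp
  qed
  also have "(\<Sum>F\<in>interior_facets M. \<Sum>K | K \<in> cells M \<and> F facet_of K. cell_flux w v K F) =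
    (\<Sum>F\<in>interior_facets M. gamma_flux M w v (F, 0))"
  proof (intro sum.cong refl)
    fix F assume F: "F \<in> interior_facets M"
    then have e: "(F, 0) \<in> gamma_faces M" by (auto simp: gamma_faces_def)
    obtain K1 K2 where s: "face_side M (F, 0) (face_normal M F) K1 0"
      "face_side M (F, 0) (- face_normal M F) K2 0"
      and K: "{K \<in> cells M. F facet_of K} = {K1, K2}" "K1 \<noteq> K2"
      using interior_face_sides[OF F] by blast
    show "(\<Sum>K | K \<in> cells M \<and> F facet_of K. cell_flux w v K F) = gamma_flux M w v (F, 0)"
      using gamma_flux_eq[OF e w v, of K1 0 K2 0] s K by simp
  qed
  also have "\<dots> = (\<Sum>e\<in>(\<lambda>F. (F, 0)) ` interior_facets M. gamma_flux M w v e)"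
    by (subst sum.reindex) (auto simp: inj_on_def)
  finally have "(\<Sum>K\<in>cells M. \<Sum>F | F facet_of K. cell_flux w v K F) =
    (\<Sum>e\<in>(\<lambda>F. (F, 0)) ` interior_facets M. gamma_flux M w v e) +
    (\<Sum>e\<in>periodic M. gamma_flux M w v e) + boundary_flux M (free_boundary_facets M) w v"
    using boundary_flux_boundary_facets[OF w v] by simp
  moreover have "(\<lambda>F. (F, 0)) ` interior_facets M \<inter> periodic M = {}"
    using periodicD(1) disj by auto
  ultimately show ?thesis
    unfolding gamma_faces_def
    by (subst sum.union_disjoint) (auto simp: finite_interior_facets finite_periodic)
qed

end

subsection \<open>Enstrophy\<close>

lemma AE_lebesgue_not_in_negligible:
  "negligible S \<Longrightarrow> AE x in lebesgue. x \<notin> S"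
  by (rule AE_I'[of S]) (auto simp: negligible_iff_null_sets)

text \<open>An algebra of functions that contains the integrands of the volume terms, used for
  integrability. Each continuous piece is defined everywhere, hence bounded on the compact cell,
  while values on the skeleton stay free.\<close>

definition piecewise_cont :: "'a::euclidean_space fe_mesh \<Rightarrow> ('a \<Rightarrow> real) \<Rightarrow> bool" where
  "piecewise_cont M f \<longleftrightarrow>
     (\<forall>K\<in>cells M. \<exists>h. continuous_on UNIV h \<and> (\<forall>x\<in>interior K. f x = h x))"

lemma piecewise_cont_const: "piecewise_cont M (\<lambda>x. c)"
  unfolding piecewise_cont_def by (intro ballI exI[of _ "\<lambda>x. c"]) auto

lemma piecewise_cont_add:
  assumes "piecewise_cont M f" "piecewise_cont M g" shows "piecewise_cont M (\<lambda>x. f x + g x)"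
  unfolding piecewise_cont_def
proof
  fix K assume "K \<in> cells M"
  then obtain a b where "continuous_on UNIV a" "\<forall>x\<in>interior K. f x = a x"
    "continuous_on UNIV b" "\<forall>x\<in>interior K. g x = b x"
    using assms unfolding piecewise_cont_def by meson
  then show "\<exists>h. continuous_on UNIV h \<and> (\<forall>x\<in>interior K. f x + g x = h x)"
    by (intro exI[of _ "\<lambda>x. a x + b x"]) (auto intro: continuous_intros)
qed

lemma piecewise_cont_mult:
  assumes "piecewise_cont M f" "piecewise_cont M g" shows "piecewise_cont M (\<lambda>x. f x * g x)"
  unfolding piecewise_cont_def
proof
  fix K assume "K \<in> cells M"
  then obtain a b where "continuous_on UNIV a" "\<forall>x\<in>interior K. f x = a x"
    "continuous_on UNIV b" "\<forall>x\<in>interior K. g x = b x"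
    using assms unfolding piecewise_cont_def by meson
  then show "\<exists>h. continuous_on UNIV h \<and> (\<forall>x\<in>interior K. f x * g x = h x)"
    by (intro exI[of _ "\<lambda>x. a x * b x"]) (auto intro: continuous_intros)
qed

lemma piecewise_cont_diff:
  assumes "piecewise_cont M f" "piecewise_cont M g" shows "piecewise_cont M (\<lambda>x. f x - g x)"
  using piecewise_cont_add[OF assms(1) piecewise_cont_mult[OF piecewise_cont_const[of M "-1"] assms(2)]]
  by simp

lemma piecewise_cont_divide:
  assumes "piecewise_cont M f" shows "piecewise_cont M (\<lambda>x. f x / c)"
  using piecewise_cont_mult[OF assms piecewise_cont_const[of M "1 / c"]] by simp

lemma piecewise_cont_power2:
  assumes "piecewise_cont M f" shows "piecewise_cont M (\<lambda>x. (f x)\<^sup>2)"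
  using piecewise_cont_mult[OF assms assms] by (simp add: power2_eq_square)

lemmas piecewise_cont_intros =
  piecewise_cont_const piecewise_cont_add piecewise_cont_mult piecewise_cont_diff
  piecewise_cont_divide piecewise_cont_power2

lemma frechet_derivative_cong_open:
  assumes "open U" "x \<in> U" "\<And>y. y \<in> U \<Longrightarrow> f y = p y" "p differentiable (at x)"
  shows "frechet_derivative f (at x) = frechet_derivative p (at x)"
proof -
  have "(p has_derivative frechet_derivative p (at x)) (at x)"
    using assms(4) by (simp add: frechet_derivative_works)
  then have "(f has_derivative frechet_derivative p (at x)) (at x)"
    by (rule has_derivative_transform_within_open[OF _ assms(1,2)]) (simp add: assms(3))
  then show ?thesis by (rule frechet_derivative_at[symmetric])
qed

context
  fixes M :: "'a::euclidean_space fe_mesh"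
  assumes mesh: "fe_mesh M"
begin

text \<open>Frontiers of convex cells are null sets, and off them a point lies in the domain exactly
  when it lies in a cell, which is then unique.\<close>

lemma piecewise_integral:
  fixes h :: "'a \<Rightarrow> real"
  assumes hK: "\<And>K. K \<in> cells M \<Longrightarrow> continuous_on UNIV (hK K)"
    and h: "\<And>K x. K \<in> cells M \<Longrightarrow> x \<in> interior K \<Longrightarrow> h x = hK K x"
  shows "set_integrable lebesgue (region M) h"
    and "(LINT x:region M|lebesgue. h x) = (\<Sum>K\<in>cells M. LINT x:K|lborel. hK K x)"
proof -
  let ?H = "\<lambda>x. \<Sum>K\<in>cells M. indicator K x *\<^sub>R hK K x"
  let ?G = "\<lambda>x. indicator (region M) x *\<^sub>R h x"
  have cont: "compact K" "continuous_on K (hK K)" if "K \<in> cells M" for K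
    using that polytope_imp_compact[OF cell(1)[OF mesh]] continuous_on_subset[OF hK] by auto
  define N where "N = (\<Union>K\<in>cells M. frontier K)"
  have N: "negligible N"
    unfolding N_def using finite_cells[OF mesh] polytope_imp_convex[OF cell(1)[OF mesh]]
    by (intro negligible_Union) (auto intro: negligible_convex_frontier)
  have eq: "?G x = ?H x" if x: "x \<notin> N" for x
  proof -
    have int: "x \<in> interior K" if "K \<in> cells M" "x \<in> K" for K
      using that x closure_subset[of K] by (auto simp: N_def frontier_def)
    show ?thesis
    proof (cases "\<exists>K\<in>cells M. x \<in> K")
      case True
      then obtain K where K: "K \<in> cells M" "x \<in> K" by blast
      have "x \<in> interior (closure (region M))"
        using int[OF K] interior_mono[of K "closure (region M)"] K(1) mesh_region(3)[OF mesh] by blast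
      then have "x \<in> region M" using mesh_region(2)[OF mesh] by simp
      moreover have "indicator L x *\<^sub>R hK L x = (if L = K then hK K x else 0)" if "L \<in> cells M" for L
        using cells_disjoint[OF mesh that K(1)] int[OF K] K(2) by (auto simp: indicator_def)
      ultimately show ?thesis
        using K h[OF K(1) int[OF K]] finite_cells[OF mesh] by simp
    next
      case False
      then have "x \<notin> region M" using mesh_region(3)[OF mesh] closure_subset by blast
      then show ?thesis using False by (simp add: indicator_def sum.neutral)
    qed
  qed
  have iK: "integrable lborel (\<lambda>x. indicator K x *\<^sub>R hK K x)" if "K \<in> cells M" for K
    by (rule borel_integrable_compact[OF cont[OF that]])
  have iH: "integrable lborel ?H" by (intro Bochner_Integration.integrable_sum iK)
  then have iHl: "integrable lebesgue ?H" by (subst integrable_completion) auto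
  \<comment> \<open>\<open>h\<close> is arbitrary on the null set \<open>N\<close>, so measurability
    and integrability are transferred from \<open>?H\<close> by a change on a negligible
    set.\<close>
  have "?H absolutely_integrable_on UNIV" using iHl by (simp add: set_integrable_def)
  then have "?G absolutely_integrable_on UNIV"
    by (rule absolutely_integrable_spike[OF _ N]) (use eq in auto)
  then have iG: "integrable lebesgue ?G" by (simp add: set_integrable_def)
  then show "set_integrable lebesgue (region M) h" by (simp add: set_integrable_def)
  have "(LINT x:region M|lebesgue. h x) = integral\<^sup>L lebesgue ?H"
    unfolding set_lebesgue_integral_def
  proof (rule integral_cong_AE)
    show "AE x in lebesgue. ?G x = ?H x"
      using AE_lebesgue_not_in_negligible[OF N] by eventually_elim (rule eq)
  qed (use iG iHl in \<open>auto intro: borel_measurable_integrable\<close>)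
  also have "\<dots> = integral\<^sup>L lborel ?H"
    using iH by (intro integral_completion borel_measurable_integrable)
  also have "\<dots> = (\<Sum>K\<in>cells M. LINT x:K|lborel. hK K x)"
    unfolding set_lebesgue_integral_def by (intro Bochner_Integration.integral_sum iK)
  finally show "(LINT x:region M|lebesgue. h x) = \<dots>" .
qed

lemma piecewise_cont_integrable:
  assumes "piecewise_cont M f" shows "set_integrable lebesgue (region M) f"
proof -
  obtain hK where "\<And>K. K \<in> cells M \<Longrightarrow> continuous_on UNIV (hK K) \<and> (\<forall>x\<in>interior K. f x = hK K x)"
    using assms unfolding piecewise_cont_def by metis
  then show ?thesis by (intro piecewise_integral(1)) auto
qed

lemma L2_space_piecewise_cont:
  assumes "w \<in> L2_space M q" shows "piecewise_cont M w"
proof -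
  obtain p where p: "\<And>K. K \<in> cells M \<Longrightarrow> real_polynomial_function (p K)"
    "\<And>K x. K \<in> cells M \<Longrightarrow> x \<in> interior K \<Longrightarrow> w x = p K x"
    using L2_space_trace[OF mesh assms] by metis
  then show ?thesis
    unfolding piecewise_cont_def
    by (metis continuous_on_polymonial_function real_polynomial_function_eq)
qed

text \<open>
  \<open>w v \<sqdot> \<nabla>w\<close> is half the divergence of the field \<open>w\<^sup>2 v\<close>, whose components are the polynomials \<open>g b\<close>.
\<close>
lemma advection_integral:
  assumes w: "w \<in> L2_space M q" and v: "v \<in> Hdiv_space M"
    and div: "\<forall>K\<in>cells M. \<forall>x\<in>interior K. divergence v x = 0"
  shows "piecewise_cont M (\<lambda>x. w x * (v x \<bullet> grad w x))"
    and "(LINT x:region M|lebesgue. w x * (v x \<bullet> grad w x)) =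
      ((\<Sum>e\<in>gamma_faces M. gamma_flux M w v e) + boundary_flux M (free_boundary_facets M) w v) / 2"
proof -
  obtain p where p: "\<And>K. K \<in> cells M \<Longrightarrow> real_polynomial_function (p K)"
    "\<And>K x. K \<in> cells M \<Longrightarrow> x \<in> interior K \<Longrightarrow> w x = p K x"
    "\<And>K x. K \<in> cells M \<Longrightarrow> x \<in> K \<Longrightarrow> trace_from K w x = p K x"
    using L2_space_trace[OF mesh w] by metis
  obtain u where u: "\<And>K. K \<in> cells M \<Longrightarrow> polynomial_function (u K)"
    "\<And>K x. K \<in> cells M \<Longrightarrow> x \<in> interior K \<Longrightarrow> v x = u K x"
    "\<And>K x. K \<in> cells M \<Longrightarrow> x \<in> K \<Longrightarrow> trace_from K v x = u K x"
    using Hdiv_space_trace[OF mesh v] by metis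
  define g where "g = (\<lambda>K b x. (p K x)\<^sup>2 * (u K x \<bullet> b))"
  have gpoly: "real_polynomial_function (g K b)" if "K \<in> cells M" for K b
    unfolding g_def using p(1)[OF that] polynomial_function_inner[OF u(1)[OF that], of b]
    by (intro real_polynomial_function.intros(4) real_polynomial_function_power)
       (auto simp: real_polynomial_function_eq)
  define H where "H = (\<lambda>K x. (\<Sum>b\<in>Basis. frechet_derivative (g K b) (at x) b) / 2)"
  have Hcont: "continuous_on UNIV (H K)" if K: "K \<in> cells M" for K
    unfolding H_def
    using polytope_divergence_lborel(1)[OF cell[OF mesh K] nonzero_Basis gpoly[OF K]]
    by (intro continuous_intros) auto
  have Hpt: "w x * (v x \<bullet> grad w x) = H K x" if K: "K \<in> cells M" and x: "x \<in> interior K" for K x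
  proof -
    define D where "D = frechet_derivative (p K) (at x)"
    define E where "E = frechet_derivative (u K) (at x)"
    have pd: "p K differentiable (at x)" using p(1)[OF K] by (rule differentiable_at_real_polynomial_function)
    have ud: "u K differentiable (at x)" using u(1)[OF K] by (rule differentiable_at_polynomial_function)
    have D: "(p K has_derivative D) (at x)" using pd by (simp add: D_def frechet_derivative_works)
    have E: "(u K has_derivative E) (at x)" using ud by (simp add: E_def frechet_derivative_works)
    have "frechet_derivative w (at x) = D"
      unfolding D_def by (rule frechet_derivative_cong_open[OF open_interior x p(2)[OF K] pd])
    then have grad: "v x \<bullet> grad w x = (\<Sum>b\<in>Basis. D b * (u K x \<bullet> b))"
      by (simp add: grad_def inner_sum_right u(2)[OF K x])
    have "frechet_derivative v (at x) = E"
      unfolding E_def by (rule frechet_derivative_cong_open[OF open_interior x u(2)[OF K] ud])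
    moreover have "divergence v x = 0" using div K x by blast
    ultimately have div0: "(\<Sum>b\<in>Basis. E b \<bullet> b) = 0" by (simp add: divergence_def)
    have gD: "frechet_derivative (g K b) (at x) b = 2 * p K x * (D b * (u K x \<bullet> b)) + (p K x)\<^sup>2 * (E b \<bullet> b)" for b
    proof -
      have "(g K b has_derivative (\<lambda>h. (p K x)\<^sup>2 * (E h \<bullet> b) + (2 * p K x * D h) * (u K x \<bullet> b))) (at x)"
        unfolding g_def by (auto intro!: derivative_eq_intros D E)
      from frechet_derivative_at[OF this] show ?thesis by (metis (no_types, lifting) add.commute mult.assoc)
    qed
    \<comment> \<open>The second sum is the divergence of the velocity and vanishes; the factor 2
      from differentiating the square cancels the division by 2 in \<open>H\<close>.\<close>
    have "H K x = p K x * (\<Sum>b\<in>Basis. D b * (u K x \<bullet> b)) + (p K x)\<^sup>2 * (\<Sum>b\<in>Basis. E b \<bullet> b) / 2"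
      unfolding H_def gD by (simp add: sum.distrib sum_distrib_left[symmetric] mult.assoc)
    then show ?thesis by (simp add: grad div0 p(2)[OF K x])
  qed
  show "piecewise_cont M (\<lambda>x. w x * (v x \<bullet> grad w x))"
    unfolding piecewise_cont_def using Hcont Hpt by blast
  have "(LINT x:region M|lebesgue. w x * (v x \<bullet> grad w x)) = (\<Sum>K\<in>cells M. LINT x:K|lborel. H K x)"
    by (rule piecewise_integral(2)[OF Hcont Hpt])
  also have "\<dots> = (\<Sum>K\<in>cells M. (\<Sum>F | F facet_of K. cell_flux w v K F) / 2)"
  proof (intro sum.cong refl)
    fix K assume K: "K \<in> cells M"
    note cK = cell[OF mesh K]
    have "(LINT x:K|lborel. H K x) = (LINT x:K|lborel. \<Sum>b\<in>Basis. frechet_derivative (g K b) (at x) b) / 2"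
      unfolding H_def by simp
    also have "(LINT x:K|lborel. \<Sum>b\<in>Basis. frechet_derivative (g K b) (at x) b) =
      (\<Sum>F | F facet_of K. surface_integral (outward_normal K F) F
         (\<lambda>x. \<Sum>b\<in>Basis. (outward_normal K F \<bullet> b) * g K b x))"
      by (rule polytope_divergence[OF cK gpoly[OF K]])
    also have "\<dots> = (\<Sum>F | F facet_of K. cell_flux w v K F)"
    proof (intro sum.cong refl)
      fix F assume "F \<in> {F. F facet_of K}"
      then have F: "F facet_of K" by simp
      show "surface_integral (outward_normal K F) F (\<lambda>x. \<Sum>b\<in>Basis. (outward_normal K F \<bullet> b) * g K b x) =
        cell_flux w v K F"
        unfolding cell_flux_def
      proof (rule surface_integral_cong[OF norm_outward_normal[OF cK F] facet_subset_hyperplane[OF cK F]])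
        fix x assume "x \<in> F"
        then have x: "x \<in> K" using facet_of_imp_subset[OF F] by blast
        have "(\<Sum>b\<in>Basis. (outward_normal K F \<bullet> b) * g K b x) =
          (p K x)\<^sup>2 * (\<Sum>b\<in>Basis. (u K x \<bullet> b) * (outward_normal K F \<bullet> b))"
          by (simp add: g_def sum_distrib_left mult_ac)
        also have "(\<Sum>b\<in>Basis. (u K x \<bullet> b) * (outward_normal K F \<bullet> b)) = u K x \<bullet> outward_normal K F"
          by (rule euclidean_inner[symmetric])
        finally show "(\<Sum>b\<in>Basis. (outward_normal K F \<bullet> b) * g K b x) =
          (trace_from K w x)\<^sup>2 * (trace_from K v x \<bullet> outward_normal K F)"
          by (simp add: p(3)[OF K x] u(3)[OF K x])
      qed
    qed
    finally show "(LINT x:K|lborel. H K x) = (\<Sum>F | F facet_of K. cell_flux w v K F) / 2" .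
  qed
  also have "\<dots> = (\<Sum>K\<in>cells M. \<Sum>F | F facet_of K. cell_flux w v K F) / 2"
    by (simp add: sum_divide_distrib)
  finally show "(LINT x:region M|lebesgue. w x * (v x \<bullet> grad w x)) =
      ((\<Sum>e\<in>gamma_faces M. gamma_flux M w v e) + boundary_flux M (free_boundary_facets M) w v) / 2"
    by (simp add: sum_cell_flux[OF mesh w v])
qed

section \<open>Energy identities of the two schemes\<close>

lemma gamma_integral_average_jump:
  "gamma_integral M (\<lambda>e x. (upwind_value M e v x \<bullet> face_normal M (fst e)) * average M e w x * jump M e w x) =
    (\<Sum>e\<in>gamma_faces M. gamma_flux M w v e) / 2"
proof -
  have "(\<lambda>x. (upwind_value M e v x \<bullet> face_normal M (fst e)) * average M e w x * jump M e w x) =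
    (\<lambda>x. (1 / 2) * ((upwind_value M e v x \<bullet> face_normal M (fst e)) *
        ((upwind_value M e w x)\<^sup>2 - (downwind_value M e w x)\<^sup>2)))" for e
    by (auto simp: fun_eq_iff average_def jump_def power2_eq_square field_simps)
  then have "surface_integral (face_normal M (fst e)) (fst e)
      (\<lambda>x. (upwind_value M e v x \<bullet> face_normal M (fst e)) * average M e w x * jump M e w x) =
    gamma_flux M w v e / 2" for e
    by (simp only: surface_integral_cmult gamma_flux_def)
  then show ?thesis unfolding gamma_integral_def sum_divide_distrib by (simp only:)
qed

lemma gamma_flux_no_jump:
  assumes "(F, s) \<in> gamma_faces M" "\<And>x. x \<in> F \<Longrightarrow> jump M (F, s) w x = 0"
  shows "gamma_flux M w v (F, s) = 0"
proof -
  obtain c where "F \<subseteq> {x. face_normal M F \<bullet> x = c}" using face_normal(2)[OF mesh assms(1)] by blast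
  then show ?thesis
    unfolding gamma_flux_def fst_conv
    by (rule surface_integral_zero[OF face_normal(1)[OF mesh assms(1)]])
       (use assms(2) in \<open>simp add: jump_def\<close>)
qed

text \<open>Continuity is given on the open domain only, while the edge of F may touch the boundary.
  So the two traces are compared on the relative interior of F, and the polynomials then agree on
  all of F by continuity.\<close>

lemma H1_space_jump:
  assumes w: "w \<in> H1_space M q" and e: "(F, s) \<in> gamma_faces M" and x: "x \<in> F"
  shows "jump M (F, s) w x = 0"
proof (cases "(F, s) \<in> periodic M")
  case True
  then show ?thesis using w x by (auto simp: H1_space_def)
next
  case False
  then have F: "F \<in> interior_facets M" and s: "s = 0" using e by (auto simp: gamma_faces_def)
  have wL: "w \<in> L2_space M q" and wc: "continuous_on (region M) w" using w by (auto simp: H1_space_def)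
  obtain p where p: "\<And>K. K \<in> cells M \<Longrightarrow> real_polynomial_function (p K)"
    "\<And>K x. K \<in> cells M \<Longrightarrow> x \<in> K \<Longrightarrow> trace_from K w x = p K x"
    using L2_space_trace[OF mesh wL] by metis
  obtain K1 K2 where s12: "face_side M (F, 0) (face_normal M F) K1 0"
      "face_side M (F, 0) (- face_normal M F) K2 0" and ne: "K1 \<noteq> K2"
    using interior_face_sides[OF mesh F] by metis
  then have K1: "K1 \<in> cells M" "F facet_of K1" and K2: "K2 \<in> cells M" "F facet_of K2"
    by (auto simp: face_side_def)
  note sub = facet_of_imp_subset[OF K1(2)] facet_of_imp_subset[OF K2(2)]
  have pc: "continuous_on UNIV (p K)" if "K \<in> cells M" for K
    using p(1)[OF that] by (auto simp: real_polynomial_function_eq intro: continuous_on_polymonial_function)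
  have on_rel: "p K1 y - p K2 y = 0" if y: "y \<in> rel_interior F" for y
  proof -
    have "y \<in> region M" using interior_facet_region[OF mesh K1 K2 ne] y by blast
    then have "isCont w y" using wc mesh_region(1)[OF mesh] by (simp add: continuous_on_eq_continuous_at)
    moreover have "y \<in> K1" "y \<in> K2" using y rel_interior_subset sub by blast+
    ultimately have "trace_from K1 w y = w y" "trace_from K2 w y = w y"
      by (simp_all add: trace_from_isCont polytope_imp_convex cell[OF mesh] K1(1) K2(1))
    then show ?thesis using p(2) K1(1) K2(1) \<open>y \<in> K1\<close> \<open>y \<in> K2\<close> by simp
  qed
  have "x \<in> closure (rel_interior F)" using facet_closure_rel_interior[OF mesh K1] x by simp
  moreover have "continuous_on (closure (rel_interior F)) (\<lambda>y. p K1 y - p K2 y)"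
    using pc K1(1) K2(1) by (intro continuous_on_diff) (auto intro: continuous_on_subset)
  ultimately have "p K1 x - p K2 x = 0"
    using continuous_constant_on_closure[of "rel_interior F" "\<lambda>y. p K1 y - p K2 y" 0 x] on_rel by blast
  moreover have "upwind_value M (F, 0) w x = p K1 x"
    using side_value_eq[OF mesh _ s12(1), of w x] e s p(2)[OF K1(1)] sub x by (auto simp: upwind_value_def)
  moreover have "downwind_value M (F, 0) w x = p K2 x"
    using side_value_eq[OF mesh _ s12(2), of w x] e s p(2)[OF K2(1)] sub x by (auto simp: downwind_value_def)
  ultimately show ?thesis by (simp add: jump_def s)
qed

lemma cg_energy_identity:
  assumes w: "w \<in> with_bc M D R (H1_space M q)" and w': "w' \<in> L2_space M q" and v: "v \<in> Hdiv_space M"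
    and eq: "cg_vorticity_eq M (with_bc M D R (H1_space M q)) w w' v"
    and div: "\<forall>K\<in>cells M. \<forall>x\<in>interior K. divergence v x = 0"
    and flux: "boundary_flux M (free_boundary_facets M) w v = 0"
  shows "(LINT x:region M|lebesgue. w x * w' x) = 0"
proof -
  have wH: "w \<in> H1_space M q" using w by (simp add: with_bc_def)
  then have wL: "w \<in> L2_space M q" by (simp add: H1_space_def)
  have "gamma_flux M w v e = 0" if "e \<in> gamma_faces M" for e
    using that gamma_flux_no_jump H1_space_jump[OF wH] by (cases e) blast
  then have "(LINT x:region M|lebesgue. w x * (v x \<bullet> grad w x)) = 0"
    using advection_integral(2)[OF wL v div] flux by simp
  moreover have "(LINT x:region M|lebesgue. w x * w' x + w x * (v x \<bullet> grad w x)) = 0"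
    using eq w by (simp add: cg_vorticity_eq_def distrib_left)
  moreover have "set_integrable lebesgue (region M) (\<lambda>x. w x * w' x)"
    by (intro piecewise_cont_integrable piecewise_cont_mult L2_space_piecewise_cont[OF wL] L2_space_piecewise_cont[OF w'])
  moreover have "set_integrable lebesgue (region M) (\<lambda>x. w x * (v x \<bullet> grad w x))"
    by (intro piecewise_cont_integrable advection_integral(1)[OF wL v div])
  ultimately show ?thesis by (simp add: set_integral_add)
qed

lemma dg_energy_identity:
  assumes w: "w \<in> with_bc M D R (L2_space M q)" and w': "w' \<in> L2_space M q" and v: "v \<in> Hdiv_space M"
    and eq: "dg_vorticity_eq M (with_bc M D R (L2_space M q)) w w' v"
    and div: "\<forall>K\<in>cells M. \<forall>x\<in>interior K. divergence v x = 0"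
    and flux: "boundary_flux M (free_boundary_facets M) w v = 0"
  shows "(LINT x:region M|lebesgue. w x * w' x) = 0"
proof -
  have wL: "w \<in> L2_space M q" using w by (simp add: with_bc_def)
  have "(LINT x:region M|lebesgue. w x * w' x + w x * (v x \<bullet> grad w x)) =
      (\<Sum>e\<in>gamma_faces M. gamma_flux M w v e) / 2"
    using eq w unfolding gamma_integral_average_jump[symmetric] by (simp add: dg_vorticity_eq_def distrib_left)
  moreover have "(LINT x:region M|lebesgue. w x * (v x \<bullet> grad w x)) =
      (\<Sum>e\<in>gamma_faces M. gamma_flux M w v e) / 2"
    using advection_integral(2)[OF wL v div] flux by simp
  moreover have "set_integrable lebesgue (region M) (\<lambda>x. w x * w' x)"
    by (intro piecewise_cont_integrable piecewise_cont_mult L2_space_piecewise_cont[OF wL] L2_space_piecewise_cont[OF w'])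
  moreover have "set_integrable lebesgue (region M) (\<lambda>x. w x * (v x \<bullet> grad w x))"
    by (intro piecewise_cont_integrable advection_integral(1)[OF wL v div])
  ultimately show ?thesis by (simp add: set_integral_add)
qed

text \<open>With the remainder \<rho> defined by w(s) = w(t) + (s - t) (w'(t) + \<rho>), the
  difference quotient of the enstrophy is twice the integral of w w', which vanishes by
  \<open>orth\<close>, plus terms containing \<rho> or s - t. The cross term w \<rho> is controlled
  by Young's inequality with a weight adapted to s.\<close>

lemma enstrophy_derivative:
  assumes pc: "\<And>t. t \<in> I \<Longrightarrow> piecewise_cont M (w t)" "\<And>t. t \<in> I \<Longrightarrow> piecewise_cont M (w' t)"
    and t: "t \<in> I"
    and lim: "((\<lambda>s. LINT x:region M|lebesgue. ((w s x - w t x) / (s - t) - w' t x)\<^sup>2) \<longlongrightarrow> 0) (at t within I)"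
    and orth: "(LINT x:region M|lebesgue. w t x * w' t x) = 0"
  shows "((\<lambda>s. LINT x:region M|lebesgue. (w s x)\<^sup>2) has_real_derivative 0) (at t within I)"
proof -
  note int = piecewise_cont_integrable
  let ?S = "\<lambda>f. LINT x:region M|lebesgue. f x"
  define A where "A = (\<lambda>s. LINT x:region M|lebesgue. ((w s x - w t x) / (s - t) - w' t x)\<^sup>2)"
  define B where "B = (LINT x:region M|lebesgue. (w t x)\<^sup>2)"
  define C where "C = (LINT x:region M|lebesgue. (w' t x)\<^sup>2)"
  define X where "X = (\<lambda>s. ((LINT x:region M|lebesgue. (w s x)\<^sup>2) - B) / (s - t))"
  \<comment> \<open>This is what the integral of the majorant \<open>g\<close> becomes once
    \<open>A s / \<epsilon>\<close> is estimated by \<open>sqrt (A s)\<close>.\<close>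
  define Y where "Y = (\<lambda>s. (sqrt (A s) + \<bar>s - t\<bar>) * B + sqrt (A s) + 2 * \<bar>s - t\<bar> * (C + A s))"
  have A0: "A s \<ge> 0" for s
    unfolding A_def set_lebesgue_integral_def by (rule integral_nonneg_AE) simp
  have bound: "\<bar>X s\<bar> \<le> Y s" if s: "s \<in> I" "s \<noteq> t" for s
  proof -
    define \<rho> where "\<rho> = (\<lambda>x. (w s x - w t x) / (s - t) - w' t x)"
    \<comment> \<open>The Young weight: it tends to 0, yet dominates \<open>sqrt (A s)\<close>, so
      that \<open>A s / \<epsilon>\<close> tends to 0 as well. The summand
      \<open>\<bar>s - t\<bar>\<close> keeps it positive when \<open>A s = 0\<close>.\<close>
    define \<epsilon> where "\<epsilon> = sqrt (A s) + \<bar>s - t\<bar>"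
    have \<epsilon>: "\<epsilon> > 0" using s A0[of s] by (simp add: \<epsilon>_def add_nonneg_pos)
    have p\<rho>: "piecewise_cont M \<rho>" unfolding \<rho>_def by (intro piecewise_cont_intros pc s t)
    note pcs = pc(1)[OF t] pc(2)[OF t] pc(1)[OF s(1)] p\<rho>
    have A\<rho>: "A s = (LINT x:region M|lebesgue. (\<rho> x)\<^sup>2)" by (simp add: A_def \<rho>_def)
    define f where "f = (\<lambda>x. 2 * (w t x * \<rho> x) + (s - t) * (w' t x + \<rho> x)\<^sup>2)"
    define g where "g = (\<lambda>x. \<epsilon> * (w t x)\<^sup>2 + (\<rho> x)\<^sup>2 / \<epsilon> + 2 * \<bar>s - t\<bar> * ((w' t x)\<^sup>2 + (\<rho> x)\<^sup>2))"
    have pf: "piecewise_cont M f" unfolding f_def by (intro piecewise_cont_intros pcs)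
    have pg: "piecewise_cont M g" unfolding g_def by (intro piecewise_cont_intros pcs)
    have i2: "set_integrable lebesgue (region M) (\<lambda>x. (w t x)\<^sup>2)"
      "set_integrable lebesgue (region M) (\<lambda>x. (w s x)\<^sup>2)"
      "set_integrable lebesgue (region M) (\<lambda>x. (w' t x)\<^sup>2)"
      "set_integrable lebesgue (region M) (\<lambda>x. (\<rho> x)\<^sup>2)"
      "set_integrable lebesgue (region M) (\<lambda>x. w t x * w' t x)"
      by (intro int piecewise_cont_intros pcs)+
    have wt: "w s x = w t x + (s - t) * (w' t x + \<rho> x)" for x using s by (simp add: \<rho>_def)
    have pt: "((w s x)\<^sup>2 - (w t x)\<^sup>2) / (s - t) = 2 * (w t x * w' t x) + f x" for x
      using s unfolding wt[of x] f_def by (simp add: power2_eq_square field_simps)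
    have "X s = (LINT x:region M|lebesgue. ((w s x)\<^sup>2 - (w t x)\<^sup>2) / (s - t))"
      by (simp add: X_def B_def set_integral_diff i2)
    also have "\<dots> = (LINT x:region M|lebesgue. 2 * (w t x * w' t x)) + ?S f"
      unfolding pt by (intro set_integral_add(2) int pf piecewise_cont_intros pcs)
    finally have X: "X s = ?S f" using orth by simp
    have fg: "\<bar>f x\<bar> \<le> g x" for x
    proof -
      have "0 \<le> (\<epsilon> * w t x - \<rho> x)\<^sup>2 / \<epsilon>" "0 \<le> (\<epsilon> * w t x + \<rho> x)\<^sup>2 / \<epsilon>" using \<epsilon> by simp_all
      then have 1: "\<bar>2 * (w t x * \<rho> x)\<bar> \<le> \<epsilon> * (w t x)\<^sup>2 + (\<rho> x)\<^sup>2 / \<epsilon>"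
        using \<epsilon> by (simp add: power2_eq_square field_simps abs_le_iff)
      have "0 \<le> (w' t x - \<rho> x)\<^sup>2" by simp
      then have "(w' t x + \<rho> x)\<^sup>2 \<le> 2 * ((w' t x)\<^sup>2 + (\<rho> x)\<^sup>2)"
        by (simp add: power2_eq_square algebra_simps)
      then have "\<bar>s - t\<bar> * (w' t x + \<rho> x)\<^sup>2 \<le> \<bar>s - t\<bar> * (2 * ((w' t x)\<^sup>2 + (\<rho> x)\<^sup>2))"
        by (intro mult_left_mono) auto
      then have 2: "\<bar>(s - t) * (w' t x + \<rho> x)\<^sup>2\<bar> \<le> 2 * \<bar>s - t\<bar> * ((w' t x)\<^sup>2 + (\<rho> x)\<^sup>2)"
        by (simp only: abs_mult abs_power2 mult_ac)
      show ?thesis unfolding f_def g_def using 1 2 by linarith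
    qed
    have "?S f \<le> ?S g"
      by (intro set_integral_mono int pf pg) (use fg abs_le_D1 in blast)
    moreover have "(LINT x:region M|lebesgue. - f x) \<le> ?S g"
      using piecewise_cont_diff[OF piecewise_cont_const[of M 0] pf]
      by (intro set_integral_mono int pg) (use fg abs_le_D2 in auto)
    ultimately have "\<bar>X s\<bar> \<le> ?S g"
      unfolding X by (simp add: set_lebesgue_integral_def)
    also have "?S g = \<epsilon> * B + A s / \<epsilon> + 2 * \<bar>s - t\<bar> * (C + A s)"
      unfolding g_def A\<rho> B_def C_def by (simp add: set_integral_add i2)
    also have "A s / \<epsilon> \<le> sqrt (A s)"
    proof -
      have "A s = sqrt (A s) * sqrt (A s)" using A0 by simp
      also have "\<dots> \<le> sqrt (A s) * \<epsilon>" using A0 by (intro mult_left_mono) (auto simp: \<epsilon>_def)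
      finally show ?thesis using \<epsilon> by (simp add: divide_le_eq)
    qed
    finally show ?thesis by (simp add: Y_def \<epsilon>_def)
  qed
  have "(A \<longlongrightarrow> 0) (at t within I)" using lim by (simp add: A_def)
  then have "(Y \<longlongrightarrow> (sqrt 0 + \<bar>t - t\<bar>) * B + sqrt 0 + 2 * \<bar>t - t\<bar> * (C + 0)) (at t within I)"
    unfolding Y_def by (intro tendsto_intros)
  then have Y: "(Y \<longlongrightarrow> 0) (at t within I)" by simp
  have "(X \<longlongrightarrow> 0) (at t within I)"
  proof (rule Lim_null_comparison[OF _ Y])
    show "\<forall>\<^sub>F s in at t within I. norm (X s) \<le> Y s"
      using bound by (auto simp: eventually_at_filter)
  qed
  then show ?thesis by (simp add: has_field_derivative_iff X_def B_def)
qed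

section \<open>Boundary conditions that make the boundary flux vanish\<close>

lemma boundary_flux_zero:
  assumes "\<forall>F\<in>boundary_facets M. F \<in> identified_facets M \<or>
      (\<forall>x\<in>F. boundary_value M F \<omega> x = 0 \<or> boundary_value M F u x \<bullet> boundary_normal M F = 0)"
  shows "boundary_flux M (free_boundary_facets M) \<omega> u = 0"
  unfolding boundary_flux_def
proof (intro sum.neutral ballI)
  fix F assume F: "F \<in> free_boundary_facets M"
  then have b: "F \<in> boundary_facets M" by (simp add: free_boundary_facets_def)
  note K = boundary_cell[OF mesh b]
  show "surface_integral (boundary_normal M F) F
     (\<lambda>x. (boundary_value M F \<omega> x)\<^sup>2 * (boundary_value M F u x \<bullet> boundary_normal M F)) = 0"
  proof (rule surface_integral_zero)
    show "norm (boundary_normal M F) = 1"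
      unfolding boundary_normal_def by (rule norm_outward_normal[OF cell[OF mesh K(1)] K(2)])
    show "F \<subseteq> {x. boundary_normal M F \<bullet> x = facet_level (boundary_cell M F) F}"
      unfolding boundary_normal_def by (rule facet_subset_hyperplane[OF cell[OF mesh K(1)] K(2)])
  qed (use assms F in \<open>auto simp: free_boundary_facets_def\<close>)
qed

text \<open>When the values of w match, the two fluxes of each identified pair cancel. So the flux
  condition is the same whether identified facets are counted as boundary or as internal
  faces.\<close>

lemma boundary_flux_periodic:
  assumes w: "w \<in> L2_space M q" and v: "v \<in> Hdiv_space M"
    and jump: "\<forall>(F, s)\<in>periodic M. \<forall>x\<in>F. jump M (F, s) w x = 0"
  shows "boundary_flux M (boundary_facets M) w v = boundary_flux M (free_boundary_facets M) w v"
proof -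
  have "gamma_flux M w v e = 0" if "e \<in> periodic M" for e
    using that jump by (cases e) (auto intro!: gamma_flux_no_jump simp: gamma_faces_def)
  then show ?thesis using boundary_flux_boundary_facets[OF mesh w v] by simp
qed

end

theorem theorem3p3:
  fixes M :: "'a::euclidean_space fe_mesh"
    and p :: nat
    and I :: "real set"
    and D :: "'a set set"
    and R :: "('a set \<times> 'a) set"
    and w w' :: "real \<Rightarrow> 'a \<Rightarrow> real"
    and v :: "real \<Rightarrow> 'a \<Rightarrow> 'a"
  assumes mesh: "fe_mesh M"
    and bc_w: "D \<subseteq> free_boundary_facets M" "R \<subseteq> periodic M"
    and time: "is_interval I"
    and C1: "C1_curve (region M) I w w'"
    and velocity: "\<forall>t\<in>I. v t \<in> Hdiv_space M"
    and weak_form: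
      "(\<forall>t\<in>I. w t \<in> with_bc M D R (H1_space M p) \<and> w' t \<in> with_bc M D R (H1_space M p) \<and>
          cg_vorticity_eq M (with_bc M D R (H1_space M p)) (w t) (w' t) (v t)) \<or>
       (\<forall>t\<in>I. w t \<in> with_bc M D R (L2_space M p) \<and> w' t \<in> with_bc M D R (L2_space M p) \<and>
          dg_vorticity_eq M (with_bc M D R (L2_space M p)) (w t) (w' t) (v t))"
    and div_free: "\<forall>t\<in>I. \<forall>K\<in>cells M. \<forall>x\<in>interior K. divergence (v t) x = 0"
  shows
    "((\<forall>t\<in>I. boundary_flux M (free_boundary_facets M) (w t) (v t) = 0) \<longrightarrow>
        (\<forall>t\<in>I. ((\<lambda>s. LINT x:region M|lebesgue. (w s x)\<^sup>2) has_real_derivative 0) (at t within I))) \<and>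
     (\<forall>\<omega>\<in>L2_space M p. \<forall>u\<in>Hdiv_space M.
        (\<forall>F\<in>boundary_facets M.
            F \<in> identified_facets M \<or>
            (\<forall>x\<in>F. boundary_value M F \<omega> x = 0 \<or>
                  boundary_value M F u x \<bullet> boundary_normal M F = 0)) \<longrightarrow>
        boundary_flux M (free_boundary_facets M) \<omega> u = 0) \<and>
     (\<forall>\<omega>\<in>L2_space M p. \<forall>u\<in>Hdiv_space M.
        (\<forall>(F, s)\<in>periodic M. \<forall>x\<in>F. jump M (F, s) \<omega> x = 0) \<longrightarrow>
        boundary_flux M (boundary_facets M) \<omega> u =
        boundary_flux M (free_boundary_facets M) \<omega> u)"
proof (intro conjI impI ballI)
  fix t
  assume flux: "\<forall>t\<in>I. boundary_flux M (free_boundary_facets M) (w t) (v t) = 0" and t: "t \<in> I"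
  have L2: "w t \<in> L2_space M p \<and> w' t \<in> L2_space M p" if "t \<in> I" for t
    using weak_form that by (auto simp: with_bc_def H1_space_def)
  have "(LINT x:region M|lebesgue. w t x * w' t x) = 0"
    using weak_form
  proof
    assume "\<forall>t\<in>I. w t \<in> with_bc M D R (H1_space M p) \<and> w' t \<in> with_bc M D R (H1_space M p) \<and>
          cg_vorticity_eq M (with_bc M D R (H1_space M p)) (w t) (w' t) (v t)"
    then show ?thesis using cg_energy_identity[OF mesh] L2 velocity div_free flux t by blast
  next
    assume "\<forall>t\<in>I. w t \<in> with_bc M D R (L2_space M p) \<and> w' t \<in> with_bc M D R (L2_space M p) \<and>
          dg_vorticity_eq M (with_bc M D R (L2_space M p)) (w t) (w' t) (v t)"
    then show ?thesis using dg_energy_identity[OF mesh] L2 velocity div_free flux t by blast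
  qed
  moreover have "((\<lambda>s. LINT x:region M|lebesgue. ((w s x - w t x) / (s - t) - w' t x)\<^sup>2) \<longlongrightarrow> 0) (at t within I)"
    using C1 t by (simp add: C1_curve_def)
  ultimately show "((\<lambda>s. LINT x:region M|lebesgue. (w s x)\<^sup>2) has_real_derivative 0) (at t within I)"
    using L2 L2_space_piecewise_cont[OF mesh] t by (intro enstrophy_derivative[OF mesh]) auto
qed (use boundary_flux_zero[OF mesh] boundary_flux_periodic[OF mesh] in blast)+

end
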